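(* Let $(\mathcal J,\mathcal F_1,\dots,\mathcal F_r)$ be an $\mathcal{H}$-joints configuration of dimension $(k_1,\dots,k_r)$, where $\mathcal{H}=([d],E,c)$ is a uniformly edge-colored (multi-)hypergraph. Fix a weight function $w:E\rightarrow\mathbb{R}_{\geq 0}$ that covers $\mathcal{H}$ and let $(\bar{w}_1,\dots,\bar{w}_r)$ be its subtotal sequence. Then \[|\mathcal J|\leq C_{\mathcal{H},w}|\mathcal F_1|^{\bar{w}_1}\dots|\mathcal F_r|^{\bar{w}_r},\] where \[C_{\mathcal{H},w}=d!^{|w|-1}\prod_{i=1}^r \left(\frac{1}{k_i!}\right)^{\bar{w}_i}\prod_{e\in c^{-1}(i)}\left(\frac{w(e)}{\bar{w}_i}\right)^{w(e)}.\] Here, we are using the convention that $\left(\frac{w(e)}{\bar{w}_i}\right)^{w(e)}=1$ when $w(e)=0$, even if $\bar{w}_i=0$.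
   Context: $\mathbb{F}$ is a field. $\mathcal{H}=([d],E,c)$ is an edge-colored (multi-)hypergraph with vertex set $[d]$, edge multiset $E$, and coloring $c:E\to[r]$; it is uniformly edge-colored with the coloring $(d-k_1,\dots,d-k_r)$-uniform, meaning that for each color $i$ the preimage $c^{-1}(i)$ is a non-empty $(d-k_i)$-uniform simple hypergraph, where $1\le k_1,\dots,k_r\le d-1$. A weight $w:E\to\mathbb{R}_{\ge0}$ covers $\mathcal{H}$ if $\sum_{e\ni j}w(e)\ge 1$ for all $j\in[d]$; $|w|=\sum_{e\in E}w(e)$, and the subtotal sequence is $\bar w_i=\sum_{e\in c^{-1}(i)}w(e)$. For each $i$, $\mathcal F_i$ is a multi-set of $k_i$-flats (affine subspaces of dimension $k_i$) in $\mathbb{F}^d$. A point $p\in\mathbb{F}^d$ is an $\mathcal{H}$-joint if there exist flats $(F_{p,e})_{e\in E}$ with $F_{p,e}\in\mathcal F_{c(e)}$ and an invertible affine transformation $A:\mathbb{F}^d\to\mathbb{F}^d$ with $A(0)=p$ and $F_{p,e}=A(\operatorname{span}\{\vec e_j\mid j\notin e\})$ for all $e\in E$, where $\vec e_j$ is the $j$-th unit vector. $\mathcal J$ is the set (without multiplicity) of $\mathcal{H}$-joints, and $(\mathcal J,\mathcal F_1,\dots,\mathcal F_r)$ is called an $\mathcal{H}$-joints configuration of dimension $(k_1,\dots,k_r)$. *)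

theory Defs
  imports "HOL-Analysis.Analysis" "HOL-Library.Multiset"
begin

text \<open>
  The vertex set \<open>[d]\<close> is the universe of a finite type \<open>'d\<close>, so \<open>d = CARD('d)\<close> and the ambient
  space is \<open>'a ^ 'd\<close>. Parallel edges are distinguished by labels: \<open>E\<close> is a finite set of
  labels, \<open>V e\<close> is the vertex set of the edge labelled \<open>e\<close>, and \<open>c e\<close> is its color.
\<close>

text \<open>
  The \<open>i\<close>-th color class is simple iff \<open>V\<close> is injective on the labels of color \<open>i\<close>;
  parallel edges of different colors are allowed.
\<close>

definition uniformly_edge_colored ::
  "'e set \<Rightarrow> ('e \<Rightarrow> 'd::finite set) \<Rightarrow> ('e \<Rightarrow> nat) \<Rightarrow> nat \<Rightarrow> (nat \<Rightarrow> nat) \<Rightarrow> bool" where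
  "uniformly_edge_colored E V c r k \<longleftrightarrow>
     finite E \<and> c ` E \<subseteq> {1..r} \<and>
     (\<forall>i\<in>{1..r}. 1 \<le> k i \<and> k i \<le> CARD('d) - 1 \<and>
        {e \<in> E. c e = i} \<noteq> {} \<and>
        inj_on V {e \<in> E. c e = i} \<and>
        (\<forall>e \<in> {e \<in> E. c e = i}. card (V e) = CARD('d) - k i))"

definition covers :: "'e set \<Rightarrow> ('e \<Rightarrow> 'd::finite set) \<Rightarrow> ('e \<Rightarrow> real) \<Rightarrow> bool" where
  "covers E V w \<longleftrightarrow> (\<forall>j. (\<Sum>e\<in>{e \<in> E. j \<in> V e}. w e) \<ge> 1)"

definition subtotal :: "'e set \<Rightarrow> ('e \<Rightarrow> nat) \<Rightarrow> ('e \<Rightarrow> real) \<Rightarrow> nat \<Rightarrow> real" where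
  "subtotal E c w i = (\<Sum>e\<in>{e \<in> E. c e = i}. w e)"

definition is_flat :: "nat \<Rightarrow> ('a::field ^ 'd::finite) set \<Rightarrow> bool" where
  "is_flat k S \<longleftrightarrow> (\<exists>p W. vec.subspace W \<and> vec.dim W = k \<and> S = (\<lambda>x. p + x) ` W)"

definition invertible_affine :: "('a::field ^ 'd::finite \<Rightarrow> 'a ^ 'd) \<Rightarrow> bool" where
  "invertible_affine A \<longleftrightarrow>
     bij A \<and> (\<exists>L b. Vector_Spaces.linear (*s) (*s) L \<and> A = (\<lambda>x. L x + b))"

definition is_joint ::
  "'e set \<Rightarrow> ('e \<Rightarrow> 'd::finite set) \<Rightarrow> ('e \<Rightarrow> nat) \<Rightarrow>
   (nat \<Rightarrow> ('a::field ^ 'd) set multiset) \<Rightarrow> 'a ^ 'd \<Rightarrow> bool" where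
  "is_joint E V c \<F> p \<longleftrightarrow>
     (\<exists>F A. (\<forall>e\<in>E. F e \<in># \<F> (c e)) \<and> invertible_affine A \<and> A 0 = p \<and>
        (\<forall>e\<in>E. F e = A ` vec.span {axis j 1 | j. j \<notin> V e}))"

definition joints_configuration ::
  "'e set \<Rightarrow> ('e \<Rightarrow> 'd::finite set) \<Rightarrow> ('e \<Rightarrow> nat) \<Rightarrow> nat \<Rightarrow> (nat \<Rightarrow> nat) \<Rightarrow>
   ('a::field ^ 'd) set \<Rightarrow> (nat \<Rightarrow> ('a ^ 'd) set multiset) \<Rightarrow> bool" where
  "joints_configuration E V c r k J \<F> \<longleftrightarrow>
     (\<forall>i\<in>{1..r}. \<forall>S. S \<in># \<F> i \<longrightarrow> is_flat (k i) S) \<and>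
     J = {p. is_joint E V c \<F> p}"

text \<open>
  Real exponentiation with \<open>x\<close> to the power \<open>0\<close> equal to \<open>1\<close> for every \<open>x\<close>
  (whereas \<open>0 powr 0 = 0\<close>). Together with \<open>0 / 0 = 0\<close>, it makes
  \<open>rpow (w e / subtotal E c w i) (w e)\<close> equal to \<open>1\<close> whenever \<open>w e = 0\<close>,
  even if the subtotal vanishes.
\<close>

definition rpow :: "real \<Rightarrow> real \<Rightarrow> real" where
  "rpow x a = (if a = 0 then 1 else x powr a)"

definition joints_constant ::
  "'e set \<Rightarrow> ('e \<Rightarrow> 'd::finite set) \<Rightarrow> ('e \<Rightarrow> nat) \<Rightarrow> nat \<Rightarrow> (nat \<Rightarrow> nat) \<Rightarrow> ('e \<Rightarrow> real) \<Rightarrow> real" where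
  "joints_constant E V c r k w =
     fact CARD('d) powr ((\<Sum>e\<in>E. w e) - 1) *
     (\<Prod>i=1..r. (1 / fact (k i)) powr subtotal E c w i *
        (\<Prod>e\<in>{e \<in> E. c e = i}. rpow (w e / subtotal E c w i) (w e)))"

end

theory Submission
  imports Defs "HOL-Library.Function_Algebras"
begin

text \<open>
  Polynomial method. Given integer handicaps \<open>\<alpha>\<close> of the joints, the Taylor coefficients of
  a polynomial of degree \<open>\<le> n\<close> at all joints are processed in the order of \<open>deg \<gamma> - \<alpha> p\<close>;
  those that are not determined by the earlier ones are the leading ones. On a \<open>k\<close>-flat exactly
  \<open>(n + k) choose k\<close> coefficients lead, and a coefficient that leads in the whole space
  projects to one that leads on each flat of its joint. Shearer's inequality therefore bounds
  \<open>(n + d) choose d\<close> by a sum over the joints of products of powers of the shares that each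
  joint gets on its flats. Lowering the handicap of a joint by one diminishes its own share
  by lower order terms only and does not diminish the other shares. This allows handicaps for
  which a weighted sum of shares is at most about \<open>1 / |J|\<close> at every joint; AM-GM and
  \<open>n \<longlonglongrightarrow> \<infinity>\<close> give the bound. Such handicaps exist under a Hall condition; where it
  fails, the inequality for a smaller set of joints implies the one for \<open>J\<close>.

  Polynomials are represented as functions on points with coordinates in \<open>'a poly\<close>, since over
  a finite field a polynomial is not determined by its values.
\<close>

text \<open>A polynomial that vanishes to all orders at one point of a flat vanishes on the flat;
  hence as many coefficients lead on a flat as it has monomials, whatever the order. Any handicaps
  thus give a valid estimate, but a useful one needs balanced shares, and this obstacle shapes the
  proof. A set of joints that contains all joints of too many flats can never be balanced, whence
  the Hall condition. The constant arises as follows, with W = |w|. Every coordinate lies outside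
  edges of total weight at most W - 1, so Shearer takes the exponents w(e) / (W - 1). A flat of
  color i is given the weight w_i / (W |F_i|), where w_i is the subtotal. These weights add up to 1,
  so the average weighted share is 1 / |J|, and AM-GM with weights w(e) / W produces the factors
  (w(e) |F_i| / w_i)^w(e) and |J|^(-W). The leading terms of the binomials give the factorials. The
  resulting bound for |J|^(1 / (W - 1)) is raised to the power W - 1, which turns d! into d!^(W -
  1).\<close>

section \<open>Leading functionals\<close>

text \<open>Rank-nullity for a single functional. Linearity of \<open>c\<close> is asked on
  \<open>W\<close> only: \<open>mcoeff\<close> is additive on polynomials, while the surrounding
  vector space consists of all functions.\<close>

lemma (in vector_space) dim_eq_Suc_dim_kernel:
  assumes W: "subspace W" "finite S" "W \<subseteq> span S"
    and c_add: "\<And>u v. u \<in> W \<Longrightarrow> v \<in> W \<Longrightarrow> c (u + v) = c u + c v"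
    and c_scale: "\<And>r u. u \<in> W \<Longrightarrow> c (scale r u) = r * c u"
    and u: "u \<in> W" "c u \<noteq> 0"
  shows "dim W = Suc (dim {v \<in> W. c v = 0})"
proof -
  let ?K = "{v \<in> W. c v = 0}"
  obtain B where B: "B \<subseteq> ?K" "independent B" "?K \<subseteq> span B" "card B = dim ?K"
    using basis_exists[of ?K] by blast
  have "B \<subseteq> span S" using B(1) W(3) by blast
  then have "finite B" using independent_span_bound[OF W(2) B(2)] by blast
  have c0: "c 0 = 0" using c_scale[of u 0] u by simp
  have K: "subspace ?K"
    using W(1) c0 by (auto simp: subspace_def c_add c_scale)
  have "span B \<subseteq> ?K" using B(1) K span_minimal by blast
  then have nB: "u \<notin> span B" using u by blast
  have ind: "independent (insert u B)" using B(2) nB by (simp add: independent_insert)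
  have "W \<subseteq> span (insert u B)"
  proof
    fix v assume v: "v \<in> W"
    let ?r = "c v / c u"
    have m: "scale (- ?r) u \<in> W" using W(1) u(1) subspace_scale by blast
    have "v + scale (- ?r) u \<in> ?K"
      using c_add[OF v m] c_scale[OF u(1), of "- ?r"] u(2) subspace_add[OF W(1) v m]
      by (simp del: scale_minus_left)
    then have "v + scale (- ?r) u \<in> span (insert u B)"
      using B(3) span_mono[of B "insert u B"] by blast
    moreover have "scale ?r u \<in> span (insert u B)" by (simp add: span_base span_scale)
    ultimately have "v + scale (- ?r) u + scale ?r u \<in> span (insert u B)" by (rule span_add)
    then show "v \<in> span (insert u B)" by (simp add: add.assoc)
  qed
  then have "dim W = card (insert u B)"
    using ind u B(1) by (intro dim_unique[symmetric, THEN sym]) auto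
  also have "\<dots> = Suc (card B)"
    using \<open>finite B\<close> nB span_base by (subst card_insert_disjoint) auto
  finally show ?thesis using B(4) by simp
qed

text \<open>Remove the \<open>R\<close>-least element \<open>a\<close> and pass to its kernel. The
  dimension drops by one exactly if \<open>a\<close> is nonzero on \<open>W\<close>, that is, if
  \<open>a\<close> leads; and since \<open>a\<close> precedes every other \<open>x\<close>, such an
  \<open>x\<close> leads on \<open>W\<close> iff it leads on the kernel without
  \<open>a\<close>.\<close>

lemma (in vector_space) dim_eq_card_leading:
  assumes "finite X" "subspace W" "finite S" "W \<subseteq> span S"
    and "\<And>x u v. x \<in> X \<Longrightarrow> u \<in> W \<Longrightarrow> v \<in> W \<Longrightarrow> c x (u + v) = c x u + c x v"
    and "\<And>x r u. x \<in> X \<Longrightarrow> u \<in> W \<Longrightarrow> c x (scale r u) = r * c x u"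
    and "transp_on X R" "asymp_on X R" "totalp_on X R"
  shows "dim W = card {x \<in> X. \<exists>u\<in>W. c x u \<noteq> 0 \<and> (\<forall>y\<in>X. R y x \<longrightarrow> c y u = 0)} +
    dim {u \<in> W. \<forall>x\<in>X. c x u = 0}"
  using assms
proof (induction "card X" arbitrary: X W)
  case 0
  then show ?case by simp
next
  case (Suc m)
  note fin = Suc.prems(1) and W = Suc.prems(2-4) and lin = Suc.prems(5,6)
  have "X \<noteq> {}" using Suc.hyps(2) by auto
  then obtain a where a: "a \<in> X" "\<And>y. y \<in> X \<Longrightarrow> y \<noteq> a \<Longrightarrow> \<not> R y a"
    using Finite_Set.bex_min_element[OF fin] Suc.prems(7-9) by metis
  have aR: "R a y" if "y \<in> X" "y \<noteq> a" for y
    using a that Suc.prems(9) by (auto simp: totalp_on_def)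
  have nR: "\<not> R a a" "\<And>y. y \<in> X \<Longrightarrow> \<not> R y a"
    using a Suc.prems(8) by (auto simp: asymp_on_def)
  let ?Y = "X - {a}"
  let ?V = "{v \<in> W. c a v = 0}"
  let ?lead = "\<lambda>X W. {x \<in> X. \<exists>u\<in>W. c x u \<noteq> 0 \<and> (\<forall>y\<in>X. R y x \<longrightarrow> c y u = 0)}"
  have z: "c a 0 = 0" using lin(2)[OF a(1), of 0 0] W(1) by (simp add: subspace_0)
  have V: "subspace ?V" using W(1) z lin[OF a(1)] by (auto simp: subspace_def)
  have IH: "dim ?V = card (?lead ?Y ?V) + dim {u \<in> ?V. \<forall>x\<in>?Y. c x u = 0}"
  proof (rule Suc.hyps(1))
    show "m = card ?Y" using Suc.hyps(2) a(1) fin by simp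
    show "transp_on ?Y R" "asymp_on ?Y R" "totalp_on ?Y R"
      using Suc.prems(7-9) by (auto intro: transp_on_subset asymp_on_subset totalp_on_subset)
  qed (use fin W V lin in auto)
  have ker: "{u \<in> ?V. \<forall>x\<in>?Y. c x u = 0} = {u \<in> W. \<forall>x\<in>X. c x u = 0}" using a(1) by auto
  have lead: "?lead X W = ?lead ?Y ?V \<union> (if \<exists>u\<in>W. c a u \<noteq> 0 then {a} else {})"
  proof (rule set_eqI)
    fix x show "x \<in> ?lead X W \<longleftrightarrow> x \<in> ?lead ?Y ?V \<union> (if \<exists>u\<in>W. c a u \<noteq> 0 then {a} else {})"
      using a(1) aR nR by (cases "x = a") auto
  qed
  have fl: "finite (?lead ?Y ?V)" using fin by simp
  show ?case
  proof (cases "\<exists>u\<in>W. c a u \<noteq> 0")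
    case True
    then obtain u where u: "u \<in> W" "c a u \<noteq> 0" by blast
    have "dim W = Suc (dim ?V)"
      using W lin[OF a(1)] u by (intro dim_eq_Suc_dim_kernel) auto
    moreover have "card (?lead X W) = Suc (card (?lead ?Y ?V))"
      unfolding lead using True fl by simp
    ultimately show ?thesis using IH ker by simp
  next
    case False
    then have "?V = W" by auto
    then show ?thesis using IH ker lead False by simp
  qed
qed

section \<open>Polynomial functions\<close>

definition fscale :: "'a::field \<Rightarrow> ('x \<Rightarrow> 'a poly) \<Rightarrow> 'x \<Rightarrow> 'a poly" where
  "fscale r f = (\<lambda>x. smult r (f x))"

interpretation PF: vector_space fscale
  by unfold_locales (auto simp: fscale_def smult_add_right smult_add_left)

definition mon :: "('d::finite \<Rightarrow> nat) \<Rightarrow> ('d \<Rightarrow> 'a::field poly) \<Rightarrow> 'a poly" where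
  "mon \<gamma> x = (\<Prod>i\<in>UNIV. x i ^ \<gamma> i)"

definition var_index :: "'d::finite \<Rightarrow> nat" where
  "var_index = (SOME f. inj f)"

lemma inj_var_index: "inj (var_index :: 'a::finite \<Rightarrow> nat)"
  unfolding var_index_def 
proof -
  show "inj (SOME f :: 'a \<Rightarrow> nat. inj f)"
    using finite_imp_inj_to_nat_seg[of "UNIV :: 'a set"] by (auto intro: someI[of inj])
qed

text \<open>The number with base-\<open>N\<close> digits \<open>\<gamma> i\<close>. Besides the
  Kronecker substitution it serves as a tie-breaker in \<open>before\<close>; its additivity makes
  that order compatible with splitting off the coordinates outside a flat.\<close>

definition code :: "nat \<Rightarrow> ('d::finite \<Rightarrow> nat) \<Rightarrow> nat" where
  "code N \<gamma> = (\<Sum>i\<in>UNIV. \<gamma> i * N ^ var_index i)"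

lemma code_add: "code N (\<gamma> + \<delta>) = code N \<gamma> + code N \<delta>"
  by (simp add: code_def sum.distrib algebra_simps)

text \<open>At the lowest digit where the exponents differ, the remaining terms of the difference
  are divisible by the next power of \<open>N\<close>. So \<open>N\<close> divides a nonzero
  difference of two digits, which is too small for that.\<close>

lemma code_inject:
  assumes "\<And>i. \<gamma> i < N" "\<And>i. \<delta> i < N" "code N \<gamma> = code N \<delta>"
  shows "\<gamma> = \<delta>"
proof (rule ccontr)
  assume "\<gamma> \<noteq> \<delta>"
  then have "\<exists>m i. var_index i = m \<and> \<gamma> i \<noteq> \<delta> i" by auto
  then obtain i where i: "\<gamma> i \<noteq> \<delta> i" and least: "\<And>j. var_index j < var_index i \<Longrightarrow> \<gamma> j = \<delta> j"
    using exists_least_iff[of "\<lambda>m. \<exists>i. var_index i = m \<and> \<gamma> i \<noteq> \<delta> i"] by metis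
  let ?d = "\<lambda>j. int (\<gamma> j) - int (\<delta> j)"
  have "0 = (\<Sum>j\<in>UNIV. ?d j * int N ^ var_index j)"
    using arg_cong[OF assms(3), of int] by (simp add: code_def sum_subtractf algebra_simps)
  also have "\<dots> = ?d i * int N ^ var_index i + (\<Sum>j\<in>UNIV-{i}. ?d j * int N ^ var_index j)"
    by (simp add: sum.remove)
  finally have *: "?d i * int N ^ var_index i = - (\<Sum>j\<in>UNIV-{i}. ?d j * int N ^ var_index j)" by simp
  have "int N ^ Suc (var_index i) dvd (\<Sum>j\<in>UNIV-{i}. ?d j * int N ^ var_index j)"
  proof (rule dvd_sum)
    fix j assume "j \<in> UNIV - {i}"
    then have "var_index j \<noteq> var_index i" using inj_var_index by (auto simp: inj_def)
    then consider "var_index j < var_index i" | "Suc (var_index i) \<le> var_index j" by linarith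
    then show "int N ^ Suc (var_index i) dvd ?d j * int N ^ var_index j"
      by cases (auto simp: least intro!: dvd_mult le_imp_power_dvd simp del: power_Suc)
  qed
  then have "int N * int N ^ var_index i dvd ?d i * int N ^ var_index i"
    unfolding * by simp
  moreover have "N > 0" using assms(1)[of i] by simp
  ultimately have "int N dvd ?d i" by simp
  moreover have "\<bar>?d i\<bar> < int N" using assms(1)[of i] assms(2)[of i] by linarith
  ultimately show False using i zdvd_not_zless[of "\<bar>?d i\<bar>" "int N"] by auto
qed

lemma sum_apply: "(\<Sum>i\<in>S. f i) x = (\<Sum>i\<in>S. f i x)"
  by (induction S rule: infinite_finite_induct) auto

text \<open>Kronecker substitution: the monomials become distinct powers of the indeterminate.\<close>

lemma mon_kronecker: "mon \<gamma> (\<lambda>i. monom 1 (N ^ var_index i)) = monom 1 (code N \<gamma>)"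
proof -
  have "(\<Prod>i\<in>S. monom (1::'a::field) (f i)) = monom 1 (\<Sum>i\<in>S. f i)" if "finite S" for S :: "'b set" and f
    using that by induction (auto simp: mult_monom)
  then show ?thesis by (simp add: mon_def code_def monom_power mult.commute)
qed

lemma finite_exponents_bounded:
  assumes "finite G"
  obtains N :: nat where "\<And>\<gamma> i. \<gamma> \<in> G \<Longrightarrow> \<gamma> (i :: 'd::finite) < N"
proof -
  have "finite ((\<lambda>(\<gamma>, i). \<gamma> i) ` (G \<times> UNIV))" using assms by simp
  then obtain N where "\<forall>x \<in> (\<lambda>(\<gamma>, i). \<gamma> i) ` (G \<times> UNIV). x < N"
    using finite_nat_set_iff_bounded by blast
  then have "\<gamma> i < N" if "\<gamma> \<in> G" for \<gamma> i using that by force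
  then show ?thesis by (rule that)
qed

lemma inj_mon: "inj (mon :: ('d::finite \<Rightarrow> nat) \<Rightarrow> ('d \<Rightarrow> 'a::field poly) \<Rightarrow> 'a poly)"
proof
  fix \<gamma> \<delta> :: "'d \<Rightarrow> nat"
  assume eq: "(mon \<gamma> :: ('d \<Rightarrow> 'a poly) \<Rightarrow> 'a poly) = mon \<delta>"
  obtain N where N: "\<And>\<beta> i. \<beta> \<in> {\<gamma>, \<delta>} \<Longrightarrow> \<beta> i < N"
    using finite_exponents_bounded[of "{\<gamma>, \<delta>}"] by blast
  have "monom (1::'a) (code N \<gamma>) = monom 1 (code N \<delta>)"
    using eq mon_kronecker by metis
  then have "code N \<gamma> = code N \<delta>" by (metis degree_monom_eq one_neq_zero)
  then show "\<gamma> = \<delta>" using N code_inject by blast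
qed

text \<open>Evaluated at a Kronecker point with \<open>N\<close> above all exponents that occur, a
  vanishing combination has its coefficients at distinct powers of the indeterminate.\<close>

lemma independent_mon: "PF.independent (range mon)"
proof
  assume "PF.dependent (range (mon :: ('d::finite \<Rightarrow> nat) \<Rightarrow> ('d \<Rightarrow> 'a::field poly) \<Rightarrow> 'a poly))"
  then obtain t u v where t: "finite t" "t \<subseteq> range (mon :: ('d::finite \<Rightarrow> nat) \<Rightarrow> ('d \<Rightarrow> 'a::field poly) \<Rightarrow> 'a poly)"
    "(\<Sum>v\<in>t. fscale (u v) v) = 0" and v: "v \<in> t" "u v \<noteq> 0"
    unfolding PF.dependent_explicit by blast
  obtain G where G: "finite G" "t = mon ` G"
    using finite_subset_image[OF t(1,2)] by blast
  obtain N where N: "\<And>\<beta> i. \<beta> \<in> G \<Longrightarrow> \<beta> i < N"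
    using finite_exponents_bounded[OF G(1)] by blast
  obtain \<gamma> where \<gamma>: "\<gamma> \<in> G" "v = mon \<gamma>" using v G by blast
  have "0 = (\<Sum>\<beta>\<in>G. fscale (u (mon \<beta>)) (mon \<beta>))"
    using t(3) unfolding G(2) by (subst (asm) sum.reindex) (auto intro: inj_on_subset[OF inj_mon])
  then have "0 = (\<Sum>\<beta>\<in>G. fscale (u (mon \<beta>)) (mon \<beta>)) (\<lambda>i. monom 1 (N ^ var_index i))"
    by (metis zero_fun_apply)
  also have "\<dots> = (\<Sum>\<beta>\<in>G. monom (u (mon \<beta>)) (code N \<beta>))"
    by (simp add: sum_apply fscale_def mon_kronecker smult_monom)
  finally have "0 = coeff (\<Sum>\<beta>\<in>G. monom (u (mon \<beta>)) (code N \<beta>)) (code N \<gamma>)" by (metis coeff_0)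
  also have "\<dots> = (\<Sum>\<beta>\<in>G. if \<beta> = \<gamma> then u (mon \<beta>) else 0)"
    unfolding coeff_sum using \<gamma>(1) N code_inject by (intro sum.cong) (auto, blast)
  also have "\<dots> = u v" using G(1) \<gamma> by simp
  finally show False using v(2) by simp
qed

section \<open>Polynomial functions and their coefficients\<close>

definition poly_span :: "('d::finite \<Rightarrow> nat) set \<Rightarrow> (('d \<Rightarrow> 'a::field poly) \<Rightarrow> 'a poly) set" where
  "poly_span G = PF.span (mon ` G)"

text \<open>\<open>PF.representation\<close> is 0 outside the span of the monomials, so this is a
  coefficient only for \<open>f \<in> poly_span UNIV\<close>; hence that hypothesis below.\<close>

definition mcoeff :: "('d::finite \<Rightarrow> nat) \<Rightarrow> (('d \<Rightarrow> 'a::field poly) \<Rightarrow> 'a poly) \<Rightarrow> 'a" where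
  "mcoeff \<gamma> f = PF.representation (range mon) f (mon \<gamma>)"

lemma subspace_poly_span: "PF.subspace (poly_span G)"
  by (simp add: poly_span_def)

lemma poly_span_add: "f \<in> poly_span G \<Longrightarrow> g \<in> poly_span G \<Longrightarrow> f + g \<in> poly_span G"
  by (simp add: poly_span_def PF.span_add)

lemma poly_span_fscale: "f \<in> poly_span G \<Longrightarrow> fscale r f \<in> poly_span G"
  by (simp add: poly_span_def PF.span_scale)

lemma poly_span_zero: "0 \<in> poly_span G"
  by (simp add: poly_span_def PF.span_zero)

lemma poly_span_sum: "(\<And>i. i \<in> S \<Longrightarrow> f i \<in> poly_span G) \<Longrightarrow> (\<Sum>i\<in>S. f i) \<in> poly_span G"
  by (simp add: poly_span_def PF.span_sum)

lemma poly_span_mono: "G \<subseteq> H \<Longrightarrow> poly_span G \<subseteq> poly_span H"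
  unfolding poly_span_def by (intro PF.span_mono) auto

lemma poly_span_UNIV: "f \<in> poly_span G \<Longrightarrow> f \<in> poly_span UNIV"
  using poly_span_mono[of G UNIV] by blast

lemma mon_in_poly_span: "\<gamma> \<in> G \<Longrightarrow> mon \<gamma> \<in> poly_span G"
  by (simp add: poly_span_def PF.span_base)

lemma poly_span_induct [consumes 1, case_names zero add]:
  assumes "f \<in> poly_span G" "P 0" "\<And>r \<gamma> g. \<gamma> \<in> G \<Longrightarrow> g \<in> poly_span G \<Longrightarrow> P g \<Longrightarrow> P (fscale r (mon \<gamma>) + g)"
  shows "P f"
proof -
  have "f \<in> poly_span G \<and> P f"
    using assms(1) unfolding poly_span_def
  proof (induction rule: PF.span_induct_alt)
    case base
    then show ?case using assms(2) PF.span_zero by blast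
  next
    case (step r x g)
    then obtain \<gamma> where \<gamma>: "\<gamma> \<in> G" "x = mon \<gamma>" by blast
    have "fscale r (mon \<gamma>) + g \<in> PF.span (mon ` G)"
      using \<gamma> step by (blast intro: PF.span_add PF.span_scale PF.span_base)
    moreover have "P (fscale r (mon \<gamma>) + g)"
      using \<gamma> step assms(3) by (metis poly_span_def)
    ultimately show ?case unfolding \<gamma>(2) by (rule conjI)
  qed
  then show ?thesis ..
qed

lemma mcoeff_add: "f \<in> poly_span UNIV \<Longrightarrow> g \<in> poly_span UNIV \<Longrightarrow> mcoeff \<gamma> (f + g) = mcoeff \<gamma> f + mcoeff \<gamma> g"
  by (simp add: mcoeff_def poly_span_def PF.representation_add[OF independent_mon])

lemma mcoeff_fscale: "f \<in> poly_span UNIV \<Longrightarrow> mcoeff \<gamma> (fscale r f) = r * mcoeff \<gamma> f"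
  by (simp add: mcoeff_def poly_span_def PF.representation_scale[OF independent_mon])

lemma mcoeff_zero: "mcoeff \<gamma> 0 = 0"
  by (simp add: mcoeff_def PF.representation_zero)

lemma mcoeff_mon: "mcoeff \<gamma> (mon \<delta>) = (if \<gamma> = \<delta> then 1 else 0)"
  by (simp add: mcoeff_def PF.representation_basis[OF independent_mon] inj_eq[OF inj_mon] eq_commute)

text \<open>Turns vanishing of coefficients, in particular a vanishing order, into membership in a
  span, which is easy to follow through products and substitutions.\<close>

lemma poly_span_iff: "f \<in> poly_span G \<longleftrightarrow> f \<in> poly_span UNIV \<and> (\<forall>\<gamma>. \<gamma> \<notin> G \<longrightarrow> mcoeff \<gamma> f = 0)"
proof safe
  assume f: "f \<in> poly_span G"
  then show "f \<in> poly_span UNIV" by (rule poly_span_UNIV)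
  fix \<gamma> assume "\<gamma> \<notin> G"
  from f show "mcoeff \<gamma> f = 0"
  proof (induction rule: poly_span_induct)
    case (add r \<delta> g)
    have "fscale r (mon \<delta>) \<in> poly_span UNIV" "g \<in> poly_span UNIV"
      using add by (auto intro: poly_span_fscale mon_in_poly_span poly_span_UNIV)
    then have "mcoeff \<gamma> (fscale r (mon \<delta>) + g) = 0"
      using add \<open>\<gamma> \<notin> G\<close> by (auto simp: mcoeff_add mcoeff_fscale mcoeff_mon mon_in_poly_span)
    then show ?case .
  qed (rule mcoeff_zero)
next
  assume f: "f \<in> poly_span UNIV" and z: "\<forall>\<gamma>. \<gamma> \<notin> G \<longrightarrow> mcoeff \<gamma> f = 0"
  let ?r = "PF.representation (range mon) f"
  have eq: "(\<Sum>v | ?r v \<noteq> 0. fscale (?r v) v) = f"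
    using f by (intro PF.sum_nonzero_representation_eq independent_mon) (simp add: poly_span_def)
  have "fscale (?r v) v \<in> poly_span G" if "?r v \<noteq> 0" for v
  proof -
    have "v \<in> range mon" using that by (rule PF.representation_ne_zero)
    then obtain \<gamma> where "v = mon \<gamma>" by blast
    then show ?thesis using z that by (intro poly_span_fscale) (auto simp: mcoeff_def intro: mon_in_poly_span)
  qed
  then have "(\<Sum>v | ?r v \<noteq> 0. fscale (?r v) v) \<in> poly_span G" by (intro poly_span_sum) blast
  with eq show "f \<in> poly_span G" by metis
qed

lemma mcoeff_poly_span: "f \<in> poly_span G \<Longrightarrow> \<gamma> \<notin> G \<Longrightarrow> mcoeff \<gamma> f = 0"
  using poly_span_iff by blast

lemma poly_span_eqI:
  assumes "f \<in> poly_span UNIV" "\<And>\<gamma>. mcoeff \<gamma> f = 0"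
  shows "f = 0"
proof -
  have "f \<in> poly_span {}" using assms poly_span_iff by blast
  then show ?thesis by (simp add: poly_span_def)
qed

lemma mon_mult: "mon \<gamma> * mon \<delta> = mon (\<gamma> + \<delta>)"
  by (rule ext) (simp add: mon_def power_add prod.distrib)

lemma mon_zero: "mon 0 = 1"
  by (rule ext) (simp add: mon_def)

lemma fscale_mult_left: "fscale r f * g = fscale r (f * g)"
  by (rule ext) (simp add: fscale_def)

lemma fscale_mult_right: "f * fscale r g = fscale r (f * g)"
  by (rule ext) (simp add: fscale_def)

lemma poly_span_mult:
  assumes "f \<in> poly_span G" "g \<in> poly_span H" "\<And>\<gamma> \<delta>. \<gamma> \<in> G \<Longrightarrow> \<delta> \<in> H \<Longrightarrow> \<gamma> + \<delta> \<in> K"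
  shows "f * g \<in> poly_span K"
  using assms(1)
proof (induction rule: poly_span_induct)
  case zero
  show ?case using poly_span_zero by (simp only: mult_zero_left)
next
  case (add r \<gamma> f)
  have "mon \<gamma> * g \<in> poly_span K" using assms(2)
  proof (induction rule: poly_span_induct)
    case zero
    show ?case using poly_span_zero by (simp only: mult_zero_right)
  next
    case (add s \<delta> g)
    then have "fscale s (mon (\<gamma> + \<delta>)) + mon \<gamma> * g \<in> poly_span K"
      using assms(3) add \<open>\<gamma> \<in> G\<close> by (blast intro: poly_span_add poly_span_fscale mon_in_poly_span)
    then have "mon \<gamma> * (fscale s (mon \<delta>) + g) \<in> poly_span K"
      by (simp only: distrib_left fscale_mult_right mon_mult)
    then show ?case .
  qed
  then have "fscale r (mon \<gamma> * g) + f * g \<in> poly_span K"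
    using add by (blast intro: poly_span_add poly_span_fscale)
  then have "(fscale r (mon \<gamma>) + f) * g \<in> poly_span K"
    by (simp only: distrib_right fscale_mult_left)
  then show ?case .
qed

lemma poly_span_comp:
  assumes "f \<in> poly_span G" "\<And>\<gamma>. \<gamma> \<in> G \<Longrightarrow> mon \<gamma> \<circ> T \<in> poly_span K"
  shows "f \<circ> T \<in> poly_span K"
  using assms(1)
proof (induction rule: poly_span_induct)
  case zero
  have "0 \<circ> T = 0" by (rule ext) simp
  then show ?case using poly_span_zero by metis
next
  case (add r \<gamma> g)
  have "(fscale r (mon \<gamma>) + g) \<circ> T = fscale r (mon \<gamma> \<circ> T) + (g \<circ> T)"
    by (rule ext) (simp add: fscale_def)
  moreover have "fscale r (mon \<gamma> \<circ> T) + (g \<circ> T) \<in> poly_span K"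
    using add assms(2) by (blast intro: poly_span_add poly_span_fscale)
  ultimately have "(fscale r (mon \<gamma>) + g) \<circ> T \<in> poly_span K" by metis
  then show ?case .
qed

section \<open>Degrees, supports and substitutions\<close>

definition deg :: "('d::finite \<Rightarrow> nat) \<Rightarrow> nat" where
  "deg \<gamma> = (\<Sum>i\<in>UNIV. \<gamma> i)"

definition supported :: "'d set \<Rightarrow> ('d \<Rightarrow> nat) set" where
  "supported U = {\<gamma>. \<forall>i. i \<notin> U \<longrightarrow> \<gamma> i = 0}"

definition project :: "'d set \<Rightarrow> ('d \<Rightarrow> nat) \<Rightarrow> 'd \<Rightarrow> nat" where
  "project U \<gamma> = (\<lambda>i. if i \<in> U then \<gamma> i else 0)"

definition affine_subst :: "('d::finite \<Rightarrow> 'a::field) \<Rightarrow> ('d \<Rightarrow> 'd \<Rightarrow> 'a) \<Rightarrow> ('d \<Rightarrow> 'a poly) \<Rightarrow> 'd \<Rightarrow> 'a poly" where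
  "affine_subst a M x = (\<lambda>i. [:a i:] + (\<Sum>j\<in>UNIV. smult (M i j) (x j)))"

definition shift :: "('d::finite \<Rightarrow> 'a::field) \<Rightarrow> ('d \<Rightarrow> 'a poly) \<Rightarrow> 'd \<Rightarrow> 'a poly" where
  "shift a x = (\<lambda>i. [:a i:] + x i)"

definition restrict_coords :: "'d set \<Rightarrow> ('d \<Rightarrow> 'a::field poly) \<Rightarrow> 'd \<Rightarrow> 'a poly" where
  "restrict_coords U x = (\<lambda>i. if i \<in> U then x i else 0)"

lemma deg_add: "deg (\<gamma> + \<delta>) = deg \<gamma> + deg \<delta>"
  by (simp add: deg_def sum.distrib)

lemma deg_zero: "deg 0 = 0"
  by (simp add: deg_def)

lemma deg_ge: "\<gamma> i \<le> deg \<gamma>"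
  unfolding deg_def by (rule member_le_sum) auto

lemma supported_add: "\<gamma> \<in> supported U \<Longrightarrow> \<delta> \<in> supported U \<Longrightarrow> \<gamma> + \<delta> \<in> supported U"
  by (simp add: supported_def)

lemma supported_zero: "0 \<in> supported U"
  by (simp add: supported_def)

lemma project_in_supported: "project U \<gamma> \<in> supported U"
  by (simp add: supported_def project_def)

lemma project_add_project_Compl: "project U \<gamma> + project (- U) \<gamma> = \<gamma>"
  by (rule ext) (simp add: project_def)

lemma project_supported: "\<gamma> \<in> supported U \<Longrightarrow> project U \<gamma> = \<gamma>"
  by (rule ext) (auto simp: project_def supported_def)

lemma project_add: "project U (\<gamma> + \<delta>) = project U \<gamma> + project U \<delta>"
  by (rule ext) (auto simp: project_def)

lemma project_disjoint: "\<gamma> \<in> supported (- U) \<Longrightarrow> project U \<gamma> = 0"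
  by (rule ext) (auto simp: project_def supported_def)

lemma finite_deg_le: "finite {\<gamma> :: 'd::finite \<Rightarrow> nat. deg \<gamma> \<le> n}"
proof (rule finite_subset)
  show "{\<gamma> :: 'd \<Rightarrow> nat. deg \<gamma> \<le> n} \<subseteq> (UNIV :: 'd set) \<rightarrow>\<^sub>E {..n}"
    using deg_ge by (auto intro: order_trans)
qed (auto intro: finite_PiE)

text \<open>\<open>G\<close> is a grading of exponents. It is used for \<open>deg \<le> n\<close>,
  for \<open>deg = n\<close> and, constant in the degree, for \<open>supported U\<close>.\<close>

lemma poly_span_power:
  assumes G: "0 \<in> G 0" "\<And>m n \<gamma> \<delta>. \<gamma> \<in> G m \<Longrightarrow> \<delta> \<in> G n \<Longrightarrow> \<gamma> + \<delta> \<in> G (m + n)"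
    and f: "f \<in> poly_span (G (1::nat))"
  shows "f ^ k \<in> poly_span (G k)"
proof (induction k)
  case 0
  show ?case using mon_in_poly_span[OF G(1)] by (simp only: mon_zero power_0)
next
  case (Suc k)
  have "f * f ^ k \<in> poly_span (G (1 + k))"
    by (rule poly_span_mult[OF f Suc]) (rule G(2))
  then show ?case by (simp only: power_Suc plus_1_eq_Suc)
qed

lemma poly_span_prod:
  assumes G: "0 \<in> G (0::nat)" "\<And>m n \<gamma> \<delta>. \<gamma> \<in> G m \<Longrightarrow> \<delta> \<in> G n \<Longrightarrow> \<gamma> + \<delta> \<in> G (m + n)"
    and S: "finite S" "\<And>i. i \<in> S \<Longrightarrow> f i \<in> poly_span (G (h i))"
  shows "(\<Prod>i\<in>S. f i) \<in> poly_span (G (\<Sum>i\<in>S. h i))"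
  using S
proof (induction S)
  case empty
  show ?case using mon_in_poly_span[OF G(1)] by (simp only: mon_zero prod.empty sum.empty)
next
  case (insert x S)
  have "f x * (\<Prod>i\<in>S. f i) \<in> poly_span (G (h x + (\<Sum>i\<in>S. h i)))"
    by (rule poly_span_mult[of _ "G (h x)" _ "G (\<Sum>i\<in>S. h i)"]) (use insert G(2) in auto)
  then show ?case using insert(1,2) by (simp only: prod.insert[OF insert(1,2)] sum.insert[OF insert(1,2)])
qed

lemma power_apply: "(f ^ k) x = f x ^ k" for f :: "'x \<Rightarrow> 'b::comm_ring_1"
  by (induction k) auto

lemma prod_apply: "(\<Prod>i\<in>S. f i) x = (\<Prod>i\<in>S. f i x)" for f :: "'i \<Rightarrow> 'x \<Rightarrow> 'b::comm_ring_1"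
  by (induction S rule: infinite_finite_induct) auto

lemma mon_comp: "mon \<gamma> \<circ> T = (\<Prod>i\<in>UNIV. (\<lambda>x. T x i) ^ \<gamma> i)"
  by (rule ext) (simp add: mon_def prod_apply power_apply)

lemma coord_eq_mon: "(\<lambda>x. x j) = mon (\<lambda>i. if i = j then 1 else 0)"
proof
  fix x :: "'a \<Rightarrow> 'b poly"
  have "mon (\<lambda>i. if i = j then 1 else 0) x = (\<Prod>i\<in>UNIV. if i = j then x i else 1)"
    unfolding mon_def by (rule prod.cong) auto
  then show "x j = mon (\<lambda>i. if i = j then 1 else 0) x" by simp
qed

lemma affine_subst_coord_eq:
  "(\<lambda>x. affine_subst a M x i) = fscale (a i) (mon 0) + (\<Sum>j\<in>UNIV. fscale (M i j) (\<lambda>x. x j))"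
  by (rule ext) (simp add: affine_subst_def fscale_def mon_zero sum_apply)

lemma coord_in_poly_span: "(\<lambda>i. if i = j then 1 else 0) \<in> G \<Longrightarrow> (\<lambda>x. x j) \<in> poly_span G"
  unfolding coord_eq_mon by (rule mon_in_poly_span)

lemma deg_unit: "deg (\<lambda>i. if i = j then 1 else 0) = 1"
  by (simp add: deg_def)

text \<open>The condition on \<open>T\<close> is confined to variables that occur in
  \<open>\<gamma>\<close>, so that \<open>mon_shift\<close> need not look at coordinates outside
  \<open>U\<close>.\<close>

lemma mon_comp_in_poly_span:
  assumes "0 \<in> G (0::nat)" "\<And>m n \<gamma> \<delta>. \<gamma> \<in> G m \<Longrightarrow> \<delta> \<in> G n \<Longrightarrow> \<gamma> + \<delta> \<in> G (m + n)"
    and "\<And>i. \<gamma> i \<noteq> 0 \<Longrightarrow> (\<lambda>x. T x i) \<in> poly_span (G 1)"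
  shows "mon \<gamma> \<circ> T \<in> poly_span (G (deg \<gamma>))"
  unfolding mon_comp deg_def
proof (rule poly_span_prod[OF assms(1,2)])
  fix i
  show "(\<lambda>x. T x i) ^ \<gamma> i \<in> poly_span (G (\<gamma> i))"
  proof (cases "\<gamma> i = 0")
    case True
    then show ?thesis using mon_in_poly_span[OF assms(1)] by (simp only: mon_zero power_0)
  next
    case False
    then show ?thesis using poly_span_power[OF assms(1,2)] assms(3) by blast
  qed
qed auto

lemma mon_affine_subst: "mon \<gamma> \<circ> affine_subst a M \<in> poly_span {\<delta>. deg \<delta> \<le> deg \<gamma>}"
proof (rule mon_comp_in_poly_span)
  fix i
  show "(\<lambda>x. affine_subst a M x i) \<in> poly_span {\<delta>. deg \<delta> \<le> 1}"
    unfolding affine_subst_coord_eq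
    by (intro poly_span_add poly_span_fscale mon_in_poly_span poly_span_sum coord_in_poly_span) (auto simp: deg_zero deg_unit)
qed (auto simp: deg_zero deg_add)

lemma mon_linear: "mon \<gamma> \<circ> affine_subst 0 M \<in> poly_span {\<delta>. deg \<delta> = deg \<gamma>}"
proof (rule mon_comp_in_poly_span)
  fix i
  have "(\<Sum>j\<in>UNIV. fscale (M i j) (\<lambda>x. x j)) \<in> poly_span {\<delta>. deg \<delta> = 1}"
    by (intro poly_span_fscale poly_span_sum coord_in_poly_span) (auto simp: deg_unit)
  moreover have "(\<lambda>x. affine_subst 0 M x i) = (\<Sum>j\<in>UNIV. fscale (M i j) (\<lambda>x. x j))"
    unfolding affine_subst_coord_eq by (rule ext) (simp add: fscale_def)
  ultimately show "(\<lambda>x. affine_subst 0 M x i) \<in> poly_span {\<delta>. deg \<delta> = 1}" by metis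
qed (auto simp: deg_zero deg_add)

lemma poly_span_affine_subst_le:
  assumes "f \<in> poly_span {\<gamma>. deg \<gamma> \<le> n}" shows "f \<circ> affine_subst a M \<in> poly_span {\<gamma>. deg \<gamma> \<le> n}"
  using assms
proof (rule poly_span_comp)
  fix \<gamma> :: "'a \<Rightarrow> nat" assume "\<gamma> \<in> {\<gamma>. deg \<gamma> \<le> n}"
  then show "mon \<gamma> \<circ> affine_subst a M \<in> poly_span {\<gamma>. deg \<gamma> \<le> n}"
    using mon_affine_subst poly_span_mono[of "{\<delta>. deg \<delta> \<le> deg \<gamma>}" "{\<gamma>. deg \<gamma> \<le> n}"] by fastforce
qed

lemma poly_span_affine_subst: "f \<in> poly_span UNIV \<Longrightarrow> f \<circ> affine_subst a M \<in> poly_span UNIV"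
  by (erule poly_span_comp) (rule poly_span_UNIV[OF mon_affine_subst])

text \<open>A linear change of coordinates does not lower the vanishing order at the origin.\<close>

lemma poly_span_linear_ge:
  assumes "f \<in> poly_span {\<gamma>. m \<le> deg \<gamma>}" shows "f \<circ> affine_subst 0 M \<in> poly_span {\<gamma>. m \<le> deg \<gamma>}"
  using assms
proof (rule poly_span_comp)
  fix \<gamma> :: "'a \<Rightarrow> nat" assume "\<gamma> \<in> {\<gamma>. m \<le> deg \<gamma>}"
  then show "mon \<gamma> \<circ> affine_subst 0 M \<in> poly_span {\<gamma>. m \<le> deg \<gamma>}"
    using mon_linear poly_span_mono[of "{\<delta>. deg \<delta> = deg \<gamma>}" "{\<gamma>. m \<le> deg \<gamma>}"] by fastforce
qed

lemma mon_shift: 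
  assumes "\<gamma> \<in> supported U" "\<And>i. i \<notin> U \<Longrightarrow> a i = 0" 
  shows "mon \<gamma> \<circ> shift a \<in> poly_span (supported U)"
proof (rule mon_comp_in_poly_span)
  fix i assume "\<gamma> i \<noteq> 0"
  then have i: "i \<in> U" using assms(1) by (auto simp: supported_def)
  have "fscale (a i) (mon 0) + (\<lambda>x. x i) \<in> poly_span (supported U)"
    using i by (intro poly_span_add poly_span_fscale mon_in_poly_span coord_in_poly_span) (auto simp: supported_def)
  moreover have "(\<lambda>x. shift a x i) = fscale (a i) (mon 0) + (\<lambda>x. x i)"
    by (rule ext) (simp add: shift_def fscale_def mon_zero one_pCons)
  ultimately show "(\<lambda>x. shift a x i) \<in> poly_span (supported U)" by metis
qed (auto intro: supported_add supported_zero)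

lemma shift_eq_affine_subst: "shift a = affine_subst a (\<lambda>i j. if i = j then 1 else 0)"
proof (intro ext)
  fix x :: "'a \<Rightarrow> 'b poly" and i :: 'a
  have "(\<Sum>j\<in>UNIV. smult (if i = j then 1 else 0) (x j)) = x i"
    by (subst sum.cong[OF refl, of _ _ "\<lambda>j. if j = i then x j else 0"]) auto
  then show "shift a x i = affine_subst a (\<lambda>i j. if i = j then 1 else 0) x i"
    by (simp add: shift_def affine_subst_def)
qed

lemma mon_restrict: "mon \<gamma> \<circ> restrict_coords U = (if \<gamma> \<in> supported U then mon \<gamma> else 0)"
proof
  fix x :: "'a \<Rightarrow> 'b poly"
  show "(mon \<gamma> \<circ> restrict_coords U) x = (if \<gamma> \<in> supported U then mon \<gamma> else 0) x"
  proof (cases "\<gamma> \<in> supported U")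
    case True
    then have "(\<Prod>i\<in>UNIV. restrict_coords U x i ^ \<gamma> i) = (\<Prod>i\<in>UNIV. x i ^ \<gamma> i)"
      by (intro prod.cong) (auto simp: restrict_coords_def supported_def)
    then show ?thesis using True by (simp add: mon_def)
  next
    case False
    then obtain i where "i \<notin> U" "\<gamma> i \<noteq> 0" by (auto simp: supported_def)
    then have "\<exists>i. restrict_coords U x i ^ \<gamma> i = 0"
      by (intro exI[of _ i]) (auto simp: restrict_coords_def power_0_left)
    then have "(\<Prod>i\<in>UNIV. restrict_coords U x i ^ \<gamma> i) = 0"
      by (simp add: prod_zero_iff)
    then show ?thesis using False by (simp add: mon_def)
  qed
qed

lemma poly_span_restrict: "f \<in> poly_span UNIV \<Longrightarrow> f \<circ> restrict_coords U \<in> poly_span UNIV"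
  by (erule poly_span_comp) (auto simp: mon_restrict poly_span_zero intro: mon_in_poly_span)

lemma mcoeff_restrict:
  assumes "f \<in> poly_span UNIV"
  shows "mcoeff \<gamma> (f \<circ> restrict_coords U) = (if \<gamma> \<in> supported U then mcoeff \<gamma> f else 0)"
  using assms
proof (induction rule: poly_span_induct)
  case zero
  have "0 \<circ> restrict_coords U = 0" by (rule ext) simp
  then have "mcoeff \<gamma> (0 \<circ> restrict_coords U) = (if \<gamma> \<in> supported U then mcoeff \<gamma> 0 else 0)" by (metis mcoeff_zero)
  then show ?case .
next
  case (add r \<delta> g)
  have IH: "mcoeff \<gamma> (g \<circ> restrict_coords U) = (if \<gamma> \<in> supported U then mcoeff \<gamma> g else 0)" by (rule add(3))
  have m: "fscale r (mon \<delta>) \<in> poly_span UNIV" "mon \<delta> \<circ> restrict_coords U \<in> poly_span UNIV"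
    by (auto simp: mon_restrict poly_span_zero intro: mon_in_poly_span poly_span_fscale)
  have "(fscale r (mon \<delta>) + g) \<circ> restrict_coords U =
    fscale r (mon \<delta> \<circ> restrict_coords U) + (g \<circ> restrict_coords U)"
    by (rule ext) (simp add: fscale_def)
  then have "mcoeff \<gamma> ((fscale r (mon \<delta>) + g) \<circ> restrict_coords U) =
    r * mcoeff \<gamma> (mon \<delta> \<circ> restrict_coords U) + mcoeff \<gamma> (g \<circ> restrict_coords U)"
    by (simp only: mcoeff_add[OF poly_span_fscale[OF m(2)] poly_span_restrict[OF add(2)]] mcoeff_fscale[OF m(2)])
  also have "\<dots> = (if \<gamma> \<in> supported U then mcoeff \<gamma> (fscale r (mon \<delta>) + g) else 0)"
    using m add(2) by (auto simp: IH mcoeff_add mcoeff_fscale mon_in_poly_span mon_restrict mcoeff_mon mcoeff_zero)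
  finally show ?case .
qed

section \<open>Taylor coefficients transverse to a flat\<close>

interpretation PFP: vector_space_pair fscale fscale ..

text \<open>Sort \<open>f\<close> by the monomials in the variables outside \<open>U\<close>: this
  is the polynomial in the \<open>U\<close>-variables that multiplies \<open>mon \<nu>\<close>. It
  replaces a derivative transverse to the flat, which could vanish in positive characteristic.
  \<open>PFP.construct\<close> makes it linear on all functions.\<close>

definition slice :: "'d::finite set \<Rightarrow> ('d \<Rightarrow> nat) \<Rightarrow> (('d \<Rightarrow> 'a::field poly) \<Rightarrow> 'a poly) \<Rightarrow> ('d \<Rightarrow> 'a poly) \<Rightarrow> 'a poly" where
  "slice U \<nu> = PFP.construct (range mon)
    (\<lambda>m. if project (- U) (inv mon m) = \<nu> then mon (project U (inv mon m)) else 0)"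

lemma slice_linear: "Vector_Spaces.linear fscale fscale (slice U \<nu>)"
  unfolding slice_def by (rule PFP.linear_construct[OF independent_mon])

lemma slice_add: "slice U \<nu> (f + g) = slice U \<nu> f + slice U \<nu> g"
  by (rule PFP.linear_add[OF slice_linear])

lemma slice_fscale: "slice U \<nu> (fscale r f) = fscale r (slice U \<nu> f)"
  by (rule PFP.linear_scale[OF slice_linear])

lemma slice_zero: "slice U \<nu> 0 = 0"
  using slice_fscale[of U \<nu> 0 0] by simp

lemma slice_mon: "slice U \<nu> (mon \<beta>) = (if project (- U) \<beta> = \<nu> then mon (project U \<beta>) else 0)"
  unfolding slice_def by (subst PFP.construct_basis[OF independent_mon]) (auto simp: inj_mon)

lemma slice_in_poly_span: "f \<in> poly_span UNIV \<Longrightarrow> slice U \<nu> f \<in> poly_span UNIV"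
proof (induction rule: poly_span_induct)
  case zero
  show ?case using slice_zero poly_span_zero by metis
next
  case (add r \<gamma> g)
  have "fscale r (slice U \<nu> (mon \<gamma>)) + slice U \<nu> g \<in> poly_span UNIV"
    using add(3) by (intro poly_span_add poly_span_fscale) (auto simp: slice_mon poly_span_zero intro: mon_in_poly_span)
  then have "slice U \<nu> (fscale r (mon \<gamma>) + g) \<in> poly_span UNIV"
    by (simp only: slice_add slice_fscale)
  then show ?case .
qed

lemma mcoeff_slice:
  assumes "f \<in> poly_span UNIV" and \<nu>: "\<nu> \<in> supported (- U)"
  shows "mcoeff \<delta> (slice U \<nu> f) = (if \<delta> \<in> supported U then mcoeff (\<delta> + \<nu>) f else 0)"
  using assms(1)
proof (induction rule: poly_span_induct)
  case zero
  have "mcoeff \<delta> (slice U \<nu> 0) = (if \<delta> \<in> supported U then mcoeff (\<delta> + \<nu>) 0 else 0)"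
    by (simp only: slice_zero mcoeff_zero if_cancel)
  then show ?case .
next
  case (add r \<beta> g)
  have IH: "mcoeff \<delta> (slice U \<nu> g) = (if \<delta> \<in> supported U then mcoeff (\<delta> + \<nu>) g else 0)" by (rule add(3))
  have *: "\<delta> = project U \<beta> \<and> project (- U) \<beta> = \<nu> \<longleftrightarrow> \<delta> \<in> supported U \<and> \<delta> + \<nu> = \<beta>"
    using \<nu> project_in_supported project_add_project_Compl[of U \<beta>] project_disjoint[of \<nu> U] project_disjoint[of \<delta> "- U"]
    by (auto simp: project_add project_supported)
  have "mon \<beta> \<in> poly_span UNIV" by (simp add: mon_in_poly_span)
  have sm: "slice U \<nu> (mon \<beta>) \<in> poly_span UNIV" "slice U \<nu> g \<in> poly_span UNIV"
    using \<open>mon \<beta> \<in> poly_span UNIV\<close> add(2) by (auto intro: slice_in_poly_span)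
  then have "mcoeff \<delta> (slice U \<nu> (fscale r (mon \<beta>) + g)) = r * mcoeff \<delta> (slice U \<nu> (mon \<beta>)) + mcoeff \<delta> (slice U \<nu> g)"
    by (simp only: slice_add slice_fscale mcoeff_add[OF poly_span_fscale[OF sm(1)] sm(2)] mcoeff_fscale[OF sm(1)])
  also have "\<dots> = (if \<delta> \<in> supported U then mcoeff (\<delta> + \<nu>) (fscale r (mon \<beta>) + g) else 0)"
    using IH * unfolding mcoeff_add[OF poly_span_fscale[OF \<open>mon \<beta> \<in> poly_span UNIV\<close>] add(2)]
      mcoeff_fscale[OF \<open>mon \<beta> \<in> poly_span UNIV\<close>]
    by (auto simp: slice_mon mcoeff_mon mcoeff_zero)
  finally show ?case .
qed

lemma slice_mon_mult:
  fixes f :: "('d::finite \<Rightarrow> 'a::field poly) \<Rightarrow> 'a poly"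
  assumes "f \<in> poly_span (supported U)" "\<mu> \<in> supported (- U)"
  shows "slice U \<nu> (mon \<mu> * f) = (if \<mu> = \<nu> then f else 0)"
  using assms(1)
proof (induction rule: poly_span_induct)
  case zero
  have "slice U \<nu> (mon \<mu> * 0) = (if \<mu> = \<nu> then 0 else 0)"
    by (simp only: mult_zero_right slice_zero if_cancel)
  then show ?case .
next
  case (add r \<gamma> g)
  have r: "project U \<gamma> = \<gamma>" "project (- U) \<gamma> = 0" "project U \<mu> = 0" "project (- U) \<mu> = \<mu>"
    using project_supported[OF add(1)] project_disjoint[of \<gamma> "- U"] add(1) project_disjoint[OF assms(2)] project_supported[OF assms(2)]
    by auto
  have "slice U \<nu> (mon \<mu> * mon \<gamma> :: ('d \<Rightarrow> 'a poly) \<Rightarrow> 'a poly) = (if \<mu> = \<nu> then mon \<gamma> else 0)"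
    by (simp only: mon_mult slice_mon project_add r add_0_left add_0_right)
  moreover have "slice U \<nu> (mon \<mu> * g) = (if \<mu> = \<nu> then g else 0)" by (rule add(3))
  ultimately have "slice U \<nu> (mon \<mu> * (fscale r (mon \<gamma>) + g)) = (if \<mu> = \<nu> then fscale r (mon \<gamma>) + g else 0)"
    by (cases "\<mu> = \<nu>") (simp_all only: refl distrib_left fscale_mult_right slice_add slice_fscale simp_thms if_True if_False PF.scale_zero_right add_0_right)
  then show ?case .
qed

text \<open>A translation along the flat fixes the variables outside \<open>U\<close> and so acts on
  each slice separately.\<close>

lemma slice_shift:
  fixes f :: "('d::finite \<Rightarrow> 'a::field poly) \<Rightarrow> 'a poly"
  assumes "f \<in> poly_span UNIV" "\<And>i. i \<notin> U \<Longrightarrow> a i = 0"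
  shows "slice U \<nu> (f \<circ> shift a) = slice U \<nu> f \<circ> shift a"
  using assms(1)
proof (induction rule: poly_span_induct)
  case zero
  have "0 \<circ> shift a = 0" by (rule ext) simp
  then have "slice U \<nu> (0 \<circ> shift a) = slice U \<nu> 0 \<circ> shift a" by (metis slice_zero)
  then show ?case .
next
  case (add r \<beta> g)
  have "mon (project (- U) \<beta>) \<circ> shift a = mon (project (- U) \<beta>)"
  proof
    fix x
    have "(\<Prod>i\<in>UNIV. shift a x i ^ project (- U) \<beta> i) = (\<Prod>i\<in>UNIV. x i ^ project (- U) \<beta> i)"
      using assms(2) by (intro prod.cong) (auto simp: shift_def project_def)
    then show "(mon (project (- U) \<beta>) \<circ> shift a) x = mon (project (- U) \<beta>) x" by (simp add: mon_def)
  qed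
  moreover have "(mon \<beta> :: ('d \<Rightarrow> 'a poly) \<Rightarrow> 'a poly) = mon (project (- U) \<beta>) * mon (project U \<beta>)"
    by (simp add: mon_mult project_add_project_Compl add.commute)
  then have "mon \<beta> y = mon (project (- U) \<beta>) y * mon (project U \<beta>) y" for y :: "'d \<Rightarrow> 'a poly"
    by (metis times_fun_apply)
  then have "mon \<beta> \<circ> shift a = (mon (project (- U) \<beta>) \<circ> shift a) * (mon (project U \<beta>) \<circ> shift a)"
    by (intro ext) (simp only: times_fun_apply o_apply)
  ultimately have "slice U \<nu> (mon \<beta> \<circ> shift a) = slice U \<nu> (mon (project (- U) \<beta>) * (mon (project U \<beta>) \<circ> shift a))"
    by simp
  also have "\<dots> = (if project (- U) \<beta> = \<nu> then mon (project U \<beta>) \<circ> shift a else 0)"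
    using assms(2) by (intro slice_mon_mult mon_shift project_in_supported) auto
  also have "\<dots> = slice U \<nu> (mon \<beta>) \<circ> shift a"
    by (simp add: slice_mon fun_eq_iff)
  finally have mon: "slice U \<nu> (mon \<beta> \<circ> shift a) = slice U \<nu> (mon \<beta>) \<circ> shift a" .
  have "(fscale r (mon \<beta>) + g) \<circ> shift a = fscale r (mon \<beta> \<circ> shift a) + (g \<circ> shift a)"
    by (rule ext) (simp add: fscale_def)
  moreover have "slice U \<nu> (g \<circ> shift a) = slice U \<nu> g \<circ> shift a" by (rule add(3))
  ultimately have "slice U \<nu> ((fscale r (mon \<beta>) + g) \<circ> shift a) =
    fscale r (slice U \<nu> (mon \<beta>) \<circ> shift a) + (slice U \<nu> g \<circ> shift a)"
    using mon by (simp only: slice_add slice_fscale)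
  also have "\<dots> = slice U \<nu> (fscale r (mon \<beta>) + g) \<circ> shift a"
    unfolding slice_add slice_fscale by (rule ext) (simp add: fscale_def)
  finally show ?case .
qed

lemma smult_sum_right: "smult c (\<Sum>j\<in>S. f j) = (\<Sum>j\<in>S. smult c (f j))"
  by (induction S rule: infinite_finite_induct) (auto simp: smult_add_right)

lemma affine_subst_comp: "affine_subst a M (affine_subst b L x) =
  affine_subst (\<lambda>i. a i + (\<Sum>j\<in>UNIV. M i j * b j)) (\<lambda>i k. \<Sum>j\<in>UNIV. M i j * L j k) x"
proof
  fix i
  have 1: "(\<Sum>j\<in>S. [:f j:]) = [:\<Sum>j\<in>S. f j:]" for S and f :: "'a \<Rightarrow> 'b"
    by (induction S rule: infinite_finite_induct) auto
  have 2: "(\<Sum>j\<in>UNIV. \<Sum>k\<in>UNIV. smult (M i j) (smult (L j k) (x k))) =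
    (\<Sum>k\<in>UNIV. smult (\<Sum>j\<in>UNIV. M i j * L j k) (x k))"
    by (subst sum.swap) (simp only: smult_sum smult_smult)
  have "affine_subst a M (affine_subst b L x) i = [:a i:] + ((\<Sum>j\<in>UNIV. [:M i j * b j:]) +
    (\<Sum>j\<in>UNIV. \<Sum>k\<in>UNIV. smult (M i j) (smult (L j k) (x k))))"
    by (simp only: affine_subst_def smult_add_right smult_sum_right sum.distrib smult_pCons smult_0_right)
  also have "\<dots> = ([:a i:] + [:\<Sum>j\<in>UNIV. M i j * b j:]) +
    (\<Sum>k\<in>UNIV. smult (\<Sum>j\<in>UNIV. M i j * L j k) (x k))"
    unfolding 1 2 by (rule add.assoc[symmetric])
  also have "[:a i:] + [:\<Sum>j\<in>UNIV. M i j * b j:] = [:a i + (\<Sum>j\<in>UNIV. M i j * b j):]"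
    by simp
  finally show "affine_subst a M (affine_subst b L x) i =
    affine_subst (\<lambda>i. a i + (\<Sum>j\<in>UNIV. M i j * b j)) (\<lambda>i k. \<Sum>j\<in>UNIV. M i j * L j k) x i"
    unfolding affine_subst_def .
qed

section \<open>Expansions at several points\<close>

text \<open>\<open>A p\<close> below takes coordinates centred at \<open>p\<close> to ambient ones,
  \<open>A' p\<close> is its inverse, \<open>b p\<close> is the position of \<open>p\<close>, and
  \<open>\<rho>\<close> breaks ties between points.\<close>

locale frames =
  fixes pts :: "'p set" and b b' :: "'p \<Rightarrow> 'd::finite \<Rightarrow> 'a::field" and M M' :: "'p \<Rightarrow> 'd \<Rightarrow> 'd \<Rightarrow> 'a"
    and \<rho> :: "'p \<Rightarrow> nat"
  assumes finite_pts: "finite pts"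
    and inverse: "\<And>p x. p \<in> pts \<Longrightarrow> affine_subst (b p) (M p) (affine_subst (b' p) (M' p) x) = x"
      "\<And>p x. p \<in> pts \<Longrightarrow> affine_subst (b' p) (M' p) (affine_subst (b p) (M p) x) = x"
    and inj_b: "inj_on b pts" and inj_\<rho>: "inj_on \<rho> pts"
begin

abbreviation "A p \<equiv> affine_subst (b p) (M p)"
abbreviation "A' p \<equiv> affine_subst (b' p) (M' p)"

text \<open>\<open>tb p q\<close> and \<open>tM p q\<close> describe the change from the frame at
  \<open>q\<close> to that at \<open>p\<close>; \<open>tb p q\<close> is the position of
  \<open>q\<close> in the frame at \<open>p\<close>.\<close>

definition tb :: "'p \<Rightarrow> 'p \<Rightarrow> 'd \<Rightarrow> 'a" where
  "tb p q = (\<lambda>i. b' p i + (\<Sum>j\<in>UNIV. M' p i j * b q j))"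

definition tM :: "'p \<Rightarrow> 'p \<Rightarrow> 'd \<Rightarrow> 'd \<Rightarrow> 'a" where
  "tM p q = (\<lambda>i k. \<Sum>j\<in>UNIV. M' p i j * M q j k)"

lemma transition: "A' p (A q x) = affine_subst (tb p q) (tM p q) x"
  unfolding affine_subst_comp tb_def tM_def ..

text \<open>
  The pair \<open>(p, \<gamma>)\<close> stands for the coefficient of \<open>x\<^sup>\<gamma>\<close> in the expansion at \<open>p\<close>;
  the handicap \<open>\<alpha>\<close> shifts the vanishing order at which it is processed.
\<close>

definition before :: "nat \<Rightarrow> ('p \<Rightarrow> int) \<Rightarrow> 'p \<times> ('d \<Rightarrow> nat) \<Rightarrow> 'p \<times> ('d \<Rightarrow> nat) \<Rightarrow> bool" where
  "before N \<alpha> = (\<lambda>(q, \<delta>) (p, \<gamma>). int (deg \<delta>) - \<alpha> q < int (deg \<gamma>) - \<alpha> p \<or>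
    int (deg \<delta>) - \<alpha> q = int (deg \<gamma>) - \<alpha> p \<and> (\<rho> q < \<rho> p \<or> \<rho> q = \<rho> p \<and> code N \<delta> < code N \<gamma>))"

text \<open>\<open>U p\<close> is the set of axes at \<open>p\<close> that span the flat under
  consideration, so only the restriction of \<open>g\<close> to the flat matters. \<open>N\<close>
  is separate from \<open>n\<close> so that different degrees can be compared under one
  order.\<close>

definition leads :: "nat \<Rightarrow> 'p set \<Rightarrow> ('p \<Rightarrow> 'd set) \<Rightarrow> nat \<Rightarrow> ('p \<Rightarrow> int) \<Rightarrow> 'p \<Rightarrow> ('d \<Rightarrow> nat) set" where
  "leads N P U n \<alpha> p = {\<gamma> \<in> supported (U p). deg \<gamma> \<le> n \<and> (\<exists>g \<in> poly_span {\<gamma>. deg \<gamma> \<le> n}. mcoeff \<gamma> (g \<circ> A p) \<noteq> 0 \<and>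
    (\<forall>q\<in>P. \<forall>\<delta>\<in>supported (U q). before N \<alpha> (q, \<delta>) (p, \<gamma>) \<longrightarrow> mcoeff \<delta> (g \<circ> A q) = 0))}"

text \<open>The coordinate subspaces \<open>U p\<close>, taken in the frames at the points of
  \<open>P\<close>, are one and the same affine subspace: each transition maps one into the
  other.\<close>

definition flat :: "'p set \<Rightarrow> ('p \<Rightarrow> 'd set) \<Rightarrow> bool" where
  "flat P U \<longleftrightarrow> P \<subseteq> pts \<and> (\<forall>p\<in>P. \<forall>q\<in>P. \<forall>i. i \<notin> U p \<longrightarrow> tb p q i = 0 \<and> (\<forall>j\<in>U q. tM p q i j = 0))"

lemma finite_leads: "finite (leads N P U n \<alpha> p)"
  by (rule finite_subset[OF _ finite_deg_le[of n]]) (auto simp: leads_def)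

lemma leads_mono:
  assumes "n \<le> n'"
    and "\<And>q \<gamma> \<delta>. q \<in> P \<Longrightarrow> before N \<alpha>' (q, \<delta>) (p, \<gamma>) \<Longrightarrow> before N \<alpha> (q, \<delta>) (p, \<gamma>)"
  shows "leads N P U n \<alpha> p \<subseteq> leads N P U n' \<alpha>' p"
proof
  fix \<gamma> assume "\<gamma> \<in> leads N P U n \<alpha> p"
  then obtain g where g: "\<gamma> \<in> supported (U p)" "deg \<gamma> \<le> n" "g \<in> poly_span {\<gamma>. deg \<gamma> \<le> n}" "mcoeff \<gamma> (g \<circ> A p) \<noteq> 0"
    "\<forall>q\<in>P. \<forall>\<delta>\<in>supported (U q). before N \<alpha> (q, \<delta>) (p, \<gamma>) \<longrightarrow> mcoeff \<delta> (g \<circ> A q) = 0"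
    unfolding leads_def by blast
  have "g \<in> poly_span {\<gamma>. deg \<gamma> \<le> n'}"
    using g(3) poly_span_mono[of "{\<gamma>. deg \<gamma> \<le> n}" "{\<gamma>. deg \<gamma> \<le> n'}"] assms(1) by fastforce
  then show "\<gamma> \<in> leads N P U n' \<alpha>' p"
    unfolding leads_def using g assms by auto
qed

text \<open>Being zero on the flat does not depend on the frame: if all coefficients along the flat
  vanish at \<open>p\<close>, the restriction of \<open>g\<close> to the flat is the zero
  polynomial, and the transition carries the flat as seen from \<open>q\<close> into the flat as
  seen from \<open>p\<close>.\<close>

lemma kernel_transfer:
  assumes "flat P U" "p \<in> P" "q \<in> P" "g \<in> poly_span UNIV"
    and "\<And>\<gamma>. \<gamma> \<in> supported (U p) \<Longrightarrow> mcoeff \<gamma> (g \<circ> A p) = 0" and "\<gamma> \<in> supported (U q)"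
  shows "mcoeff \<gamma> (g \<circ> A q) = 0"
proof -
  have p: "p \<in> pts" using assms(1,2) by (auto simp: flat_def)
  have z: "g \<circ> A p \<circ> restrict_coords (U p) = 0"
    using assms(4,5) by (intro poly_span_eqI poly_span_restrict poly_span_affine_subst) (auto simp: mcoeff_restrict poly_span_affine_subst)
  have "g \<circ> A q \<circ> restrict_coords (U q) = 0"
  proof
    fix x
    let ?y = "affine_subst (tb p q) (tM p q) (restrict_coords (U q) x)"
    have "restrict_coords (U p) ?y i = ?y i" for i
    proof (cases "i \<in> U p")
      case False
      then have "tb p q i = 0" "\<And>j. j \<in> U q \<Longrightarrow> tM p q i j = 0"
        using assms(1-3) by (auto simp: flat_def)
      then have "?y i = 0"
        unfolding affine_subst_def by (auto simp: restrict_coords_def intro!: sum.neutral)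
      then show ?thesis using False by (simp add: restrict_coords_def)
    qed (simp add: restrict_coords_def)
    then have y: "restrict_coords (U p) ?y = ?y" by (rule ext)
    have "A q (restrict_coords (U q) x) = A p (A' p (A q (restrict_coords (U q) x)))"
      using inverse(1)[OF p] by metis
    also have "\<dots> = A p (restrict_coords (U p) ?y)" unfolding transition y ..
    finally have "(g \<circ> A q \<circ> restrict_coords (U q)) x = (g \<circ> A p \<circ> restrict_coords (U p)) ?y" by simp
    then show "(g \<circ> A q \<circ> restrict_coords (U q)) x = 0 x" unfolding z by simp
  qed
  then have "mcoeff \<gamma> (g \<circ> A q \<circ> restrict_coords (U q)) = 0" by (metis mcoeff_zero)
  then show ?thesis using assms(4,6) by (simp add: mcoeff_restrict poly_span_affine_subst)
qed

lemma before_order: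
  fixes U :: "'p \<Rightarrow> 'd set"
  assumes "P \<subseteq> pts" "n < N"
  defines "X \<equiv> SIGMA p:P. {\<gamma> \<in> supported (U p). deg \<gamma> \<le> n}"
  shows "transp_on X (before N \<alpha>)" "asymp_on X (before N \<alpha>)" "totalp_on X (before N \<alpha>)"
proof -
  show "transp_on X (before N \<alpha>)"
    by (rule transp_onI) (auto simp: before_def)
  show "asymp_on X (before N \<alpha>)"
    by (rule asymp_onI) (auto simp: before_def)
  show "totalp_on X (before N \<alpha>)"
  proof (rule totalp_onI)
    fix x y assume "x \<in> X" "y \<in> X" "x \<noteq> y"
    obtain p \<gamma> q \<delta> where x: "x = (p, \<gamma>)" and y: "y = (q, \<delta>)" by (metis surj_pair)
    have "p \<in> pts" "q \<in> pts" "deg \<gamma> \<le> n" "deg \<delta> \<le> n"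
      using assms(1) \<open>x \<in> X\<close> \<open>y \<in> X\<close> by (auto simp: X_def x y)
    note xy = x y this
    have lt: "\<gamma> i < N" "\<delta> i < N" for i
      using deg_ge[of \<gamma> i] deg_ge[of \<delta> i] xy(5,6) assms(2) by auto
    show "before N \<alpha> x y \<or> before N \<alpha> y x"
    proof (cases "p = q")
      case True
      then have "code N \<gamma> \<noteq> code N \<delta>" using code_inject[of \<gamma> N \<delta>] lt xy \<open>x \<noteq> y\<close> by auto
      then show ?thesis using True by (auto simp: before_def xy)
    next
      case False
      then have "\<rho> p \<noteq> \<rho> q" using inj_\<rho> xy(3,4) by (auto simp: inj_on_def)
      then show ?thesis by (auto simp: before_def xy)
    qed
  qed
qed

text \<open>The instance of \<open>dim_eq_card_leading\<close> for Taylor coefficients. Exponents of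
  degree above \<open>n\<close> are left out to keep the index set finite; their coefficients vanish
  anyway.\<close>

lemma sum_card_leads_dim:
  assumes "P \<subseteq> pts" "n < N"
  shows "PF.dim (poly_span {\<gamma>. deg \<gamma> \<le> n} :: (('d \<Rightarrow> 'a poly) \<Rightarrow> 'a poly) set) = (\<Sum>p\<in>P. card (leads N P U n \<alpha> p)) +
    PF.dim {g \<in> poly_span {\<gamma>. deg \<gamma> \<le> n}. \<forall>p\<in>P. \<forall>\<gamma>\<in>supported (U p). mcoeff \<gamma> (g \<circ> A p) = 0}"
proof -
  let ?W = "poly_span {\<gamma>. deg \<gamma> \<le> n} :: (('d \<Rightarrow> 'a poly) \<Rightarrow> 'a poly) set"
  let ?S = "mon ` {\<gamma>. deg \<gamma> \<le> n} :: (('d \<Rightarrow> 'a poly) \<Rightarrow> 'a poly) set"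
  let ?X = "SIGMA p:P. {\<gamma> \<in> supported (U p). deg \<gamma> \<le> n}"
  let ?c = "\<lambda>(p, \<gamma>) g. mcoeff \<gamma> (g \<circ> A p)"
  have fP: "finite P" using assms(1) finite_pts finite_subset by blast
  have finX: "finite ?X"
    using fP by (intro finite_SigmaI) (auto intro: finite_subset[OF _ finite_deg_le[of n]])
  have high: "mcoeff \<gamma> (g \<circ> A p) = 0" if "g \<in> ?W" "\<not> deg \<gamma> \<le> n" for g p \<gamma>
    using poly_span_affine_subst_le[OF that(1)] that(2) by (intro mcoeff_poly_span) auto
  have add: "mcoeff \<gamma> ((u + v) \<circ> A p) = mcoeff \<gamma> (u \<circ> A p) + mcoeff \<gamma> (v \<circ> A p)"
    if "u \<in> ?W" "v \<in> ?W" for u v \<gamma> p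
  proof -
    have "(u + v) \<circ> A p = (u \<circ> A p) + (v \<circ> A p)" by (rule ext) simp
    then show ?thesis using that by (metis mcoeff_add poly_span_affine_subst poly_span_UNIV)
  qed
  have scale: "mcoeff \<gamma> (fscale r u \<circ> A p) = r * mcoeff \<gamma> (u \<circ> A p)" if "u \<in> ?W" for u r \<gamma> p
  proof -
    have "fscale r u \<circ> A p = fscale r (u \<circ> A p)" by (rule ext) (simp add: fscale_def)
    then show ?thesis using that by (metis mcoeff_fscale poly_span_affine_subst poly_span_UNIV)
  qed
  have "PF.dim ?W = card {x \<in> ?X. \<exists>u\<in>?W. ?c x u \<noteq> 0 \<and> (\<forall>y\<in>?X. before N \<alpha> y x \<longrightarrow> ?c y u = 0)} +
    PF.dim {u \<in> ?W. \<forall>x\<in>?X. ?c x u = 0}"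
  proof (rule PF.dim_eq_card_leading[OF finX])
    show "PF.subspace ?W" by (rule subspace_poly_span)
    show "finite ?S" by (intro finite_imageI finite_deg_le)
    show "?W \<subseteq> PF.span ?S" by (simp add: poly_span_def)
    show "transp_on ?X (before N \<alpha>)" "asymp_on ?X (before N \<alpha>)" "totalp_on ?X (before N \<alpha>)"
      using before_order[OF assms] by auto
  next
    fix x u v assume "u \<in> ?W" "v \<in> ?W"
    then show "?c x (u + v) = ?c x u + ?c x v" by (cases x) (simp only: split_conv add)
  next
    fix x u r assume "u \<in> ?W"
    then show "?c x (fscale r u) = r * ?c x u" by (cases x) (simp only: split_conv scale)
  qed
  moreover have "{x \<in> ?X. \<exists>u\<in>?W. ?c x u \<noteq> 0 \<and> (\<forall>y\<in>?X. before N \<alpha> y x \<longrightarrow> ?c y u = 0)} =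
    (SIGMA p:P. leads N P U n \<alpha> p)" (is "?L = ?R")
  proof (rule set_eqI)
    fix x :: "'p \<times> ('d \<Rightarrow> nat)" obtain p \<gamma> where x: "x = (p, \<gamma>)" by (cases x)
    have "(\<forall>y\<in>?X. before N \<alpha> y x \<longrightarrow> ?c y u = 0) \<longleftrightarrow>
      (\<forall>q\<in>P. \<forall>\<delta>\<in>supported (U q). before N \<alpha> (q, \<delta>) (p, \<gamma>) \<longrightarrow> mcoeff \<delta> (u \<circ> A q) = 0)" if "u \<in> ?W" for u
      using high[OF that] by (auto simp: x)
    then show "x \<in> ?L \<longleftrightarrow> x \<in> ?R" by (auto simp: x leads_def)
  qed
  moreover have "card (SIGMA p:P. leads N P U n \<alpha> p) = (\<Sum>p\<in>P. card (leads N P U n \<alpha> p))"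
    using fP finite_leads by (intro card_SigmaI) auto
  moreover have "{u \<in> ?W. \<forall>x\<in>?X. ?c x u = 0} = {g \<in> ?W. \<forall>p\<in>P. \<forall>\<gamma>\<in>supported (U p). mcoeff \<gamma> (g \<circ> A p) = 0}"
    using high by (auto, metis)
  ultimately show ?thesis by simp
qed

text \<open>By \<open>kernel_transfer\<close> the common kernel is the same for \<open>P\<close> as
  for \<open>{p}\<close> alone, hence so is the number of leading coefficients; and with a single
  point every coefficient leads.\<close>

lemma sum_card_leads:
  assumes "flat P U" "p \<in> P" "n < N"
  shows "(\<Sum>q\<in>P. card (leads N P U n \<alpha> q)) = card {\<gamma> \<in> supported (U p). deg \<gamma> \<le> n}"
proof -
  have P: "P \<subseteq> pts" "{p} \<subseteq> pts" using assms by (auto simp: flat_def)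
  have "{g \<in> poly_span {\<gamma>. deg \<gamma> \<le> n}. \<forall>q\<in>P. \<forall>\<gamma>\<in>supported (U q). mcoeff \<gamma> (g \<circ> A q) = 0} =
    {g \<in> poly_span {\<gamma>. deg \<gamma> \<le> n}. \<forall>q\<in>{p}. \<forall>\<gamma>\<in>supported (U q). mcoeff \<gamma> (g \<circ> A q) = 0}"
    using kernel_transfer[OF assms(1,2)] assms(2) poly_span_UNIV by blast
  from arg_cong[OF this, of PF.dim]
  have "(\<Sum>q\<in>P. card (leads N P U n \<alpha> q)) = (\<Sum>q\<in>{p}. card (leads N {p} U n \<alpha> q))"
    using sum_card_leads_dim[OF P(1) assms(3), of U \<alpha>] sum_card_leads_dim[OF P(2) assms(3), of U \<alpha>] by linarith
  moreover have "leads N {p} U n \<alpha> p = {\<gamma> \<in> supported (U p). deg \<gamma> \<le> n}"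
  proof safe
    fix \<gamma> assume \<gamma>: "\<gamma> \<in> supported (U p)" "deg \<gamma> \<le> n"
    \<comment> \<open>The witness is the monomial written in the coordinates at \<open>p\<close>,
      which has no other coefficient there.\<close>
    have "mon \<gamma> \<circ> A' p \<circ> A p = mon \<gamma>"
      using inverse(2) P(2) by (intro ext) simp
    moreover have "mon \<gamma> \<circ> A' p \<in> poly_span {\<gamma>. deg \<gamma> \<le> n}"
      using \<gamma>(2) by (intro poly_span_affine_subst_le mon_in_poly_span) simp
    moreover have "\<not> before N \<alpha> (p, \<gamma>) (p, \<gamma>)" by (simp add: before_def)
    ultimately show "\<gamma> \<in> leads N {p} U n \<alpha> p"
      unfolding leads_def using \<gamma> by (auto intro!: bexI[of _ "mon \<gamma> \<circ> A' p"] simp: mcoeff_mon)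
  qed (auto simp: leads_def)
  ultimately show ?thesis by simp
qed

text \<open>All coefficients at \<open>q\<close> up to degree \<open>n\<close> are processed before
  any at \<open>p\<close>. They determine the polynomial on the flat, so nothing is left to lead at
  \<open>p\<close>.\<close>

lemma leads_empty:
  assumes "flat P U" "p \<in> P" "q \<in> P" "\<alpha> p + int n < \<alpha> q"
  shows "leads N P U n \<alpha> p = {}"
proof (rule ccontr)
  assume "leads N P U n \<alpha> p \<noteq> {}"
  then obtain \<gamma> g where g: "\<gamma> \<in> supported (U p)" "deg \<gamma> \<le> n" "g \<in> poly_span {\<gamma>. deg \<gamma> \<le> n}" "mcoeff \<gamma> (g \<circ> A p) \<noteq> 0"
    "\<forall>q\<in>P. \<forall>\<delta>\<in>supported (U q). before N \<alpha> (q, \<delta>) (p, \<gamma>) \<longrightarrow> mcoeff \<delta> (g \<circ> A q) = 0"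
    unfolding leads_def by blast
  have "mcoeff \<delta> (g \<circ> A q) = 0" if "\<delta> \<in> supported (U q)" for \<delta>
  proof (cases "deg \<delta> \<le> n")
    case True
    then have "before N \<alpha> (q, \<delta>) (p, \<gamma>)" using assms(4) by (simp add: before_def)
    then show ?thesis using g(5) assms(3) that by blast
  next
    case False
    then show ?thesis using poly_span_affine_subst_le[OF g(3)] by (intro mcoeff_poly_span) auto
  qed
  then show False using kernel_transfer[OF assms(1,3,2) poly_span_UNIV[OF g(3)]] g(1,4) by blast
qed

text \<open>A lower handicap at \<open>p\<close> postpones the coefficients at \<open>p\<close>, so
  fewer conditions precede a given coefficient at \<open>q\<close>.\<close>

lemma leads_mono_handicap:
  assumes "p \<noteq> q"
  shows "leads N P U n \<alpha> q \<subseteq> leads N P U n (\<alpha>(p := \<alpha> p - 1)) q"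
  using assms by (intro leads_mono) (auto simp: before_def split: if_splits)

text \<open>Multiplication by a linear form that vanishes at \<open>p\<close> but not at \<open>q\<close>.\<close>

lemma leads_lower_handicap:
  assumes "P \<subseteq> pts" "p \<in> P" "q \<in> P" "p \<noteq> q"
  shows "leads N P U n (\<alpha>(p := \<alpha> p - 1)) q \<subseteq> leads N P U (Suc n) \<alpha> q"
proof
  let ?\<alpha> = "\<alpha>(p := \<alpha> p - 1)"
  fix \<gamma> assume "\<gamma> \<in> leads N P U n ?\<alpha> q"
  then obtain g where g: "\<gamma> \<in> supported (U q)" "deg \<gamma> \<le> n" "g \<in> poly_span {\<gamma>. deg \<gamma> \<le> n}" "mcoeff \<gamma> (g \<circ> A q) \<noteq> 0"
    "\<forall>r\<in>P. \<forall>\<delta>\<in>supported (U r). before N ?\<alpha> (r, \<delta>) (q, \<gamma>) \<longrightarrow> mcoeff \<delta> (g \<circ> A r) = 0"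
    unfolding leads_def by blast
  have gU: "g \<in> poly_span UNIV" by (rule poly_span_UNIV[OF g(3)])
  have "b p \<noteq> b q" using assms inj_b by (auto simp: inj_on_def)
  then obtain i where i: "b p i \<noteq> b q i" by blast
  define l :: "('d \<Rightarrow> 'a poly) \<Rightarrow> 'a poly" where "l = (\<lambda>x. x i) + fscale (- b p i) (mon 0)"
  define L where "L r = (\<lambda>x. affine_subst 0 (M r) x i)" for r
  have L: "L r \<in> poly_span {\<delta>. deg \<delta> = 1}" for r
  proof -
    have "mon (\<lambda>j. if j = i then 1 else 0) \<circ> affine_subst 0 (M r) \<in> poly_span {\<delta>. deg \<delta> = 1}"
      using mon_linear[of "\<lambda>j. if j = i then 1 else 0" "M r"] by (simp only: deg_unit)
    then show ?thesis unfolding coord_eq_mon[symmetric] L_def comp_def .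
  qed
  have lA: "l \<circ> A r = fscale (b r i - b p i) (mon 0) + L r" for r
    by (rule ext) (simp add: l_def L_def affine_subst_def fscale_def mon_zero one_pCons)
  have "l \<in> poly_span {\<delta>. deg \<delta> \<le> 1}"
    unfolding l_def by (intro poly_span_add poly_span_fscale mon_in_poly_span coord_in_poly_span) (auto simp: deg_zero deg_unit)
  then have lg: "l * g \<in> poly_span {\<gamma>. deg \<gamma> \<le> Suc n}"
    by (rule poly_span_mult[OF _ g(3)]) (auto simp: deg_add)
  let ?f = "\<lambda>r. g \<circ> A r \<circ> restrict_coords (U r)"
  let ?G = "\<lambda>r. {\<delta> \<in> supported (U r). \<not> before N ?\<alpha> (r, \<delta>) (q, \<gamma>)}"
  have f: "?f r \<in> poly_span (?G r)" if "r \<in> P" for r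
    using g(5) that gU by (subst poly_span_iff) (auto simp: mcoeff_restrict poly_span_restrict poly_span_affine_subst)
  let ?Lf = "\<lambda>r. (L r \<circ> restrict_coords (U r)) * ?f r"
  have Lr: "L r \<circ> restrict_coords (U r) \<in> poly_span {\<delta>. deg \<delta> = 1}" for r
  proof -
    have "L r \<in> poly_span UNIV" using L poly_span_UNIV by blast
    then show ?thesis using mcoeff_poly_span[OF L[of r]] by (subst poly_span_iff) (auto simp: mcoeff_restrict poly_span_restrict)
  qed
  have Lf: "?Lf r \<in> poly_span {\<delta>. \<exists>\<mu> \<delta>'. deg \<mu> = 1 \<and> \<not> before N ?\<alpha> (r, \<delta>') (q, \<gamma>) \<and> \<delta> = \<mu> + \<delta>'}"
    if "r \<in> P" for r
    by (rule poly_span_mult[OF Lr f[OF that]]) blast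
  have prod: "(l * g) \<circ> A r \<circ> restrict_coords (U r) = fscale (b r i - b p i) (?f r) + ?Lf r" for r
  proof
    fix x
    have "((l * g) \<circ> A r \<circ> restrict_coords (U r)) x =
      (l \<circ> A r) (restrict_coords (U r) x) * ?f r x" by simp
    then show "((l * g) \<circ> A r \<circ> restrict_coords (U r)) x = (fscale (b r i - b p i) (?f r) + ?Lf r) x"
      unfolding lA by (simp add: fscale_def mon_zero distrib_right)
  qed
  have lgU: "(l * g) \<circ> A r \<in> poly_span UNIV" for r using poly_span_UNIV[OF lg] by (rule poly_span_affine_subst)
  have mcoeff: "mcoeff \<delta> ((l * g) \<circ> A r) = (b r i - b p i) * mcoeff \<delta> (?f r) + mcoeff \<delta> (?Lf r)"
    if "r \<in> P" "\<delta> \<in> supported (U r)" for r \<delta>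
  proof -
    have "mcoeff \<delta> ((l * g) \<circ> A r) = mcoeff \<delta> ((l * g) \<circ> A r \<circ> restrict_coords (U r))"
      using that lgU by (simp add: mcoeff_restrict)
    also have "\<dots> = mcoeff \<delta> (fscale (b r i - b p i) (?f r)) + mcoeff \<delta> (?Lf r)"
      unfolding prod by (intro mcoeff_add poly_span_fscale poly_span_UNIV[OF f[OF that(1)]] poly_span_UNIV[OF Lf[OF that(1)]])
    also have "mcoeff \<delta> (fscale (b r i - b p i) (?f r)) = (b r i - b p i) * mcoeff \<delta> (?f r)"
      by (intro mcoeff_fscale poly_span_UNIV[OF f[OF that(1)]])
    finally show ?thesis .
  qed
  have \<rho>: "\<rho> p \<noteq> \<rho> q" using assms inj_\<rho> by (auto simp: inj_on_def)
  \<comment> \<open>At \<open>p\<close> the form \<open>l\<close> has no constant term, so a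
    coefficient of \<open>l * g\<close> depends on coefficients of \<open>g\<close> of degree one
    less; this makes up for the handicap lowered by one. At other points, the coefficients of
    \<open>g\<close> that enter precede \<open>(q, \<gamma>)\<close> as well.\<close>
  have "mcoeff \<delta> ((l * g) \<circ> A r) = 0" if r: "r \<in> P" "\<delta> \<in> supported (U r)" "before N \<alpha> (r, \<delta>) (q, \<gamma>)" for r \<delta>
  proof -
    have "mcoeff \<delta> (?Lf r) = 0"
      using r(3) assms(4) \<rho>
      by (intro mcoeff_poly_span[OF Lf[OF r(1)]]) (auto simp: before_def deg_add split: if_splits)
    moreover have "(b r i - b p i) * mcoeff \<delta> (?f r) = 0"
    proof (cases "r = p")
      case False
      then have "mcoeff \<delta> (?f r) = 0"
        using r(3) assms(4) by (intro mcoeff_poly_span[OF f[OF r(1)]]) (auto simp: before_def split: if_splits)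
      then show ?thesis by simp
    qed simp
    ultimately show ?thesis using mcoeff[OF r(1,2)] by simp
  qed
  \<comment> \<open>Coefficients of \<open>g\<close> of lower degree at \<open>q\<close> vanish, so
    only the constant term of \<open>l\<close> at \<open>q\<close>, which is nonzero,
    contributes.\<close>
  moreover have "mcoeff \<gamma> ((l * g) \<circ> A q) \<noteq> 0"
  proof -
    have "mcoeff \<gamma> (?Lf q) = 0"
      using assms(4) by (intro mcoeff_poly_span[OF Lf[OF assms(3)]]) (auto simp: before_def deg_add split: if_splits)
    moreover have "mcoeff \<gamma> (?f q) = mcoeff \<gamma> (g \<circ> A q)"
      using g(1) gU by (simp add: mcoeff_restrict poly_span_affine_subst)
    ultimately show ?thesis using mcoeff[OF assms(3) g(1)] g(4) i by simp
  qed
  ultimately show "\<gamma> \<in> leads N P U (Suc n) \<alpha> q"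
    unfolding leads_def using g(1,2) lg by (auto intro!: bexI[of _ "l * g"])
qed

text \<open>If \<open>g\<close> witnesses that \<open>\<gamma>\<close> leads in the whole space, its
  transverse Taylor coefficient of order \<open>?\<nu>\<close>, the part of \<open>\<gamma>\<close>
  outside \<open>U p\<close>, is a witness on the flat. At \<open>p\<close> its coefficients are
  those of \<open>g\<close> shifted by \<open>?\<nu>\<close>, and the order respects this shift. At
  another point \<open>q\<close>, slicing costs at most \<open>deg ?\<nu>\<close> of the vanishing
  order of \<open>g\<close>, because it commutes with the translation from \<open>p\<close> to
  \<open>q\<close>.\<close>

lemma leads_slice:
  assumes "flat P U" "p \<in> P" and \<gamma>: "\<gamma> \<in> leads N pts (\<lambda>_. UNIV) n \<alpha> p"
  shows "project (U p) \<gamma> \<in> leads N P U n \<alpha> p"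
proof -
  have P: "P \<subseteq> pts" and p: "p \<in> pts" using assms(1,2) by (auto simp: flat_def)
  have exU: "supported UNIV = (UNIV :: ('d \<Rightarrow> nat) set)" by (auto simp: supported_def)
  obtain g where g: "deg \<gamma> \<le> n" "g \<in> poly_span {\<gamma>. deg \<gamma> \<le> n}" "mcoeff \<gamma> (g \<circ> A p) \<noteq> 0"
    "\<And>q \<delta>. q \<in> pts \<Longrightarrow> before N \<alpha> (q, \<delta>) (p, \<gamma>) \<Longrightarrow> mcoeff \<delta> (g \<circ> A q) = 0"
    using \<gamma> unfolding leads_def exU by blast
  have gU: "g \<in> poly_span UNIV" by (rule poly_span_UNIV[OF g(2)])
  let ?\<nu> = "project (- U p) \<gamma>"
  let ?f = "g \<circ> A p"
  let ?s = "slice (U p) ?\<nu> ?f"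
  let ?h = "?s \<circ> A' p"
  have split: "project (U p) \<gamma> + ?\<nu> = \<gamma>" by (rule project_add_project_Compl)
  then have deg: "deg (project (U p) \<gamma>) + deg ?\<nu> = deg \<gamma>" and
    code: "code N (project (U p) \<gamma>) + code N ?\<nu> = code N \<gamma>"
    using deg_add[of "project (U p) \<gamma>" ?\<nu>] code_add[of N "project (U p) \<gamma>" ?\<nu>] by simp_all
  have fU: "?f \<in> poly_span UNIV" and fn: "?f \<in> poly_span {\<gamma>. deg \<gamma> \<le> n}"
    using gU g(2) by (auto intro: poly_span_affine_subst poly_span_affine_subst_le)
  have sU: "?s \<in> poly_span UNIV" using fU by (rule slice_in_poly_span)
  have cfs: "mcoeff \<delta> (slice (U p) ?\<nu> u) = (if \<delta> \<in> supported (U p) then mcoeff (\<delta> + ?\<nu>) u else 0)"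
    if "u \<in> poly_span UNIV" for \<delta> and u :: "('d \<Rightarrow> 'a poly) \<Rightarrow> 'a poly"
    by (rule mcoeff_slice[OF that project_in_supported])
  have "?s \<in> poly_span {\<gamma>. deg \<gamma> \<le> n}"
    using sU mcoeff_poly_span[OF fn] by (subst poly_span_iff) (auto simp: cfs[OF fU] deg_add)
  then have hn: "?h \<in> poly_span {\<gamma>. deg \<gamma> \<le> n}" by (rule poly_span_affine_subst_le)
  have hA: "?h \<circ> A p = ?s" using inverse(2)[OF p] by (intro ext) simp
  have "mcoeff \<delta> (?h \<circ> A q) = 0"
    if q: "q \<in> P" "\<delta> \<in> supported (U q)" "before N \<alpha> (q, \<delta>) (p, project (U p) \<gamma>)" for q \<delta>
  proof (cases "q = p")
    case True
    have "before N \<alpha> (p, \<delta> + ?\<nu>) (p, \<gamma>)"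
      using q(3) True deg code by (auto simp: before_def deg_add code_add)
    then show ?thesis using g(4) p cfs[OF fU] unfolding True hA by simp
  next
    case False
    have qp: "q \<in> pts" using q(1) P by blast
    then have \<rho>: "\<rho> q \<noteq> \<rho> p" using False p inj_\<rho> by (auto simp: inj_on_def)
    \<comment> \<open>The coefficients at \<open>q\<close> of degree below
      \<open>m + deg ?\<nu>\<close> are those before \<open>(p, \<gamma>)\<close>; the extra 1
      accounts for ties that \<open>q\<close> wins by \<open>\<rho>\<close>.\<close>
    define m where "m = int (deg (project (U p) \<gamma>)) - \<alpha> p + \<alpha> q + (if \<rho> q < \<rho> p then 1 else 0)"
    have m: "int (deg \<delta>) < m" using q(3) \<rho> by (auto simp: before_def m_def)
    define k where "k = nat m"
    have k: "deg \<delta> < k" "int k = m" using m by (auto simp: k_def)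
    have "mcoeff \<delta>' (g \<circ> A q) = 0" if "\<not> k + deg ?\<nu> \<le> deg \<delta>'" for \<delta>'
    proof -
      have "before N \<alpha> (q, \<delta>') (p, \<gamma>)"
        using that k(2) deg by (auto simp: before_def m_def split: if_splits)
      then show ?thesis using g(4) qp by blast
    qed
    then have gq: "g \<circ> A q \<in> poly_span {\<delta>. k + deg ?\<nu> \<le> deg \<delta>}"
      using poly_span_affine_subst[OF gU] by (subst poly_span_iff) auto
    let ?a = "tb p q"
    \<comment> \<open>The frame at \<open>q\<close> and the frame at \<open>p\<close> translated to
      \<open>q\<close> have the same origin. The change between them is therefore linear
      (\<open>c = 0\<close>) and does not lower the vanishing order.\<close>
    obtain c K where cK: "\<And>x :: 'd \<Rightarrow> 'a poly. A' q (A p (shift ?a x)) = affine_subst c K x"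
      unfolding shift_eq_affine_subst affine_subst_comp by blast
    have lift: "shift ?a 0 = affine_subst (tb p q) (tM p q) (0 :: 'd \<Rightarrow> 'a poly)"
      by (rule ext) (simp add: shift_def affine_subst_def)
    have "affine_subst c K (0 :: 'd \<Rightarrow> 'a poly) = 0"
      unfolding cK[symmetric] lift transition[symmetric] using inverse[OF p] inverse[OF qp] by metis
    from fun_cong[OF this] have "c i = 0" for i
      by (simp add: affine_subst_def)
    then have c: "c = 0" by (intro ext) simp
    have "A p (shift ?a x) = A q (affine_subst 0 K x)" for x
      using cK[of x] inverse(1)[OF qp] unfolding c by metis
    then have "?f \<circ> shift ?a = (g \<circ> A q) \<circ> affine_subst 0 K" by (intro ext) simp
    then have fs: "?f \<circ> shift ?a \<in> poly_span {\<delta>. k + deg ?\<nu> \<le> deg \<delta>}"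
      using poly_span_linear_ge[OF gq] by metis
    have supp: "tb p q i = 0" if "i \<notin> U p" for i
      using assms(1,2) q(1) that by (auto simp: flat_def)
    have sl: "slice (U p) ?\<nu> (?f \<circ> shift ?a) = ?s \<circ> shift ?a"
      by (rule slice_shift[OF fU supp])
    have "slice (U p) ?\<nu> (?f \<circ> shift ?a) \<in> poly_span {\<delta>. k \<le> deg \<delta>}"
      using slice_in_poly_span[OF poly_span_UNIV[OF fs]] mcoeff_poly_span[OF fs]
      by (subst poly_span_iff) (auto simp: cfs[OF poly_span_UNIV[OF fs]] deg_add)
    then have "?s \<circ> shift ?a \<in> poly_span {\<delta>. k \<le> deg \<delta>}" unfolding sl .
    then have "?s \<circ> shift ?a \<circ> affine_subst 0 (tM p q) \<in> poly_span {\<delta>. k \<le> deg \<delta>}" by (rule poly_span_linear_ge)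
    moreover have "?h \<circ> A q = ?s \<circ> shift ?a \<circ> affine_subst 0 (tM p q)"
    proof
      fix x
      have "shift ?a (affine_subst 0 (tM p q) x) = affine_subst (tb p q) (tM p q) x"
        by (rule ext) (simp add: shift_def affine_subst_def)
      then show "(?h \<circ> A q) x = (?s \<circ> shift ?a \<circ> affine_subst 0 (tM p q)) x"
        by (simp add: transition)
    qed
    ultimately show ?thesis using k(1) by (metis mcoeff_poly_span mem_Collect_eq not_le)
  qed
  moreover have "mcoeff (project (U p) \<gamma>) (?h \<circ> A p) \<noteq> 0"
    unfolding hA cfs[OF fU] using g(3) split by (simp add: project_in_supported)
  ultimately show ?thesis
    unfolding leads_def using hn deg g(1) by (auto simp: project_in_supported intro!: bexI[of _ ?h])
qed

end

section \<open>Combinatorial inequalities\<close>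

lemma deg_fun_upd: "\<gamma> j = 0 \<Longrightarrow> deg (\<gamma>(j := i)) = deg \<gamma> + i"
proof -
  assume "\<gamma> j = 0"
  moreover have "(\<Sum>x\<in>UNIV - {j}. (\<gamma>(j := i)) x) = (\<Sum>x\<in>UNIV - {j}. \<gamma> x)"
    by (rule sum.cong) auto
  ultimately show ?thesis by (simp add: deg_def sum.remove[of UNIV j])
qed

lemma supported_empty: "supported {} = {0}"
proof
  show "supported {} \<subseteq> {0 :: 'a \<Rightarrow> nat}"
  proof
    fix \<gamma> :: "'a \<Rightarrow> nat" assume "\<gamma> \<in> supported {}"
    then have "\<gamma> = 0" by (intro ext) (simp add: supported_def)
    then show "\<gamma> \<in> {0}" by simp
  qed
qed (simp add: supported_zero)

text \<open>Sort the exponents by their value at a new coordinate \<open>j\<close>; the resulting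
  sum is the hockey-stick identity.\<close>

lemma card_supported_deg_le:
  "card {\<gamma> \<in> supported (U :: 'd::finite set). deg \<gamma> \<le> n} = (n + card U) choose (card U)"
proof -
  have "finite U" by simp
  then show ?thesis
  proof (induction U arbitrary: n rule: finite_induct)
    case empty
    have "{\<gamma> \<in> supported ({} :: 'd set). deg \<gamma> \<le> n} = {0}"
      unfolding supported_empty by (auto simp: deg_zero)
    then show ?case by simp
  next
    case (insert j U)
    let ?S = "SIGMA i:{..n}. {\<gamma> \<in> supported U. deg \<gamma> \<le> n - i}"
    let ?h = "\<lambda>(i, \<gamma>). \<gamma>(j := i)"
    have z: "\<gamma> j = 0" if "\<gamma> \<in> supported U" for \<gamma> using that insert(2) by (auto simp: supported_def)
    have inj: "inj_on ?h ?S"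
    proof (rule inj_onI, clarify)
      fix i k :: nat and \<gamma> \<delta> :: "'d \<Rightarrow> nat"
      assume h: "\<gamma> \<in> supported U" "\<delta> \<in> supported U" "\<gamma>(j := i) = \<delta>(j := k)"
      have "i = k" using fun_cong[OF h(3), of j] by simp
      moreover have "\<gamma> x = \<delta> x" for x
        using fun_cong[OF h(3), of x] z[OF h(1)] z[OF h(2)] by (cases "x = j") auto
      ultimately show "i = k \<and> \<gamma> = \<delta>" by auto
    qed
    have img: "?h ` ?S = {\<gamma> \<in> supported (insert j U). deg \<gamma> \<le> n}" (is "_ = ?R")
    proof (rule subset_antisym; rule subsetI)
      fix \<gamma> :: "'d \<Rightarrow> nat" assume \<gamma>: "\<gamma> \<in> ?R"
      have "deg \<gamma> = deg (\<gamma>(j := 0)) + \<gamma> j"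
        using deg_fun_upd[of "\<gamma>(j := 0)" j "\<gamma> j"] by simp
      then have "(\<gamma> j, \<gamma>(j := 0)) \<in> ?S" using \<gamma> by (auto simp: supported_def)
      then have "?h (\<gamma> j, \<gamma>(j := 0)) \<in> ?h ` ?S" by (rule imageI)
      then show "\<gamma> \<in> ?h ` ?S" by simp
    next
      fix \<beta> assume "\<beta> \<in> ?h ` ?S"
      then obtain x where x: "x \<in> ?S" "\<beta> = ?h x" by (rule imageE)
      obtain i \<gamma> where "x = (i, \<gamma>)" by (cases x)
      with x have h: "i \<le> n" "\<gamma> \<in> supported U" "deg \<gamma> \<le> n - i" and \<beta>: "\<beta> = \<gamma>(j := i)" by auto
      have "\<beta> \<in> supported (insert j U)" using h(2) by (simp add: supported_def \<beta>)
      moreover have "deg \<beta> \<le> n" using h deg_fun_upd[of \<gamma> j i] z[OF h(2)] by (simp add: \<beta>)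
      ultimately show "\<beta> \<in> ?R" by simp
    qed
    have "card {\<gamma> \<in> supported (insert j U). deg \<gamma> \<le> n} = card ?S"
      using card_image[OF inj] unfolding img .
    also have "\<dots> = (\<Sum>i\<le>n. card {\<gamma> \<in> supported U. deg \<gamma> \<le> n - i})"
      by (intro card_SigmaI) (auto intro: finite_subset[OF _ finite_deg_le])
    also have "\<dots> = (\<Sum>i\<le>n. (card U + i) choose card U)"
      unfolding insert(3)
      by (rule sum.reindex_bij_witness[of _ "\<lambda>i. n - i" "\<lambda>i. n - i"]) (auto simp: add.commute)
    also have "\<dots> = (card U + n + 1) choose (card U + 1)"
      by (rule choose_rising_sum)
    finally show ?case using insert(1,2) by (simp add: add.commute)
  qed
qed

section \<open>AM-GM, Hoelder and Shearer inequalities\<close>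

lemma weighted_AM_GM:
  fixes x u :: "'i \<Rightarrow> real"
  assumes "finite I" "\<And>i. i \<in> I \<Longrightarrow> 0 < x i" "\<And>i. i \<in> I \<Longrightarrow> 0 \<le> u i" "(\<Sum>i\<in>I. u i) = 1"
  shows "(\<Prod>i\<in>I. x i powr u i) \<le> (\<Sum>i\<in>I. u i * x i)"
proof -
  have "I \<noteq> {}" using assms(4) by auto
  have "(\<Prod>i\<in>I. x i powr u i) = (\<Prod>i\<in>I. exp (u i * ln (x i)))"
    by (intro prod.cong refl) (simp add: powr_def less_imp_neq[OF assms(2), symmetric])
  also have "\<dots> = exp (\<Sum>i\<in>I. u i *\<^sub>R ln (x i))" by (simp add: exp_sum assms(1))
  also have "\<dots> \<le> (\<Sum>i\<in>I. u i * exp (ln (x i)))"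
    using assms \<open>I \<noteq> {}\<close> by (intro convex_on_sum[OF _ _ exp_convex]) auto
  also have "\<dots> = (\<Sum>i\<in>I. u i * x i)" by (intro sum.cong refl) (simp add: assms(2))
  finally show ?thesis .
qed

text \<open>After division of each \<open>a i\<close> by its sum over \<open>V\<close>, AM-GM at
  every \<open>v\<close> gives terms whose total is the sum of the \<open>u i\<close>, which is
  1.\<close>

lemma Hoelder_sum:
  fixes a :: "'i \<Rightarrow> 'v \<Rightarrow> real"
  assumes I: "finite I" "\<And>i. i \<in> I \<Longrightarrow> 0 \<le> u i" "(\<Sum>i\<in>I. u i) = 1"
    and V: "finite V" "V \<noteq> {}" "\<And>i v. i \<in> I \<Longrightarrow> v \<in> V \<Longrightarrow> 0 < a i v"
  shows "(\<Sum>v\<in>V. \<Prod>i\<in>I. a i v powr u i) \<le> (\<Prod>i\<in>I. (\<Sum>v\<in>V. a i v) powr u i)"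
proof -
  let ?A = "\<lambda>i. \<Sum>v\<in>V. a i v"
  have A: "0 < ?A i" if "i \<in> I" for i using V that by (intro sum_pos) auto
  have "(\<Sum>v\<in>V. \<Prod>i\<in>I. a i v powr u i) =
    (\<Sum>v\<in>V. (\<Prod>i\<in>I. (a i v / ?A i) powr u i) * (\<Prod>i\<in>I. ?A i powr u i))"
  proof (rule sum.cong[OF refl])
    fix v assume v: "v \<in> V"
    have "a i v powr u i = (a i v / ?A i) powr u i * ?A i powr u i" if "i \<in> I" for i
      using A[OF that] V(3)[OF that v] by (subst powr_mult[symmetric]) auto
    then show "(\<Prod>i\<in>I. a i v powr u i) = (\<Prod>i\<in>I. (a i v / ?A i) powr u i) * (\<Prod>i\<in>I. ?A i powr u i)"
      unfolding prod.distrib[symmetric] by (intro prod.cong) auto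
  qed
  also have "\<dots> \<le> (\<Sum>v\<in>V. (\<Sum>i\<in>I. u i * (a i v / ?A i)) * (\<Prod>i\<in>I. ?A i powr u i))"
    using A V by (intro sum_mono mult_right_mono weighted_AM_GM I prod_nonneg) auto
  also have "\<dots> = (\<Sum>i\<in>I. \<Sum>v\<in>V. u i * (a i v / ?A i)) * (\<Prod>i\<in>I. ?A i powr u i)"
    by (subst sum.swap) (simp add: sum_distrib_right)
  also have "(\<Sum>i\<in>I. \<Sum>v\<in>V. u i * (a i v / ?A i)) = (\<Sum>i\<in>I. u i)"
  proof (rule sum.cong[OF refl])
    fix i assume "i \<in> I"
    then have "?A i \<noteq> 0" using A by force
    then show "(\<Sum>v\<in>V. u i * (a i v / ?A i)) = u i"
      by (simp add: sum_divide_distrib[symmetric] sum_distrib_left[symmetric])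
  qed
  finally show ?thesis using I(3) by simp
qed

text \<open>Shearer's inequality.\<close>

lemma card_le_prod_projections:
  fixes T :: "('d::finite \<Rightarrow> nat) set"
  assumes I: "finite I" "\<And>i. i \<in> I \<Longrightarrow> 0 \<le> u i"
    and cover: "\<And>j. j \<in> D \<Longrightarrow> (\<Sum>i | i \<in> I \<and> j \<in> S i. u i) = 1"
    and T: "finite T" "T \<subseteq> supported D"
  shows "real (card T) \<le> (\<Prod>i\<in>I. real (card (project (S i) ` T)) powr u i)"
proof -
  have "finite D" by simp
  then show ?thesis using cover T
  proof (induction D arbitrary: T rule: finite_induct)
    case empty
    then consider "T = {}" | "T = {0}" unfolding supported_empty by blast
    then show ?case
    proof cases
      case 2
      then show ?thesis by simp
    qed (simp add: prod_nonneg)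
  next
    case (insert j D)
    show ?case
    proof (cases "T = {}")
      case True
      then show ?thesis by (simp add: prod_nonneg)
    next
      case False
      let ?V = "(\<lambda>\<gamma>. \<gamma> j) ` T"
      let ?T = "\<lambda>v. (\<lambda>\<gamma>. \<gamma>(j := 0)) ` {\<gamma> \<in> T. \<gamma> j = v}"
      let ?a = "\<lambda>i v. real (card (project (S i) ` ?T v))"
      let ?I = "{i \<in> I. j \<in> S i}"
      have finV: "finite ?V" "?V \<noteq> {}" using insert.prems(2) False by auto
      have finT: "finite (?T v)" for v using insert.prems(2) by simp
      have a_pos: "0 < ?a i v" if "v \<in> ?V" for i v
        using that finT by (auto simp: card_gt_0_iff)
      have inj: "inj_on (\<lambda>\<gamma>. \<gamma>(j := 0)) {\<gamma> \<in> T. \<gamma> j = v}" for v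
        by (rule inj_onI) (auto simp: fun_eq_iff, metis)
      have "card T = card (\<Union>v\<in>?V. {\<gamma> \<in> T. \<gamma> j = v})" by (rule arg_cong[of _ _ card]) auto
      also have "\<dots> = (\<Sum>v\<in>?V. card {\<gamma> \<in> T. \<gamma> j = v})"
        using finV insert.prems(2) by (intro card_UN_disjoint) auto
      also have "\<dots> = (\<Sum>v\<in>?V. card (?T v))"
        by (simp add: card_image[OF inj])
      finally have "real (card T) = (\<Sum>v\<in>?V. real (card (?T v)))" by simp
      also have "\<dots> \<le> (\<Sum>v\<in>?V. \<Prod>i\<in>I. ?a i v powr u i)"
      proof (rule sum_mono)
        fix v
        have "?T v \<subseteq> supported D"
        proof
          fix \<delta> assume "\<delta> \<in> ?T v"
          then obtain \<gamma> where "\<gamma> \<in> supported (insert j D)" "\<delta> = \<gamma>(j := 0)" using insert.prems(3) by blast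
          then show "\<delta> \<in> supported D" by (simp add: supported_def)
        qed
        then show "real (card (?T v)) \<le> (\<Prod>i\<in>I. ?a i v powr u i)"
          by (intro insert.IH[OF insert.prems(1) finT]) simp
      qed
      \<comment> \<open>If \<open>j \<notin> S i\<close>, the projection of a section is contained
        in that of \<open>T\<close>. The weights of the other \<open>i\<close> add up to 1, so
        Hoelder applies to them; there the projections of the sections, with the coordinate
        \<open>j\<close> restored, are disjoint parts of the projection of \<open>T\<close>.\<close>
      also have "\<dots> = (\<Sum>v\<in>?V. (\<Prod>i\<in>?I. ?a i v powr u i) * (\<Prod>i\<in>I-?I. ?a i v powr u i))"
        by (intro sum.cong refl) (subst prod.subset_diff[OF _ I(1), of ?I], auto)
      also have "\<dots> \<le> (\<Sum>v\<in>?V. (\<Prod>i\<in>?I. ?a i v powr u i) * (\<Prod>i\<in>I-?I. real (card (project (S i) ` T)) powr u i))"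
      proof (intro sum_mono mult_left_mono prod_mono conjI powr_mono2)
        fix v i assume vi: "v \<in> ?V" "i \<in> I - ?I"
        then have "project (S i) (\<gamma>(j := 0)) = project (S i) \<gamma>" for \<gamma> by (auto simp: project_def fun_eq_iff)
        then have "project (S i) ` ?T v \<subseteq> project (S i) ` T" by (auto simp: image_iff)
        then show "?a i v \<le> real (card (project (S i) ` T))"
          using insert.prems(2) by (simp add: card_mono)
      qed (use I in \<open>auto intro: prod_nonneg\<close>)
      also have "\<dots> = (\<Sum>v\<in>?V. \<Prod>i\<in>?I. ?a i v powr u i) * (\<Prod>i\<in>I-?I. real (card (project (S i) ` T)) powr u i)"
        by (simp add: sum_distrib_right)
      also have "\<dots> \<le> (\<Prod>i\<in>?I. (\<Sum>v\<in>?V. ?a i v) powr u i) * (\<Prod>i\<in>I-?I. real (card (project (S i) ` T)) powr u i)"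
        using I a_pos finV insert.prems(1)[of j]
        by (intro mult_right_mono Hoelder_sum prod_nonneg) auto
      also have "\<dots> \<le> (\<Prod>i\<in>?I. real (card (project (S i) ` T)) powr u i) * (\<Prod>i\<in>I-?I. real (card (project (S i) ` T)) powr u i)"
      proof (intro mult_right_mono prod_mono conjI powr_mono2)
        fix i assume i: "i \<in> ?I"
        let ?h = "\<lambda>(v, \<delta>). \<delta>(j := v)"
        let ?P = "SIGMA v:?V. project (S i) ` ?T v"
        have zero: "\<delta> j = 0" if "\<delta> \<in> project (S i) ` ?T v" for \<delta> v using that by (auto simp: project_def)
        have "inj_on ?h ?P"
        proof (rule inj_onI)
          fix x y assume xy: "x \<in> ?P" "y \<in> ?P" "?h x = ?h y"
          obtain v \<delta> v' \<delta>' where x: "x = (v, \<delta>)" and y: "y = (v', \<delta>')" by (metis surj_pair)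
          have h: "\<delta> \<in> project (S i) ` ?T v" "\<delta>' \<in> project (S i) ` ?T v'" "\<delta>(j := v) = \<delta>'(j := v')"
            using xy(1,2) unfolding x y by (blast, blast, use xy(3) in \<open>simp add: x y\<close>)
          have "v = v'" using fun_cong[OF h(3), of j] by simp
          moreover have "\<delta> x = \<delta>' x" for x
            using fun_cong[OF h(3), of x] zero[OF h(1)] zero[OF h(2)] by (cases "x = j") auto
          ultimately show "x = y" unfolding x y by auto
        qed
        moreover have "?h ` ?P \<subseteq> project (S i) ` T"
        proof
          fix \<beta> assume "\<beta> \<in> ?h ` ?P"
          then obtain x where x: "x \<in> ?P" "\<beta> = ?h x" by (rule imageE)
          then obtain v \<delta> where "\<beta> = \<delta>(j := v)" "\<delta> \<in> project (S i) ` ?T v"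
            by (cases x) (simp only: mem_Sigma_iff split_conv)
          then obtain \<gamma> where \<gamma>: "\<gamma> \<in> T" "\<beta> = (project (S i) (\<gamma>(j := 0)))(j := \<gamma> j)" by blast
          have "\<beta> = project (S i) \<gamma>" unfolding \<gamma>(2) using i by (intro ext) (simp add: project_def)
          then show "\<beta> \<in> project (S i) ` T" using \<gamma>(1) by blast
        qed
        ultimately have "card ?P \<le> card (project (S i) ` T)"
          by (rule card_inj_on_le) (rule finite_imageI[OF insert.prems(2)])
        moreover have "card ?P = (\<Sum>v\<in>?V. card (project (S i) ` ?T v))"
          using finV finT by (intro card_SigmaI) auto
        ultimately show "(\<Sum>v\<in>?V. ?a i v) \<le> real (card (project (S i) ` T))"
          by (simp only: of_nat_sum[symmetric] of_nat_le_iff)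
      qed (use I in \<open>auto intro: prod_nonneg sum_nonneg\<close>)
      also have "\<dots> = (\<Prod>i\<in>I. real (card (project (S i) ` T)) powr u i)"
        by (subst prod.subset_diff[OF _ I(1), of ?I]) auto
      finally show ?thesis .
    qed
  qed
qed

text \<open>
  Handicaps are lowered one at a time, at points where \<open>B\<close> is still too large. All points ever
  lowered keep \<open>B > lam\<close>, and \<open>block\<close> prevents a group of them from drifting away.
\<close>

lemma exists_balanced_handicap:
  fixes B :: "('p \<Rightarrow> int) \<Rightarrow> 'p \<Rightarrow> real"
  assumes J: "finite J" and "0 \<le> \<epsilon>"
    and mono: "\<And>\<alpha> p q. p \<in> J \<Longrightarrow> q \<in> J \<Longrightarrow> p \<noteq> q \<Longrightarrow> B \<alpha> q \<le> B (\<alpha>(p := \<alpha> p - 1)) q"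
    and lip: "\<And>\<alpha> p. p \<in> J \<Longrightarrow> B \<alpha> p - \<epsilon> \<le> B (\<alpha>(p := \<alpha> p - 1)) p"
    and block: "\<And>\<alpha> D. D \<subseteq> J \<Longrightarrow> D \<noteq> {} \<Longrightarrow>
      (\<And>p q. p \<in> D \<Longrightarrow> q \<in> J - D \<Longrightarrow> \<alpha> p + int n < \<alpha> q) \<Longrightarrow> (\<Sum>p\<in>D. B \<alpha> p) \<le> lam * real (card D)"
  shows "\<exists>\<alpha>. \<forall>p\<in>J. B \<alpha> p \<le> lam + \<epsilon>"
proof -
  define good where "good \<alpha> \<longleftrightarrow> (\<forall>p\<in>J. \<alpha> p \<le> 0 \<and> (\<alpha> p = 0 \<or> lam < B \<alpha> p))" for \<alpha> :: "'p \<Rightarrow> int"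
  define K where "K = int n + 1"
  have bound: "- (int (card J) * K) \<le> \<alpha> p" if \<alpha>: "good \<alpha>" and p: "p \<in> J" for \<alpha> p
  proof (rule ccontr)
    assume c: "\<not> - (int (card J) * K) \<le> \<alpha> p"
    \<comment> \<open>Levels of width \<open>K = n + 1\<close>. The sets \<open>D m\<close> decrease
      and contain \<open>p\<close> for all \<open>m \<le> card J\<close>, so they cannot shrink
      strictly \<open>card J\<close> times. Hence some level is empty and \<open>D m\<close> lies
      more than \<open>n\<close> below the rest; \<open>block\<close> then contradicts
      \<open>B > lam\<close> on \<open>D m\<close>.\<close>
    define D where "D m = {q \<in> J. \<alpha> q < - (int m * K)}" for m
    have finD: "finite (D m)" for m using J by (simp add: D_def)
    have anti: "D (Suc m) \<subseteq> D m" for m by (auto simp: D_def K_def algebra_simps)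
    have pD: "p \<in> D m" if "m \<le> card J" for m
    proof -
      have "int m * K \<le> int (card J) * K" using that by (intro mult_right_mono) (auto simp: K_def)
      then show ?thesis using c p by (simp add: D_def)
    qed
    have "\<exists>m<card J. D (Suc m) = D m"
    proof (rule ccontr)
      assume nex: "\<not> (\<exists>m<card J. D (Suc m) = D m)"
      have "m \<le> card J \<Longrightarrow> card (D m) + m \<le> card J" for m
      proof (induction m)
        case 0
        then show ?case using J by (auto simp: D_def intro: card_mono)
      next
        case (Suc m)
        then have "D (Suc m) \<subset> D m" using nex anti by auto
        then have "card (D (Suc m)) < card (D m)" using finD by (intro psubset_card_mono)
        then show ?case using Suc by simp
      qed
      from this[of "card J"] have "card (D (card J)) = 0" by simp
      then show False using pD[of "card J"] finD by auto
    qed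
    then obtain m where m: "m < card J" "D (Suc m) = D m" by blast
    have ne: "D m \<noteq> {}" using pD[of m] m(1) by auto
    have "(\<Sum>q\<in>D m. B \<alpha> q) \<le> lam * real (card (D m))"
    proof (rule block)
      fix q q' assume "q \<in> D m" "q' \<in> J - D m"
      then have "q \<in> D (Suc m)" "q' \<in> J" "q' \<notin> D m" unfolding m(2) by auto
      then have "\<alpha> q < - (int (Suc m) * K)" "- (int m * K) \<le> \<alpha> q'"
        by (simp_all add: D_def)
      then show "\<alpha> q + int n < \<alpha> q'" by (simp add: K_def algebra_simps)
    qed (use ne in \<open>auto simp: D_def\<close>)
    moreover have "(\<Sum>q\<in>D m. lam) < (\<Sum>q\<in>D m. B \<alpha> q)"
    proof (rule sum_strict_mono)
      fix q assume "q \<in> D m"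
      moreover have "0 \<le> int m * K" by (simp add: K_def)
      ultimately show "lam < B \<alpha> q" using \<alpha> by (auto simp: D_def good_def)
    qed (use finD ne in auto)
    ultimately show False by (simp add: mult.commute)
  qed
  \<comment> \<open>The total amount of lowering, which \<open>bound\<close> limits for good
    handicaps. Where it is maximal no point exceeds \<open>lam + \<epsilon>\<close>: lowering such a
    point would keep the handicap good, by \<open>lip\<close> for the point itself and by
    \<open>mono\<close> for the others.\<close>
  define f where "f \<alpha> = nat (\<Sum>p\<in>J. - \<alpha> p)" for \<alpha> :: "'p \<Rightarrow> int"
  have "f \<alpha> \<le> nat (int (card J) * (int (card J) * K))" if "good \<alpha>" for \<alpha>
  proof -
    have "(\<Sum>p\<in>J. - \<alpha> p) \<le> (\<Sum>p\<in>J. int (card J) * K)"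
      using bound[OF that] by (intro sum_mono) (simp add: minus_le_iff)
    then show ?thesis unfolding f_def by (intro nat_mono) simp
  qed
  moreover have "good (\<lambda>_. 0)" by (simp add: good_def)
  ultimately obtain \<alpha> where \<alpha>: "good \<alpha>" "\<And>\<beta>. good \<beta> \<Longrightarrow> f \<beta> \<le> f \<alpha>"
    using ex_has_greatest_nat[of good "\<lambda>_. 0" f "Suc (nat (int (card J) * (int (card J) * K)))"]
    by (metis le_imp_less_Suc)
  have "B \<alpha> p \<le> lam + \<epsilon>" if p: "p \<in> J" for p
  proof (rule ccontr)
    assume c: "\<not> B \<alpha> p \<le> lam + \<epsilon>"
    let ?\<beta> = "\<alpha>(p := \<alpha> p - 1)"
    have "good ?\<beta>"
      unfolding good_def
    proof (intro ballI conjI)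
      fix q assume q: "q \<in> J"
      show "?\<beta> q \<le> 0" using \<alpha>(1) p q by (auto simp: good_def)
      show "?\<beta> q = 0 \<or> lam < B ?\<beta> q"
      proof (cases "q = p")
        case True
        then show ?thesis using lip[OF p, of \<alpha>] c by auto
      next
        case False
        then show ?thesis using mono[OF p q, of \<alpha>] \<alpha>(1) q by (force simp: good_def)
      qed
    qed
    then have "f ?\<beta> \<le> f \<alpha>" by (rule \<alpha>(2))
    moreover have "(\<Sum>q\<in>J. - ?\<beta> q) = (\<Sum>q\<in>J. - \<alpha> q) + 1"
    proof -
      have "(\<Sum>q\<in>J - {p}. - ?\<beta> q) = (\<Sum>q\<in>J - {p}. - \<alpha> q)" by (rule sum.cong) auto
      then show ?thesis using sum.remove[OF J p, of "\<lambda>q. - ?\<beta> q"] sum.remove[OF J p, of "\<lambda>q. - \<alpha> q"] by simp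
    qed
    moreover have "0 \<le> (\<Sum>q\<in>J. - \<alpha> q)"
      using \<alpha>(1) by (intro sum_nonneg) (auto simp: good_def)
    ultimately show False by (simp add: f_def)
  qed
  then show ?thesis by blast
qed

section \<open>Families of joints\<close>

definition affine_map :: "('a::field ^ 'd::finite \<Rightarrow> 'a ^ 'd) \<Rightarrow> bool" where
  "affine_map T \<longleftrightarrow> (\<exists>L b. Vector_Spaces.linear (*s) (*s) L \<and> T = (\<lambda>x. L x + b))"

definition offset :: "('a::field ^ 'd::finite \<Rightarrow> 'a ^ 'd) \<Rightarrow> 'd \<Rightarrow> 'a" where
  "offset T i = T 0 $ i"

definition linear_part :: "('a::field ^ 'd::finite \<Rightarrow> 'a ^ 'd) \<Rightarrow> 'd \<Rightarrow> 'd \<Rightarrow> 'a" where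
  "linear_part T i j = (T (axis j 1) - T 0) $ i"

lemma affine_map_apply:
  assumes "affine_map T"
  shows "T x $ i = offset T i + (\<Sum>j\<in>UNIV. linear_part T i j * x $ j)"
proof -
  obtain L b where L: "Vector_Spaces.linear (*s) (*s) L" and T: "T = (\<lambda>x. L x + b)"
    using assms by (auto simp: affine_map_def)
  have L0: "L 0 = 0" using vec.linear_0[OF L] .
  show ?thesis
    using linear_componentwise[OF L, of x i] by (simp add: T offset_def linear_part_def L0 mult.commute)
qed

lemma affine_map_inv:
  assumes "invertible_affine T"
  shows "affine_map (inv T)"
proof -
  obtain L b where L: "Vector_Spaces.linear (*s) (*s) L" and T: "T = (\<lambda>x. L x + b)" and bij: "bij T"
    using assms by (auto simp: invertible_affine_def)
  have "inj L" using bij_is_inj[OF bij] by (auto simp: T inj_def)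
  then obtain K where K: "Vector_Spaces.linear (*s) (*s) K" "K \<circ> L = id"
    using vec.linear_injective_left_inverse[OF L] by blast
  have "inv T y = K y + - K b" for y
  proof -
    have "T (inv T y) = y" using bij by (simp add: bij_is_surj surj_f_inv_f)
    then have "K (L (inv T y)) = K (y - b)" unfolding T by (metis add_diff_cancel_right')
    then show ?thesis using K(2) vec.linear_diff[OF K(1)] by (simp add: fun_eq_iff)
  qed
  then show ?thesis using K(1) unfolding affine_map_def by blast
qed

text \<open>Transfers identities such as \<open>A p \<circ> inv (A p) = id\<close> from vectors over
  the field to points with polynomial coordinates.\<close>

lemma affine_subst_comp_affine_map:
  assumes "affine_map S"
  shows "affine_subst (offset S) (linear_part S) (affine_subst (offset T) (linear_part T) x) = affine_subst (offset (S \<circ> T)) (linear_part (S \<circ> T)) x"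
proof -
  have "offset S i + (\<Sum>j\<in>UNIV. linear_part S i j * offset T j) = offset (S \<circ> T) i" for i
    using affine_map_apply[OF assms, of "T 0" i] by (simp add: offset_def)
  moreover have "(\<Sum>j\<in>UNIV. linear_part S i j * linear_part T j k) = linear_part (S \<circ> T) i k" for i k
    using affine_map_apply[OF assms, of "T 0" i] affine_map_apply[OF assms, of "T (axis k 1)" i]
    by (simp add: linear_part_def sum_subtractf right_diff_distrib)
  ultimately show ?thesis unfolding affine_subst_comp by presburger
qed

lemma affine_subst_id: "affine_subst (offset id) (linear_part id) x = x"
proof
  fix i
  have "(\<Sum>j\<in>UNIV. smult (linear_part id i j) (x j)) = (\<Sum>j\<in>UNIV. if j = i then x j else 0)"
    by (rule sum.cong) (auto simp: linear_part_def axis_def)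
  then show "affine_subst (offset id) (linear_part id) x i = x i" by (simp add: affine_subst_def offset_def)
qed

lemma span_axis_subset: "vec.span {axis j 1 | j. j \<in> U} \<subseteq> {x :: 'a::field ^ 'd::finite. \<forall>i. i \<notin> U \<longrightarrow> x $ i = 0}"
  by (rule vec.span_minimal) (auto simp: vec.subspace_def axis_def)

text \<open>\<open>R\<close> may be any nonempty finite set of joints, so that the induction in
  \<open>card_joint_family_le\<close> can discard some. For each joint a frame and its flats are
  chosen once and for all.\<close>

locale joint_family =
  fixes E :: "'e set" and V :: "'e \<Rightarrow> 'd::finite set" and c :: "'e \<Rightarrow> nat"
    and r :: nat and k :: "nat \<Rightarrow> nat"
    and R :: "('a::field ^ 'd) set" and Fl :: "'a ^ 'd \<Rightarrow> 'e \<Rightarrow> ('a ^ 'd) set"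
    and A :: "'a ^ 'd \<Rightarrow> 'a ^ 'd \<Rightarrow> 'a ^ 'd"
  assumes colored: "uniformly_edge_colored E V c r k"
    and finite_R: "finite R" and R_ne: "R \<noteq> {}"
    and frame: "\<And>p. p \<in> R \<Longrightarrow> invertible_affine (A p)" "\<And>p. p \<in> R \<Longrightarrow> A p 0 = p"
      "\<And>p e. p \<in> R \<Longrightarrow> e \<in> E \<Longrightarrow> Fl p e = A p ` vec.span {axis j 1 | j. j \<notin> V e}"
begin

lemma bij_A: "p \<in> R \<Longrightarrow> bij (A p)"
  using frame(1) by (simp add: invertible_affine_def)

lemma affine_A: "p \<in> R \<Longrightarrow> affine_map (A p)"
  using frame(1) by (auto simp: invertible_affine_def affine_map_def)

lemma affine_inv_A: "p \<in> R \<Longrightarrow> affine_map (inv (A p))"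
  by (rule affine_map_inv[OF frame(1)])

sublocale fr: frames R "\<lambda>p. offset (A p)" "\<lambda>p. offset (inv (A p))" "\<lambda>p. linear_part (A p)"
  "\<lambda>p. linear_part (inv (A p))" "SOME f. inj_on f R"
proof
  show "finite R" by (rule finite_R)
  show "affine_subst (offset (A p)) (linear_part (A p)) (affine_subst (offset (inv (A p))) (linear_part (inv (A p))) x) = x"
    if "p \<in> R" for p x
  proof -
    have "A p \<circ> inv (A p) = id" using bij_is_surj[OF bij_A[OF that]] unfolding surj_iff .
    then show ?thesis by (simp add: affine_subst_comp_affine_map[OF affine_A[OF that]] affine_subst_id)
  qed
  show "affine_subst (offset (inv (A p))) (linear_part (inv (A p))) (affine_subst (offset (A p)) (linear_part (A p)) x) = x"
    if "p \<in> R" for p x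
  proof -
    have "inv (A p) \<circ> A p = id" using bij_A[OF that] by (simp add: bij_is_inj)
    then show ?thesis by (simp add: affine_subst_comp_affine_map[OF affine_inv_A[OF that]] affine_subst_id)
  qed
  show "inj_on (\<lambda>p. offset (A p)) R"
    by (rule inj_onI) (use frame(2) in \<open>auto simp: offset_def vec_eq_iff fun_eq_iff\<close>)
  obtain f :: "'a ^ 'd \<Rightarrow> nat" where "inj_on f R"
    using finite_imp_inj_to_nat_seg[OF finite_R] by blast
  then show "inj_on (SOME f :: 'a ^ 'd \<Rightarrow> nat. inj_on f R) R" by (rule someI[of "\<lambda>f. inj_on f R"])
qed

section \<open>Flats of a family and the shares on them\<close>

lemma tb_eq: "p \<in> R \<Longrightarrow> fr.tb p q i = inv (A p) (A q 0) $ i"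
  unfolding fr.tb_def by (subst affine_map_apply[OF affine_inv_A]) (auto simp: offset_def)

lemma tM_eq: "p \<in> R \<Longrightarrow> fr.tM p q i j = inv (A p) (A q (axis j 1)) $ i - inv (A p) (A q 0) $ i"
  unfolding fr.tM_def
  by (subst (1 2) affine_map_apply[OF affine_inv_A])
    (auto simp: linear_part_def sum_subtractf right_diff_distrib)

text \<open>Only flats chosen by joints of \<open>R\<close>, without multiplicity: when joints are
  discarded, the flats that only they chose must disappear as well.\<close>

definition flats :: "nat \<Rightarrow> ('a ^ 'd) set set" where
  "flats i = {Fl p e | p e. p \<in> R \<and> e \<in> E \<and> c e = i}"

text \<open>A joint that merely lies on \<open>F\<close> is not counted; \<open>F\<close> has to be
  one of its chosen flats of color \<open>i\<close>, since only then do axes of its frame span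
  \<open>F\<close>.\<close>

definition points :: "nat \<Rightarrow> ('a ^ 'd) set \<Rightarrow> ('a ^ 'd) set" where
  "points i F = {p \<in> R. \<exists>e\<in>E. c e = i \<and> Fl p e = F}"

text \<open>This is \<open>- V e\<close> if \<open>F = Fl p e\<close>; phrased without
  \<open>e\<close>, so that \<open>axes F\<close> can serve as the map \<open>U\<close>.\<close>

definition axes :: "('a ^ 'd) set \<Rightarrow> 'a ^ 'd \<Rightarrow> 'd set" where
  "axes F p = {j. A p (axis j 1) \<in> F}"

lemma finite_E: "finite E" using colored by (simp add: uniformly_edge_colored_def)

lemma color_range: "e \<in> E \<Longrightarrow> c e \<in> {1..r}"
  using colored by (auto simp: uniformly_edge_colored_def)

lemma finite_flats: "finite (flats i)"
proof -
  have "flats i \<subseteq> (\<lambda>(p, e). Fl p e) ` (R \<times> E)" by (auto simp: flats_def)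
  then show ?thesis using finite_R finite_E finite_subset by blast
qed

lemma flats_ne: "i \<in> {1..r} \<Longrightarrow> flats i \<noteq> {}"
proof -
  assume "i \<in> {1..r}"
  then have "{e \<in> E. c e = i} \<noteq> {}" using colored unfolding uniformly_edge_colored_def by blast
  then show ?thesis using R_ne by (auto simp: flats_def)
qed

lemma points_ne: "F \<in> flats i \<Longrightarrow> points i F \<noteq> {}"
  by (auto simp: flats_def points_def)

lemma points_subset: "points i F \<subseteq> R"
  by (auto simp: points_def)

lemma axes_eq:
  assumes "p \<in> R" "e \<in> E"
  shows "axes (Fl p e) p = - V e"
proof -
  let ?S = "vec.span {axis j 1 | j. j \<notin> V e} :: ('a ^ 'd) set"
  have "A p x \<in> A p ` ?S \<longleftrightarrow> x \<in> ?S" for x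
    using bij_A[OF assms(1)] by (simp add: bij_is_inj inj_image_mem_iff)
  moreover have "axis j 1 \<in> ?S \<longleftrightarrow> j \<notin> V e" for j
  proof
    assume "axis j 1 \<in> ?S"
    then have "\<forall>i. i \<notin> - V e \<longrightarrow> (axis j 1 :: 'a ^ 'd) $ i = 0"
      using span_axis_subset[of "- V e"] by auto
    then show "j \<notin> V e" by (auto simp: axis_def)
  qed (auto intro: vec.span_base)
  ultimately show ?thesis by (auto simp: axes_def frame(3)[OF assms])
qed

lemma card_axes:
  assumes "p \<in> R" "e \<in> E"
  shows "card (axes (Fl p e) p) = k (c e)"
proof -
  have "k (c e) \<le> CARD('d) - 1" "card (V e) = CARD('d) - k (c e)"
    using colored color_range[OF assms(2)] assms(2) by (auto simp: uniformly_edge_colored_def)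
  then show ?thesis unfolding axes_eq[OF assms] by (simp add: card_Diff_subset Compl_eq_Diff_UNIV)
qed

text \<open>The frame recovers \<open>V e\<close> from the flat, and the color classes are simple.
  In \<open>prod_share_le\<close> this keeps a flat from being counted twice at one joint.\<close>

lemma Fl_inj: 
  assumes "p \<in> R" "e \<in> E" "e' \<in> E" "c e = c e'" "Fl p e = Fl p e'"
  shows "e = e'"
proof -
  have "V e = V e'" using axes_eq[OF assms(1,2)] axes_eq[OF assms(1,3)] assms(5) by auto
  moreover have "inj_on V {e' \<in> E. c e' = c e}"
    using colored color_range[OF assms(2)] by (simp add: uniformly_edge_colored_def)
  ultimately show ?thesis using assms(2-4) by (auto simp: inj_on_def)
qed

lemma flat_points: "fr.flat (points i F) (axes F)"
  unfolding fr.flat_def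
proof (intro conjI ballI allI impI)
  fix p q j assume p: "p \<in> points i F" and q: "q \<in> points i F" and j: "j \<notin> axes F p"
  obtain e e' where e: "p \<in> R" "e \<in> E" "F = Fl p e" and e': "q \<in> R" "e' \<in> E" "F = Fl q e'"
    using p q by (auto simp: points_def)
  have U: "axes F p = - V e" unfolding e(3) by (rule axes_eq[OF e(1,2)])
  have z: "inv (A p) y $ j = 0" if "y \<in> F" for y
  proof -
    from that have "y \<in> A p ` vec.span {axis j 1 | j. j \<notin> V e}"
      unfolding e(3) frame(3)[OF e(1,2)] .
    then obtain x where x: "y = A p x" "x \<in> vec.span {axis j 1 | j. j \<notin> V e}"
      by (rule imageE)
    have "x $ j = 0" using x(2) span_axis_subset[of "- V e"] j U by auto
    then show ?thesis using bij_A[OF e(1)] by (simp add: x(1) bij_is_inj)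
  qed
  have "A q 0 \<in> F" unfolding e'(3) frame(3)[OF e'(1,2)] by (auto intro: vec.span_zero)
  then have z0: "inv (A p) (A q 0) $ j = 0" by (rule z)
  then show "fr.tb p q j = 0" by (simp add: tb_eq e(1))
  show "fr.tM p q j l = 0" if "l \<in> axes F q" for l
  proof -
    have "A q (axis l 1) \<in> F" using that by (simp add: axes_def)
    then show ?thesis using z z0 by (simp add: tM_eq e(1))
  qed
qed (rule points_subset)

lemma flat_UNIV: "fr.flat R (\<lambda>_. UNIV)"
  by (simp add: fr.flat_def)

text \<open>The degree is \<open>Suc n\<close> because \<open>share_lip\<close> compares with degree
  \<open>n\<close>; the base \<open>Suc (Suc n)\<close> exceeds both, so one order serves for
  both.\<close>

definition share :: "nat \<Rightarrow> nat \<Rightarrow> ('a ^ 'd) set \<Rightarrow> (('a ^ 'd) \<Rightarrow> int) \<Rightarrow> 'a ^ 'd \<Rightarrow> nat" where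
  "share n i F \<alpha> p = (if p \<in> points i F then card (fr.leads (Suc (Suc n)) (points i F) (axes F) (Suc n) \<alpha> p) else 0)"

lemma sum_card_leads_points:
  assumes "F \<in> flats i" "m < N"
  shows "(\<Sum>p\<in>points i F. card (fr.leads N (points i F) (axes F) m \<alpha> p)) = (m + k i) choose (k i)"
proof -
  obtain p where p: "p \<in> points i F" using points_ne[OF assms(1)] by blast
  then obtain e where e: "p \<in> R" "e \<in> E" "F = Fl p e" "c e = i" by (auto simp: points_def)
  show ?thesis
    using fr.sum_card_leads[OF flat_points p assms(2), of \<alpha>] card_axes[OF e(1,2)]
    by (simp add: card_supported_deg_le e)
qed

lemma sum_share:
  assumes "F \<in> flats i"
  shows "(\<Sum>p\<in>R. share n i F \<alpha> p) = (Suc n + k i) choose (k i)"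
proof -
  have "(\<Sum>p\<in>R. share n i F \<alpha> p) = (\<Sum>p\<in>points i F. share n i F \<alpha> p)"
    by (intro sum.mono_neutral_right finite_R points_subset) (auto simp: share_def)
  also have "\<dots> = (Suc n + k i) choose (k i)"
    using sum_card_leads_points[OF assms, of "Suc n" "Suc (Suc n)" \<alpha>] by (simp add: share_def)
  finally show ?thesis .
qed

lemma share_mono:
  assumes "p \<noteq> q"
  shows "share n i F \<alpha> q \<le> share n i F (\<alpha>(p := \<alpha> p - 1)) q"
  unfolding share_def using card_mono[OF fr.finite_leads fr.leads_mono_handicap[OF assms]] by simp

text \<open>With the lowered handicap the other points have at most as many leading coefficients in
  degree \<open>n\<close> as they had in degree \<open>Suc n\<close> before. Both totals are fixed,
  so \<open>p\<close> loses at most the difference of the binomials.\<close>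

lemma share_lip:
  assumes "F \<in> flats i"
  shows "share n i F \<alpha> p + ((n + k i) choose (k i)) \<le>
    share n i F (\<alpha>(p := \<alpha> p - 1)) p + ((Suc n + k i) choose (k i))"
proof (cases "p \<in> points i F")
  case True
  let ?P = "points i F" and ?N = "Suc (Suc n)" and ?\<beta> = "\<alpha>(p := \<alpha> p - 1)"
  let ?b = "\<lambda>m \<alpha> q. card (fr.leads ?N ?P (axes F) m \<alpha> q)"
  have fin: "finite ?P" using points_subset finite_R finite_subset by blast
  have 1: "(n + k i) choose (k i) = ?b n ?\<beta> p + (\<Sum>q\<in>?P - {p}. ?b n ?\<beta> q)"
    using sum_card_leads_points[OF assms, of n ?N ?\<beta>] True fin by (simp add: sum.remove)
  have 2: "(Suc n + k i) choose (k i) = ?b (Suc n) \<alpha> p + (\<Sum>q\<in>?P - {p}. ?b (Suc n) \<alpha> q)"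
    using sum_card_leads_points[OF assms, of "Suc n" ?N \<alpha>] True fin by (simp add: sum.remove)
  have 3: "(\<Sum>q\<in>?P - {p}. ?b n ?\<beta> q) \<le> (\<Sum>q\<in>?P - {p}. ?b (Suc n) \<alpha> q)"
    using True points_subset
    by (intro sum_mono card_mono fr.finite_leads fr.leads_lower_handicap) auto
  have 4: "?b n ?\<beta> p \<le> ?b (Suc n) ?\<beta> p"
    by (intro card_mono fr.finite_leads fr.leads_mono) auto
  show ?thesis using 1 2 3 4 True by (simp add: share_def)
qed (simp add: share_def binomial_right_mono)

lemma share_gap:
  assumes "p \<in> points i F" "q \<in> points i F" "\<alpha> p + int (Suc n) < \<alpha> q"
  shows "share n i F \<alpha> p = 0"
  using fr.leads_empty[OF flat_points assms] by (simp add: share_def)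

lemma sum_card_leads_R: "m < N \<Longrightarrow> (\<Sum>p\<in>R. card (fr.leads N R (\<lambda>_. UNIV) m \<alpha> p)) = (m + CARD('d)) choose CARD('d)"
  using R_ne fr.sum_card_leads[OF flat_UNIV, of _ m N \<alpha>] by (auto simp: card_supported_deg_le)

lemma card_leads_slice:
  assumes "p \<in> R" "e \<in> E"
  shows "card (project (- V e) ` fr.leads (Suc (Suc n)) R (\<lambda>_. UNIV) (Suc n) \<alpha> p) \<le> share n (c e) (Fl p e) \<alpha> p"
proof -
  have p: "p \<in> points (c e) (Fl p e)" using assms by (auto simp: points_def)
  show ?thesis
    using p fr.leads_slice[OF flat_points p] axes_eq[OF assms] fr.finite_leads
    by (auto simp: share_def intro!: card_mono)
qed

end

section \<open>Weights\<close>

lemma power_le_fact_mult_binomial: "m ^ d \<le> fact d * ((m + d) choose d)"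
proof (induction d)
  case (Suc d)
  have "m ^ Suc d \<le> (m + Suc d) * (fact d * ((m + d) choose d))"
    using mult_mono[OF _ Suc, of m "m + Suc d"] by simp
  also have "\<dots> = fact d * (Suc (m + d) * ((m + d) choose d))" by (simp add: distrib_left mult.left_commute)
  also have "\<dots> = fact (Suc d) * ((m + Suc d) choose Suc d)"
    unfolding Suc_times_binomial_eq by (simp add: distrib_left distrib_right mult.left_commute mult.commute)
  finally show ?case .
qed simp

text \<open>The cost of one lowering to a normalised share, bounded uniformly in \<open>k\<close>;
  it vanishes in the limit of \<open>Hall_bound\<close>.\<close>

lemma binomial_increment_le:
  assumes "k \<le> d"
  shows "(real ((Suc n + k) choose k) - real ((n + k) choose k)) / real ((Suc n + k) choose k) \<le> real d / real (Suc n)"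
proof -
  let ?C = "real ((Suc n + k) choose k)" and ?c = "real ((n + k) choose k)"
  have pos: "0 < ?C" by (simp add: zero_less_binomial_iff)
  have "(Suc n + k - k) * ((Suc n + k) choose k) = (Suc n + k) * ((Suc n + k - 1) choose k)"
    by (rule binomial_absorb_comp)
  then have "Suc n * ((Suc n + k) choose k) = (Suc n + k) * ((n + k) choose k)" by simp
  then have "real (Suc n) * ?C = real (Suc n + k) * ?c" by (metis of_nat_mult)
  then have "(?C - ?c) * real (Suc n) = real k * ?c" by (simp add: algebra_simps)
  also have "\<dots> \<le> real d * ?C"
    using assms by (intro mult_mono) (auto intro: binomial_right_mono)
  finally show ?thesis using pos by (simp add: divide_le_eq le_divide_eq)
qed

locale weighted_joint_family = joint_family E V c r k R Fl A
  for E :: "'e set" and V :: "'e \<Rightarrow> 'd::finite set" and c :: "'e \<Rightarrow> nat"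
    and r :: nat and k :: "nat \<Rightarrow> nat"
    and R :: "('a::field ^ 'd) set" and Fl :: "'a ^ 'd \<Rightarrow> 'e \<Rightarrow> ('a ^ 'd) set"
    and A :: "'a ^ 'd \<Rightarrow> 'a ^ 'd \<Rightarrow> 'a ^ 'd" +
  fixes w :: "'e \<Rightarrow> real"
  assumes w_nonneg: "\<And>e. e \<in> E \<Longrightarrow> 0 \<le> w e" and cover: "covers E V w"
begin

definition "W = (\<Sum>e\<in>E. w e)"
text \<open>AM-GM divides by \<open>w e\<close>, and a share 0 with exponent 0 would spoil the
  products because \<open>0 powr 0 = 0\<close>.\<close>

definition "E0 = {e \<in> E. 0 < w e}"
definition "cov j = (\<Sum>e\<in>{e \<in> E. j \<in> V e}. w e)"
text \<open>The edges that avoid \<open>j\<close> have total weight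
  \<open>W - cov j \<le> W - 1\<close>, so the scaled weights \<open>\<theta> w\<close> sum to at
  most 1 there, as Shearer requires.\<close>

definition "\<theta> = 1 / (W - 1)"
text \<open>Color \<open>i\<close> receives its proportion of \<open>W\<close>, divided equally
  among its flats.\<close>

definition "\<mu> i = subtotal E c w i / (real (card (flats i)) * W)"
text \<open>The weighted share of \<open>p\<close>. It sums to 1 over \<open>R\<close> for all
  handicaps, so \<open>1 / card R\<close> is its average.\<close>

definition "B n \<alpha> p = (\<Sum>i\<in>{1..r}. \<Sum>F\<in>flats i.
  \<mu> i * (real (share n i F \<alpha> p) / real ((Suc n + k i) choose k i)))"

lemma cov_ge: "1 \<le> cov j"
  using cover by (simp add: covers_def cov_def)

lemma finite_E0: "finite E0" using finite_E by (simp add: E0_def)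

lemma sum_E0: "(\<Sum>e\<in>E0. f e * w e) = (\<Sum>e\<in>E. f e * w e)"
  using w_nonneg by (intro sum.mono_neutral_left finite_E) (auto simp: E0_def less_le)

text \<open>Every edge misses some vertex \<open>j\<close>, so its weight is at most
  \<open>W - cov j \<le> W - 1\<close>. If \<open>W \<le> 1\<close>, all weights would be 0 and no
  vertex covered.\<close>

lemma W_gt_1: "1 < W"
proof (rule ccontr)
  assume "\<not> 1 < W"
  have "w e = 0" if e: "e \<in> E" for e
  proof -
    have "card (V e) = CARD('d) - k (c e)" "1 \<le> k (c e)"
      using colored color_range[OF e] e by (auto simp: uniformly_edge_colored_def)
    then have "V e \<noteq> UNIV" by (metis diff_less finite_UNIV_card_ge_0 finite less_irrefl less_le_trans zero_less_one)
    then obtain j where j: "j \<notin> V e" by auto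
    have "w e \<le> (\<Sum>e\<in>{e \<in> E. j \<notin> V e}. w e)"
      using e j finite_E w_nonneg by (intro member_le_sum) auto
    also have "\<dots> = W - cov j"
      unfolding W_def cov_def using finite_E
      by (subst sum.subset_diff[of "{e \<in> E. j \<in> V e}" E]) (auto intro: sum.cong)
    finally show ?thesis using cov_ge[of j] \<open>\<not> 1 < W\<close> w_nonneg[OF e] by linarith
  qed
  then have "cov j = 0" for j by (simp add: cov_def)
  then show False using cov_ge by (metis not_one_le_zero)
qed

lemma \<theta>_pos: "0 < \<theta>" using W_gt_1 by (simp add: \<theta>_def)

lemma subtotal_nonneg: "0 \<le> subtotal E c w i"
  unfolding subtotal_def using w_nonneg by (intro sum_nonneg) auto

lemma \<mu>_nonneg: "0 \<le> \<mu> i"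
  using subtotal_nonneg W_gt_1 by (simp add: \<mu>_def)

lemma card_flats_pos: "i \<in> {1..r} \<Longrightarrow> 0 < card (flats i)"
  using flats_ne finite_flats by (simp add: card_gt_0_iff)

lemma sum_subtotal: "(\<Sum>i\<in>{1..r}. subtotal E c w i) = W"
  unfolding subtotal_def W_def using color_range by (intro sum.group finite_E) auto

lemma sum_\<mu>: "(\<Sum>i\<in>{1..r}. \<Sum>F\<in>flats i. \<mu> i) = 1"
proof -
  have "(\<Sum>F\<in>flats i. \<mu> i) = subtotal E c w i / W" if "i \<in> {1..r}" for i
    using card_flats_pos[OF that] by (simp add: \<mu>_def)
  then show ?thesis using W_gt_1 sum_subtotal by (simp add: sum_divide_distrib[symmetric])
qed

lemma k_le: "i \<in> {1..r} \<Longrightarrow> k i \<le> CARD('d)"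
  using colored unfolding uniformly_edge_colored_def by (meson diff_le_self order_trans)

text \<open>A flat with \<open>points i F \<subseteq> D\<close> distributes its whole weight within
  \<open>D\<close>, whatever the handicaps. So the condition is necessary for
  \<open>B \<le> 1 / card R\<close> everywhere; \<open>exists_balanced\<close> shows that it
  suffices up to a small error.\<close>

definition "Hall \<longleftrightarrow> (\<forall>D\<subseteq>R. (\<Sum>i\<in>{1..r}. \<mu> i * real (card {F \<in> flats i. points i F \<subseteq> D})) \<le> real (card D) / real (card R))"

lemma exists_balanced:
  assumes Hall
  shows "\<exists>\<alpha>. \<forall>p\<in>R. B n \<alpha> p \<le> 1 / real (card R) + real CARD('d) / real (Suc n)"
proof (rule exists_balanced_handicap[OF finite_R, where n = "Suc n"])
  let ?C = "\<lambda>i. real ((Suc n + k i) choose k i)"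
  have C: "0 < ?C i" for i by (simp add: zero_less_binomial_iff)
  show "B n \<alpha> q \<le> B n (\<alpha>(p := \<alpha> p - 1)) q" if "p \<noteq> q" for \<alpha> p q
    unfolding B_def using share_mono[OF that]
    by (intro sum_mono mult_left_mono divide_right_mono \<mu>_nonneg) auto
  show "B n \<alpha> p - real CARD('d) / real (Suc n) \<le> B n (\<alpha>(p := \<alpha> p - 1)) p" for \<alpha> p
  proof -
    let ?\<epsilon> = "real CARD('d) / real (Suc n)"
    have "B n \<alpha> p \<le> (\<Sum>i\<in>{1..r}. \<Sum>F\<in>flats i.
      \<mu> i * (real (share n i F (\<alpha>(p := \<alpha> p - 1)) p) / ?C i) + \<mu> i * ?\<epsilon>)"
      unfolding B_def distrib_left[symmetric]
    proof (intro sum_mono mult_left_mono \<mu>_nonneg)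
      fix i F assume i: "i \<in> {1..r}" and F: "F \<in> flats i"
      have "real (share n i F \<alpha> p) \<le> real (share n i F (\<alpha>(p := \<alpha> p - 1)) p) + (?C i - real ((n + k i) choose k i))"
        using share_lip[OF F, of n \<alpha> p] by linarith
      then have "real (share n i F \<alpha> p) / ?C i \<le>
        real (share n i F (\<alpha>(p := \<alpha> p - 1)) p) / ?C i + (?C i - real ((n + k i) choose k i)) / ?C i"
        using C[of i] by (simp add: add_divide_distrib[symmetric] divide_right_mono)
      also have "\<dots> \<le> real (share n i F (\<alpha>(p := \<alpha> p - 1)) p) / ?C i + ?\<epsilon>"
        by (intro add_left_mono binomial_increment_le k_le i)
      finally show "real (share n i F \<alpha> p) / ?C i \<le> real (share n i F (\<alpha>(p := \<alpha> p - 1)) p) / ?C i + ?\<epsilon>" .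
    qed
    also have "\<dots> = B n (\<alpha>(p := \<alpha> p - 1)) p + (\<Sum>i\<in>{1..r}. \<Sum>F\<in>flats i. \<mu> i) * ?\<epsilon>"
      by (simp only: B_def sum.distrib sum_distrib_right)
    finally show ?thesis unfolding sum_\<mu> by simp
  qed
next
  fix \<alpha> :: "'a ^ 'd \<Rightarrow> int" and D
  assume D: "D \<subseteq> R" and gap: "\<And>p q. p \<in> D \<Longrightarrow> q \<in> R - D \<Longrightarrow> \<alpha> p + int (Suc n) < \<alpha> q"
  let ?C = "\<lambda>i. real ((Suc n + k i) choose k i)"
  have C: "0 < ?C i" for i by (simp add: zero_less_binomial_iff)
  \<comment> \<open>A flat with a joint outside \<open>D\<close> gives nothing to \<open>D\<close>,
    since that joint is too far ahead (\<open>share_gap\<close>). Any other flat gives at most its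
    weight, and Hall's condition limits the total weight of these.\<close>
  have fl: "(\<Sum>p\<in>D. \<mu> i * (real (share n i F \<alpha> p) / ?C i)) \<le> (if points i F \<subseteq> D then \<mu> i else 0)"
    if F: "F \<in> flats i" for i F
  proof (cases "points i F \<subseteq> D")
    case True
    have "(\<Sum>p\<in>D. share n i F \<alpha> p) \<le> (\<Sum>p\<in>R. share n i F \<alpha> p)"
      using D finite_R by (intro sum_mono2) auto
    also have "\<dots> = (Suc n + k i) choose k i" by (rule sum_share[OF F])
    finally have "real (\<Sum>p\<in>D. share n i F \<alpha> p) / ?C i \<le> 1"
      using C[of i] by (simp only: divide_le_eq_1 of_nat_le_iff) simp
    then have "\<mu> i * (real (\<Sum>p\<in>D. share n i F \<alpha> p) / ?C i) \<le> \<mu> i"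
      by (rule mult_left_le) (rule \<mu>_nonneg)
    then show ?thesis using True by (simp add: sum_distrib_left sum_divide_distrib)
  next
    case False
    then obtain q where q: "q \<in> points i F" "q \<in> R - D" using points_subset by blast
    have "share n i F \<alpha> p = 0" if "p \<in> D" for p
      using share_gap[OF _ q(1) gap[OF that q(2)]] by (auto simp: share_def)
    then show ?thesis using False by simp
  qed
  have "(\<Sum>p\<in>D. B n \<alpha> p) = (\<Sum>i\<in>{1..r}. \<Sum>F\<in>flats i. \<Sum>p\<in>D. \<mu> i * (real (share n i F \<alpha> p) / ?C i))"
    unfolding B_def by (subst sum.swap) (intro sum.cong refl, subst sum.swap, simp)
  also have "\<dots> \<le> (\<Sum>i\<in>{1..r}. \<Sum>F\<in>flats i. if points i F \<subseteq> D then \<mu> i else 0)"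
    by (intro sum_mono fl)
  also have "\<dots> = (\<Sum>i\<in>{1..r}. \<mu> i * real (card {F \<in> flats i. points i F \<subseteq> D}))"
    by (intro sum.cong refl) (simp add: sum.If_cases finite_flats Int_def mult.commute)
  also have "\<dots> \<le> real (card D) / real (card R)" using assms D by (simp add: Hall_def)
  finally show "(\<Sum>p\<in>D. B n \<alpha> p) \<le> 1 / real (card R) * real (card D)" by simp
qed simp

text \<open>AM-GM with weights \<open>w e / W\<close> on the summands of \<open>B\<close> that come
  from the chosen flats of \<open>p\<close>. If one of the shares is 0, so is the left side.\<close>

lemma prod_share_le:
  assumes p: "p \<in> R" and le: "B n \<alpha> p \<le> \<Lambda>" and "0 < \<Lambda>"
  shows "(\<Prod>e\<in>E0. (real (share n (c e) (Fl p e) \<alpha> p) / real ((Suc n + k (c e)) choose k (c e))) powr w e)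
    \<le> \<Lambda> powr W * (\<Prod>e\<in>E0. (w e * real (card (flats (c e))) / subtotal E c w (c e)) powr w e)"
proof -
  define x where "x e = real (share n (c e) (Fl p e) \<alpha> p) / real ((Suc n + k (c e)) choose k (c e))" for e
  have x_nonneg: "0 \<le> x e" for e by (simp add: x_def)
  have E0: "e \<in> E" "0 < w e" "0 < subtotal E c w (c e)" "0 < real (card (flats (c e)))" if "e \<in> E0" for e
  proof -
    show e: "e \<in> E" "0 < w e" using that by (auto simp: E0_def)
    have "w e \<le> subtotal E c w (c e)"
      unfolding subtotal_def using e finite_E w_nonneg by (intro member_le_sum) auto
    then show "0 < subtotal E c w (c e)" using e(2) by simp
    show "0 < real (card (flats (c e)))" using card_flats_pos color_range e(1) by simp
  qed
  have \<mu>: "0 < \<mu> (c e)" if "e \<in> E0" for e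
    using E0[OF that] W_gt_1 by (simp add: \<mu>_def)
  have "(\<Sum>e\<in>E0. \<mu> (c e) * x e) \<le> \<Lambda>"
  proof -
    let ?f = "\<lambda>(i, F). \<mu> i * (real (share n i F \<alpha> p) / real ((Suc n + k i) choose k i))"
    \<comment> \<open>The edges give distinct summands of \<open>B\<close>, and the other summands
      are nonnegative.\<close>
    have inj: "inj_on (\<lambda>e. (c e, Fl p e)) E0"
      using Fl_inj[OF p] by (auto simp: inj_on_def E0_def)
    have "(\<Sum>e\<in>E0. \<mu> (c e) * x e) = (\<Sum>y\<in>(\<lambda>e. (c e, Fl p e)) ` E0. ?f y)"
      by (subst sum.reindex[OF inj]) (simp add: x_def)
    also have "\<dots> \<le> (\<Sum>y\<in>Sigma {1..r} flats. ?f y)"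
    proof (rule sum_mono2)
      show "finite (Sigma {1..r} flats)" using finite_flats by auto
      show "(\<lambda>e. (c e, Fl p e)) ` E0 \<subseteq> Sigma {1..r} flats"
      proof
        fix y assume "y \<in> (\<lambda>e. (c e, Fl p e)) ` E0"
        then obtain e where "e \<in> E" "y = (c e, Fl p e)" using E0(1) by blast
        moreover have "Fl p e \<in> flats (c e)" using p \<open>e \<in> E\<close> by (auto simp: flats_def)
        ultimately show "y \<in> Sigma {1..r} flats" using color_range by blast
      qed
    qed (auto simp: \<mu>_nonneg)
    also have "\<dots> = B n \<alpha> p"
      unfolding B_def by (subst sum.Sigma) (auto simp: finite_flats)
    finally show ?thesis using le by simp
  qed
  note sum_le = this
  show ?thesis unfolding x_def[symmetric]
  proof (cases "\<exists>e\<in>E0. x e = 0")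
    case True
    then have "(\<Prod>e\<in>E0. x e powr w e) = 0" using finite_E0 by (auto simp: prod_zero_iff)
    moreover have "0 \<le> \<Lambda> powr W * (\<Prod>e\<in>E0. (w e * real (card (flats (c e))) / subtotal E c w (c e)) powr w e)"
      by (intro mult_nonneg_nonneg prod_nonneg) auto
    ultimately show "(\<Prod>e\<in>E0. x e powr w e) \<le> \<Lambda> powr W * (\<Prod>e\<in>E0. (w e * real (card (flats (c e))) / subtotal E c w (c e)) powr w e)"
      by simp
  next
    case False
    then have x: "0 < x e" if "e \<in> E0" for e using x_nonneg[of e] that by (auto simp: less_le)
    \<comment> \<open>Scaled so that the mean of \<open>y e\<close> with weights
      \<open>w e / W\<close> is the sum of \<open>\<mu> (c e) * x e\<close>; \<open>z e\<close> is
      the remaining factor of \<open>x e\<close>.\<close>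
    define y where "y e = \<mu> (c e) * x e * W / w e" for e
    define z where "z e = w e * real (card (flats (c e))) / subtotal E c w (c e)" for e
    have y: "0 < y e" if "e \<in> E0" for e
      using x[OF that] \<mu>[OF that] E0(2)[OF that] W_gt_1 by (simp add: y_def)
    have z: "0 < z e" if "e \<in> E0" for e
      using E0(2-4)[OF that] by (simp add: z_def)
    have xyz: "x e = y e * z e" if "e \<in> E0" for e
      using E0(2-4)[OF that] W_gt_1 by (simp add: y_def z_def \<mu>_def)
    have W: "(\<Sum>e\<in>E0. w e) = W" using sum_E0[of "\<lambda>_. 1"] by (simp add: W_def)
    have "(\<Prod>e\<in>E0. y e powr (w e / W)) \<le> (\<Sum>e\<in>E0. w e / W * y e)"
      using y E0(2) W_gt_1 W by (intro weighted_AM_GM finite_E0) (auto simp: sum_divide_distrib[symmetric] less_imp_le)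
    also have "\<dots> = (\<Sum>e\<in>E0. \<mu> (c e) * x e)"
    proof (intro sum.cong refl)
      fix e assume "e \<in> E0"
      then show "w e / W * y e = \<mu> (c e) * x e"
        using E0(2)[of e] W_gt_1 by (simp add: y_def)
    qed
    also have "\<dots> \<le> \<Lambda>" by (rule sum_le)
    finally have "(\<Prod>e\<in>E0. y e powr (w e / W)) powr W \<le> \<Lambda> powr W"
      using W_gt_1 by (intro powr_mono2) (auto intro: prod_nonneg)
    then have le: "(\<Prod>e\<in>E0. y e powr w e) \<le> \<Lambda> powr W"
      using W_gt_1 by (simp add: prod_powr_distrib powr_powr)
    have "(\<Prod>e\<in>E0. x e powr w e) = (\<Prod>e\<in>E0. y e powr w e) * (\<Prod>e\<in>E0. z e powr w e)"
      unfolding prod.distrib[symmetric]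
      using y z by (intro prod.cong refl) (simp add: xyz powr_mult less_imp_le)
    also have "\<dots> \<le> \<Lambda> powr W * (\<Prod>e\<in>E0. z e powr w e)"
      using le by (intro mult_right_mono prod_nonneg) auto
    finally show "(\<Prod>e\<in>E0. x e powr w e) \<le> \<Lambda> powr W * (\<Prod>e\<in>E0. (w e * real (card (flats (c e))) / subtotal E c w (c e)) powr w e)"
      by (simp add: z_def)
  qed
qed

lemma sum_complement: "(\<Sum>e\<in>{e \<in> E0. j \<notin> V e}. w e) = W - cov j"
proof -
  have "(\<Sum>e\<in>{e \<in> E0. j \<notin> V e}. w e) = (\<Sum>e\<in>{e \<in> E. j \<notin> V e}. w e)"
    using w_nonneg finite_E by (intro sum.mono_neutral_left) (auto simp: E0_def less_le)
  also have "\<dots> = W - cov j"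
    unfolding W_def cov_def using finite_E
    by (subst sum.subset_diff[of "{e \<in> E. j \<in> V e}" E]) (auto intro: sum.cong)
  finally show ?thesis .
qed

text \<open>
  The weights \<open>\<theta> w\<close> need not cover every coordinate; the deficit \<open>\<theta> (cov j - 1)\<close> at \<open>j\<close>
  is made up by the projection to the \<open>j\<close>-axis, which has at most \<open>n + 2\<close> points.
\<close>

lemma card_leads_le:
  assumes p: "p \<in> R"
  shows "real (card (fr.leads (Suc (Suc n)) R (\<lambda>_. UNIV) (Suc n) \<alpha> p)) \<le>
    (\<Prod>e\<in>E0. real (share n (c e) (Fl p e) \<alpha> p) powr (w e * \<theta>)) *
    real (Suc (Suc n)) powr (\<Sum>j\<in>UNIV. (cov j - 1) * \<theta>)"
proof -
  let ?T = "fr.leads (Suc (Suc n)) R (\<lambda>_. UNIV) (Suc n) \<alpha> p"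
  define I :: "('e + 'd) set" where "I = E0 <+> UNIV"
  define u :: "'e + 'd \<Rightarrow> real" where "u = case_sum (\<lambda>e. w e * \<theta>) (\<lambda>j. (cov j - 1) * \<theta>)"
  define S :: "'e + 'd \<Rightarrow> 'd set" where "S = case_sum (\<lambda>e. - V e) (\<lambda>j. {j})"
  have finI: "finite I" using finite_E0 by (simp add: I_def)
  have u_nonneg: "0 \<le> u i" if "i \<in> I" for i
    using that \<theta>_pos cov_ge by (auto simp: u_def I_def E0_def)
  have "real (card ?T) \<le> (\<Prod>i\<in>I. real (card (project (S i) ` ?T)) powr u i)"
  proof (rule card_le_prod_projections[where D = UNIV])
    fix j :: 'd
    have "{i \<in> I. j \<in> S i} = {e \<in> E0. j \<notin> V e} <+> {j}" by (auto simp: I_def S_def)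
    then have "(\<Sum>i | i \<in> I \<and> j \<in> S i. u i) = (\<Sum>e\<in>{e \<in> E0. j \<notin> V e}. w e * \<theta>) + (cov j - 1) * \<theta>"
      using finite_E0 by (simp add: sum.Plus u_def)
    also have "\<dots> = (W - 1) * \<theta>"
      by (simp add: sum_distrib_right[symmetric] sum_complement algebra_simps)
    also have "\<dots> = 1" using W_gt_1 by (simp add: \<theta>_def)
    finally show "(\<Sum>i | i \<in> I \<and> j \<in> S i. u i) = 1" .
  qed (use finI u_nonneg fr.finite_leads in \<open>auto simp: supported_def\<close>)
  also have "\<dots> = (\<Prod>e\<in>E0. real (card (project (- V e) ` ?T)) powr (w e * \<theta>)) *
    (\<Prod>j\<in>UNIV. real (card (project {j} ` ?T)) powr ((cov j - 1) * \<theta>))"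
    unfolding I_def using finite_E0 by (simp add: prod.Plus u_def S_def)
  also have "\<dots> \<le> (\<Prod>e\<in>E0. real (share n (c e) (Fl p e) \<alpha> p) powr (w e * \<theta>)) *
    (\<Prod>j\<in>UNIV. real (Suc (Suc n)) powr ((cov j - 1) * \<theta>))"
  proof (intro mult_mono prod_mono conjI powr_mono2)
    fix e assume "e \<in> E0"
    then show "real (card (project (- V e) ` ?T)) \<le> real (share n (c e) (Fl p e) \<alpha> p)"
      using card_leads_slice[OF p] by (simp add: E0_def)
    show "0 \<le> w e * \<theta>" using \<open>e \<in> E0\<close> \<theta>_pos by (simp add: E0_def)
  next
    fix j :: 'd
    have "project {j} ` ?T \<subseteq> (\<lambda>v i. if i = j then v else 0) ` {..Suc n}"
    proof
      fix \<beta> assume "\<beta> \<in> project {j} ` ?T"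
      then obtain \<gamma> where \<gamma>: "\<gamma> \<in> ?T" "\<beta> = project {j} \<gamma>" by (rule imageE) blast
      have "\<gamma> j \<le> Suc n" using \<gamma>(1) deg_ge[of \<gamma> j] by (simp add: fr.leads_def)
      moreover have "\<beta> = (\<lambda>i. if i = j then \<gamma> j else 0)" by (rule ext) (simp add: \<gamma>(2) project_def)
      ultimately show "\<beta> \<in> (\<lambda>v i. if i = j then v else 0) ` {..Suc n}" by blast
    qed
    then have "card (project {j} ` ?T) \<le> card {..Suc n}" by (rule surj_card_le[rotated]) simp
    then show "real (card (project {j} ` ?T)) \<le> real (Suc (Suc n))" by simp
    show "0 \<le> (cov j - 1) * \<theta>" using cov_ge \<theta>_pos by simp
  qed (auto intro: prod_nonneg)
  also have "(\<Prod>j\<in>UNIV. real (Suc (Suc n)) powr ((cov j - 1) * \<theta>)) =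
    real (Suc (Suc n)) powr (\<Sum>j\<in>UNIV. (cov j - 1) * \<theta>)"
    by (subst powr_sum) auto
  finally show ?thesis .
qed

text \<open>Counts the pairs of an edge and a coordinate outside it. As the exponents add up to the
  dimension, both sides of \<open>degree_bound\<close> have the same order in
  \<open>m\<close>.\<close>

lemma sum_exponents:
  "(\<Sum>e\<in>E0. real (k (c e)) * (w e * \<theta>)) + (\<Sum>j\<in>UNIV. (cov j - 1) * \<theta>) = real CARD('d)"
proof -
  have "(\<Sum>j\<in>UNIV. W - cov j) = (\<Sum>j\<in>UNIV. \<Sum>e\<in>E0. if j \<notin> V e then w e else 0)"
    unfolding sum_complement[symmetric] using finite_E0 by (simp add: sum.inter_filter)
  also have "\<dots> = (\<Sum>e\<in>E0. \<Sum>j\<in>UNIV. if j \<notin> V e then w e else 0)" by (rule sum.swap)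
  also have "\<dots> = (\<Sum>e\<in>E0. real (k (c e)) * w e)"
  proof (rule sum.cong[OF refl])
    fix e assume "e \<in> E0"
    then have "e \<in> E" by (simp add: E0_def)
    then have "card (- V e) = k (c e)"
      using R_ne card_axes axes_eq by (metis ex_in_conv)
    moreover have "{j. j \<notin> V e} = - V e" by auto
    ultimately show "(\<Sum>j\<in>UNIV. if j \<notin> V e then w e else 0) = real (k (c e)) * w e"
      by (simp add: sum.If_cases)
  qed
  finally have "(\<Sum>e\<in>E0. real (k (c e)) * w e) + (\<Sum>j\<in>UNIV. cov j - 1) = (W - 1) * real CARD('d)"
    by (simp add: sum_subtractf algebra_simps)
  then have "((\<Sum>e\<in>E0. real (k (c e)) * w e) + (\<Sum>j\<in>UNIV. cov j - 1)) * \<theta> = real CARD('d)"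
    using W_gt_1 by (simp add: \<theta>_def)
  then show ?thesis by (simp add: sum_distrib_right distrib_right mult.assoc)
qed

end

section \<open>The joints bound\<close>

context weighted_joint_family
begin

text \<open>\<open>G\<close> and \<open>K\<close> collect edge by edge the factorials and the
  factors left over from AM-GM; \<open>constant_eq\<close> regroups them by color.\<close>

definition "G = (\<Prod>e\<in>E0. (1 / fact (k (c e))) powr w e)"
definition "K = (\<Prod>e\<in>E0. (w e * real (card (flats (c e))) / subtotal E c w (c e)) powr w e)"

lemma G_nonneg: "0 \<le> G" and K_nonneg: "0 \<le> K"
  by (auto simp: G_def K_def intro!: prod_nonneg)

lemma card_R_pos: "0 < card R"
  using finite_R R_ne by (simp add: card_gt_0_iff)

text \<open>The left side is below the number of leading coefficients in the whole space; the right
  side bounds their number at each joint. Only the leading order in \<open>m\<close> will matter, so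
  lower order terms are absorbed into \<open>m + d\<close>.\<close>

lemma degree_bound:
  fixes n :: nat
  assumes Hall
  defines "m \<equiv> real (Suc n)" and "d \<equiv> real CARD('d)"
  shows "m ^ CARD('d) / fact CARD('d) \<le> real (card R) *
    ((G * K) powr \<theta> * (1 / real (card R) + d / m) powr (W * \<theta>) * (m + d) ^ CARD('d))"
proof -
  let ?\<Lambda> = "1 / real (card R) + d / m"
  let ?C = "\<lambda>i. real ((Suc n + k i) choose k i)"
  let ?\<Delta> = "\<Sum>j\<in>UNIV. (cov j - 1) * \<theta>"
  have md: "0 < m" "1 \<le> d" by (auto simp: m_def d_def)
  have \<Lambda>: "0 < ?\<Lambda>" using card_R_pos md by (intro add_pos_nonneg) auto
  obtain \<alpha> where \<alpha>: "\<And>p. p \<in> R \<Longrightarrow> B n \<alpha> p \<le> ?\<Lambda>"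
    using exists_balanced[OF assms(1), of n] by (auto simp: m_def d_def)
  have C: "?C (k' :: nat) \<le> (m + d) ^ k k' / fact (k k')" if "k' \<in> {1..r}" for k'
  proof -
    have "real ((Suc n + k k') choose k k') * fact (k k') \<le> real (Suc n + k k') ^ k k'"
      using binomial_fact_pow[of "Suc n + k k'" "k k'"] by (metis of_nat_fact of_nat_le_iff of_nat_mult of_nat_power)
    also have "\<dots> \<le> (m + d) ^ k k'"
      using k_le[OF that] by (intro power_mono) (auto simp: m_def d_def)
    finally show ?thesis by (simp add: le_divide_eq)
  qed
  have point: "real (card (fr.leads (Suc (Suc n)) R (\<lambda>_. UNIV) (Suc n) \<alpha> p)) \<le>
    (G * K) powr \<theta> * ?\<Lambda> powr (W * \<theta>) * (m + d) ^ CARD('d)" if p: "p \<in> R" for p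
  proof -
    define x where "x e = real (share n (c e) (Fl p e) \<alpha> p) / ?C (c e)" for e
    have x_nonneg: "0 \<le> x e" for e by (simp add: x_def)
    have C0: "?C i \<noteq> 0" for i by simp
    have "(\<Prod>e\<in>E0. real (share n (c e) (Fl p e) \<alpha> p) powr (w e * \<theta>)) =
      (\<Prod>e\<in>E0. x e powr (w e * \<theta>)) * (\<Prod>e\<in>E0. ?C (c e) powr (w e * \<theta>))"
      unfolding prod.distrib[symmetric]
    proof (rule prod.cong[OF refl])
      fix e
      have "real (share n (c e) (Fl p e) \<alpha> p) = x e * ?C (c e)" using C0[of "c e"] by (simp add: x_def)
      then show "real (share n (c e) (Fl p e) \<alpha> p) powr (w e * \<theta>) = x e powr (w e * \<theta>) * ?C (c e) powr (w e * \<theta>)"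
        using x_nonneg by (simp only: powr_mult of_nat_0_le_iff)
    qed
    also have "\<dots> \<le> (?\<Lambda> powr W * K) powr \<theta> * ((m + d) powr (\<Sum>e\<in>E0. real (k (c e)) * (w e * \<theta>)) * G powr \<theta>)"
    proof (rule mult_mono)
      have "(\<Prod>e\<in>E0. x e powr (w e * \<theta>)) = (\<Prod>e\<in>E0. x e powr w e) powr \<theta>"
        by (simp add: prod_powr_distrib powr_powr)
      also have "\<dots> \<le> (?\<Lambda> powr W * K) powr \<theta>"
        using prod_share_le[OF p \<alpha>[OF p] \<Lambda>] \<theta>_pos
        by (intro powr_mono2) (auto simp: x_def K_def intro!: prod_nonneg)
      finally show "(\<Prod>e\<in>E0. x e powr (w e * \<theta>)) \<le> (?\<Lambda> powr W * K) powr \<theta>" .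
      have "(\<Prod>e\<in>E0. ?C (c e) powr (w e * \<theta>)) \<le>
        (\<Prod>e\<in>E0. (m + d) powr (real (k (c e)) * (w e * \<theta>)) * ((1 / fact (k (c e))) powr w e) powr \<theta>)"
      proof (intro prod_mono conjI)
        fix e assume e: "e \<in> E0"
        have "?C (c e) powr (w e * \<theta>) \<le> ((m + d) ^ k (c e) / fact (k (c e))) powr (w e * \<theta>)"
          using e \<theta>_pos color_range by (intro powr_mono2 C) (auto simp: E0_def)
        also have "\<dots> = ((m + d) ^ k (c e)) powr (w e * \<theta>) * (1 / fact (k (c e))) powr (w e * \<theta>)"
          using md by (subst powr_mult[symmetric]) auto
        also have "((m + d) ^ k (c e)) powr (w e * \<theta>) = (m + d) powr (real (k (c e)) * (w e * \<theta>))"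
          using md by (simp add: powr_realpow[symmetric] powr_powr)
        finally show "?C (c e) powr (w e * \<theta>) \<le>
          (m + d) powr (real (k (c e)) * (w e * \<theta>)) * ((1 / fact (k (c e))) powr w e) powr \<theta>"
          by (simp add: powr_powr)
      qed simp
      also have "\<dots> = (m + d) powr (\<Sum>e\<in>E0. real (k (c e)) * (w e * \<theta>)) * G powr \<theta>"
        using md by (simp add: prod.distrib powr_sum G_def prod_powr_distrib finite_E0)
      finally show "(\<Prod>e\<in>E0. ?C (c e) powr (w e * \<theta>)) \<le> \<dots>" .
    qed (auto intro: prod_nonneg)
    finally have 1: "(\<Prod>e\<in>E0. real (share n (c e) (Fl p e) \<alpha> p) powr (w e * \<theta>)) \<le> \<dots>" .
    \<comment> \<open>\<open>n + 2 = m + 1 \<le> m + d\<close>, as there is at least one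
      coordinate.\<close>
    have 2: "real (Suc (Suc n)) powr ?\<Delta> \<le> (m + d) powr ?\<Delta>"
      using md cov_ge \<theta>_pos by (intro powr_mono2 sum_nonneg) (auto simp: m_def)
    have "real (card (fr.leads (Suc (Suc n)) R (\<lambda>_. UNIV) (Suc n) \<alpha> p)) \<le>
      (?\<Lambda> powr W * K) powr \<theta> * ((m + d) powr (\<Sum>e\<in>E0. real (k (c e)) * (w e * \<theta>)) * G powr \<theta>) * (m + d) powr ?\<Delta>"
      by (rule order_trans[OF card_leads_le[OF p]]) (intro mult_mono 1 2, auto)
    also have "\<dots> = (?\<Lambda> powr W * K) powr \<theta> * G powr \<theta> * ((m + d) powr (\<Sum>e\<in>E0. real (k (c e)) * (w e * \<theta>)) * (m + d) powr ?\<Delta>)"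
      by (simp add: mult_ac)
    also have "(m + d) powr (\<Sum>e\<in>E0. real (k (c e)) * (w e * \<theta>)) * (m + d) powr ?\<Delta> = (m + d) ^ CARD('d)"
      unfolding powr_add[symmetric] sum_exponents using md by (simp add: powr_realpow)
    also have "(?\<Lambda> powr W * K) powr \<theta> * G powr \<theta> = (G * K) powr \<theta> * ?\<Lambda> powr (W * \<theta>)"
      using G_nonneg K_nonneg by (simp add: powr_mult powr_powr mult_ac)
    finally show ?thesis .
  qed
  have "(Suc n) ^ CARD('d) \<le> fact CARD('d) * ((Suc n + CARD('d)) choose CARD('d))"
    by (rule power_le_fact_mult_binomial)
  then have "m ^ CARD('d) \<le> fact CARD('d) * real ((Suc n + CARD('d)) choose CARD('d))"
    unfolding m_def by (metis of_nat_fact of_nat_le_iff of_nat_mult of_nat_power)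
  then have "m ^ CARD('d) / fact CARD('d) \<le> real ((Suc n + CARD('d)) choose CARD('d))"
    by (simp add: divide_le_eq mult.commute)
  also have "\<dots> = (\<Sum>p\<in>R. real (card (fr.leads (Suc (Suc n)) R (\<lambda>_. UNIV) (Suc n) \<alpha> p)))"
    using sum_card_leads_R[of "Suc n" "Suc (Suc n)" \<alpha>] by (metis lessI of_nat_sum)
  also have "\<dots> \<le> (\<Sum>p\<in>R. (G * K) powr \<theta> * ?\<Lambda> powr (W * \<theta>) * (m + d) ^ CARD('d))"
    by (intro sum_mono point)
  finally show ?thesis by simp
qed

text \<open>Divide \<open>degree_bound\<close> by \<open>m ^ CARD('d)\<close> and let
  \<open>n\<close> grow. Since \<open>W * \<theta> = 1 + \<theta>\<close>, what remains of
  \<open>card R\<close> is the exponent \<open>\<theta>\<close>, which the power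
  \<open>W - 1\<close> removes.\<close>

lemma Hall_bound:
  assumes Hall
  shows "real (card R) \<le> fact CARD('d) powr (W - 1) * (G * K)"
proof -
  let ?d = "real CARD('d)" and ?R = "real (card R)"
  have R: "0 < ?R" using card_R_pos by simp
  define f where "f n = ?R * ((G * K) powr \<theta> * (1 / ?R + ?d / real (Suc n)) powr (W * \<theta>) *
    (1 + ?d / real (Suc n)) ^ CARD('d))" for n
  have d0: "(\<lambda>n. ?d / real (Suc n)) \<longlonglongrightarrow> 0"
    by (rule LIMSEQ_Suc) (rule lim_const_over_n)
  have "f \<longlonglongrightarrow> ?R * ((G * K) powr \<theta> * (1 / ?R + 0) powr (W * \<theta>) * (1 + 0) ^ CARD('d))"
    unfolding f_def using R by (intro tendsto_intros d0) auto
  moreover have "1 / fact CARD('d) \<le> f n" for n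
  proof -
    let ?m = "real (Suc n)"
    have "(1 + ?d / ?m) ^ CARD('d) = (?m + ?d) ^ CARD('d) / ?m ^ CARD('d)"
      by (simp add: power_divide[symmetric] add_divide_distrib)
    then have "f n = ?R * ((G * K) powr \<theta> * (1 / ?R + ?d / ?m) powr (W * \<theta>) * (?m + ?d) ^ CARD('d)) / ?m ^ CARD('d)"
      by (simp add: f_def)
    moreover have "?m ^ CARD('d) / fact CARD('d) / ?m ^ CARD('d) \<le> \<dots>"
      by (rule divide_right_mono[OF degree_bound[OF assms]]) simp
    ultimately show ?thesis by simp
  qed
  ultimately have "1 / fact CARD('d) \<le> ?R * ((G * K) powr \<theta> * (1 / ?R + 0) powr (W * \<theta>) * (1 + 0) ^ CARD('d))"
    by (intro LIMSEQ_le_const) auto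
  also have "\<dots> = (G * K) powr \<theta> * (?R * ?R powr (- (W * \<theta>)))"
    using R by (simp add: powr_minus_divide powr_divide)
  also have "?R * ?R powr (- (W * \<theta>)) = ?R powr (- \<theta>)"
  proof -
    have "W * \<theta> = 1 + \<theta>" using W_gt_1 by (simp add: \<theta>_def field_simps)
    moreover have "?R * ?R powr (- (1 + \<theta>)) = ?R powr 1 * ?R powr (- (1 + \<theta>))" using R by simp
    ultimately show ?thesis by (simp only: powr_add[symmetric]) simp
  qed
  finally have "?R powr \<theta> \<le> fact CARD('d) * (G * K) powr \<theta>"
    using R by (simp add: powr_minus_divide divide_le_eq le_divide_eq mult.commute)
  then have "(?R powr \<theta>) powr (W - 1) \<le> (fact CARD('d) * (G * K) powr \<theta>) powr (W - 1)"
    using W_gt_1 by (intro powr_mono2) auto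
  moreover have "\<theta> * (W - 1) = 1" using W_gt_1 by (simp add: \<theta>_def)
  ultimately show ?thesis
    using R G_nonneg K_nonneg by (simp add: powr_mult powr_powr)
qed

lemma constant_eq:
  "fact CARD('d) powr (W - 1) * (G * K) =
    joints_constant E V c r k w * (\<Prod>i=1..r. real (card (flats i)) powr subtotal E c w i)"
proof -
  let ?s = "subtotal E c w" and ?Ei = "\<lambda>i. {e \<in> E. c e = i}"
  let ?q = "\<lambda>e. rpow (w e / ?s (c e)) (w e)"
  have card0: "0 < card (flats (c e))" if "e \<in> E" for e
    using card_flats_pos color_range[OF that] by blast
  have G: "G = (\<Prod>e\<in>E. (1 / fact (k (c e))) powr w e)"
    unfolding G_def using w_nonneg
    by (intro prod.mono_neutral_left finite_E) (auto simp: E0_def less_le)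
  have K: "K = (\<Prod>e\<in>E. ?q e * real (card (flats (c e))) powr w e)"
  proof -
    have "K = (\<Prod>e\<in>E0. ?q e * real (card (flats (c e))) powr w e)"
      unfolding K_def
    proof (rule prod.cong[OF refl])
      fix e assume "e \<in> E0"
      then have w: "0 < w e" by (simp add: E0_def)
      have "0 \<le> w e / ?s (c e)" using w subtotal_nonneg by (intro divide_nonneg_nonneg) auto
      then show "(w e * real (card (flats (c e))) / ?s (c e)) powr w e = ?q e * real (card (flats (c e))) powr w e"
        using w by (simp add: rpow_def powr_mult[symmetric])
    qed
    also have "\<dots> = (\<Prod>e\<in>E. ?q e * real (card (flats (c e))) powr w e)"
    proof (intro prod.mono_neutral_left finite_E ballI)
      fix e assume e: "e \<in> E - E0"
      then have "w e = 0" using w_nonneg[of e] by (simp add: E0_def)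
      \<comment> \<open>The base is positive by \<open>card0\<close>, so its power with exponent 0
        is 1.\<close>
      then show "?q e * real (card (flats (c e))) powr w e = 1"
        using card0[of e] e by (simp add: rpow_def)
    qed (auto simp: E0_def)
    finally show ?thesis .
  qed
  have group: "(\<Prod>e\<in>E. h e) = (\<Prod>i=1..r. \<Prod>e\<in>?Ei i. h e)" for h :: "'e \<Rightarrow> real"
    using color_range by (intro prod.group[symmetric] finite_E) auto
  have pow: "(\<Prod>e\<in>?Ei i. b (c e) powr w e) = b i powr ?s i" if "0 < b i" for b i
  proof -
    have "(\<Prod>e\<in>?Ei i. b (c e) powr w e) = (\<Prod>e\<in>?Ei i. b i powr w e)" by (rule prod.cong) auto
    also have "\<dots> = b i powr ?s i"
      unfolding subtotal_def using that finite_E by (subst powr_sum) auto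
    finally show ?thesis .
  qed
  have "G * K = (\<Prod>i=1..r. (\<Prod>e\<in>?Ei i. (1 / fact (k (c e))) powr w e) *
    ((\<Prod>e\<in>?Ei i. ?q e) * (\<Prod>e\<in>?Ei i. real (card (flats (c e))) powr w e)))"
    unfolding G K group prod.distrib ..
  also have "\<dots> = (\<Prod>i=1..r. (1 / fact (k i)) powr ?s i *
    ((\<Prod>e\<in>?Ei i. rpow (w e / ?s i) (w e)) * real (card (flats i)) powr ?s i))"
  proof (intro prod.cong refl)
    fix i assume i: "i \<in> {1..r}"
    have "(\<Prod>e\<in>?Ei i. ?q e) = (\<Prod>e\<in>?Ei i. rpow (w e / ?s i) (w e))" by (rule prod.cong) auto
    then show "(\<Prod>e\<in>?Ei i. (1 / fact (k (c e))) powr w e) *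
      ((\<Prod>e\<in>?Ei i. ?q e) * (\<Prod>e\<in>?Ei i. real (card (flats (c e))) powr w e)) =
      (1 / fact (k i)) powr ?s i * ((\<Prod>e\<in>?Ei i. rpow (w e / ?s i) (w e)) * real (card (flats i)) powr ?s i)"
      using pow[of "\<lambda>i. 1 / fact (k i)" i] pow[of "\<lambda>i. real (card (flats i))" i] card_flats_pos[OF i]
      by simp
  qed
  finally show ?thesis
    by (simp add: joints_constant_def prod.distrib W_def mult_ac)
qed

end

lemma joints_constant_nonneg: "0 \<le> joints_constant E V c r k w"
  unfolding joints_constant_def by (intro mult_nonneg_nonneg prod_nonneg) (auto simp: rpow_def intro!: prod_nonneg)

text \<open>
  If Hall's condition fails for \<open>D\<close>, the joints outside \<open>D\<close> form a family for which the
  inequality is at least as strong, and induction applies.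
\<close>

lemma card_joint_family_le:
  assumes "weighted_joint_family E V c r k R Fl A w"
  shows "real (card R) \<le> joints_constant E V c r k w *
    (\<Prod>i=1..r. real (card (joint_family.flats E c R Fl i)) powr subtotal E c w i)"
  using assms
proof (induction "card R" arbitrary: R rule: less_induct)
  case less
  interpret weighted_joint_family E V c r k R Fl A w by (rule less.prems)
  show ?case
  proof (cases Hall)
    case True
    then show ?thesis using Hall_bound constant_eq by simp
  next
    case False
    let ?s = "subtotal E c w"
    let ?in = "\<lambda>D i. {F \<in> flats i. points i F \<subseteq> D}"
    obtain D where D: "D \<subseteq> R" and gt: "real (card D) / real (card R) < (\<Sum>i\<in>{1..r}. \<mu> i * real (card (?in D i)))"
      using False by (auto simp: Hall_def not_le)
    have total: "(\<Sum>i\<in>{1..r}. \<mu> i * real (card (flats i))) = 1"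
      using sum_\<mu> by (simp add: mult.commute)
    \<comment> \<open>A violating set is nonempty, because each flat has a joint that chose it, and
      proper, because \<open>R\<close> attains equality. So the rest is a smaller nonempty
      family.\<close>
    have "D \<noteq> {}"
    proof
      assume "D = {}"
      then have z: "?in D i = {}" for i using points_ne by auto
      show False using gt unfolding z using \<open>D = {}\<close> by simp
    qed
    have "D \<noteq> R"
    proof
      assume "D = R"
      then have z: "?in D i = flats i" for i using points_subset by auto
      have "real (card D) / real (card R) < 1" using gt unfolding z total .
      then show False using \<open>D = R\<close> card_R_pos by simp
    qed
    define R' where "R' = R - D"
    have R': "R' \<subseteq> R" "R' \<noteq> {}" using D \<open>D \<noteq> R\<close> by (auto simp: R'_def)
    have finD: "finite D" using D finite_R finite_subset by blast
    have card_R': "card R' + card D = card R"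
      unfolding R'_def using D finite_R finD by (simp add: card_Diff_subset card_mono)
    have smaller: "card R' < card R" 
    proof -
      have "0 < card D" using \<open>D \<noteq> {}\<close> finD by (simp add: card_gt_0_iff)
      then show ?thesis using card_R' by linarith
    qed
    have fam: "weighted_joint_family E V c r k R' Fl A w"
      using colored finite_R R' frame w_nonneg cover
      by unfold_locales (auto intro: finite_subset)
    interpret R': weighted_joint_family E V c r k R' Fl A w by (rule fam)
    \<comment> \<open>A flat with \<open>points i F \<subseteq> D\<close> is not chosen by any joint
      of \<open>R'\<close>.\<close>
    have flats': "card (R'.flats i) + card (?in D i) \<le> card (flats i)" for i
    proof -
      have sub: "R'.flats i \<union> ?in D i \<subseteq> flats i" and disj: "R'.flats i \<inter> ?in D i = {}"
        unfolding R'.flats_def flats_def points_def by (auto simp: R'_def)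
      have "finite (?in D i)" using finite_flats by simp
      then have "card (R'.flats i) + card (?in D i) = card (R'.flats i \<union> ?in D i)"
        using R'.finite_flats disj by (intro card_Un_disjoint[symmetric])
      also have "\<dots> \<le> card (flats i)" by (rule card_mono[OF finite_flats sub])
      finally show ?thesis .
    qed
    have "(\<Sum>i\<in>{1..r}. \<mu> i * real (card (R'.flats i))) \<le> (\<Sum>i\<in>{1..r}. \<mu> i * real (card (flats i)) - \<mu> i * real (card (?in D i)))"
    proof (rule sum_mono)
      fix i
      have "real (card (R'.flats i)) \<le> real (card (flats i)) - real (card (?in D i))" using flats'[of i] by linarith
      from mult_left_mono[OF this \<mu>_nonneg[of i]]
      show "\<mu> i * real (card (R'.flats i)) \<le> \<mu> i * real (card (flats i)) - \<mu> i * real (card (?in D i))"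
        by (simp only: right_diff_distrib)
    qed
    also have "\<dots> \<le> 1 - real (card D) / real (card R)"
      unfolding sum_subtractf total using gt by simp
    also have "\<dots> = real (card R') / real (card R)"
    proof -
      have "real (card R') = real (card R) - real (card D)" using card_R' by linarith
      then show ?thesis using card_R_pos by (simp add: diff_divide_distrib)
    qed
    finally have ratio: "(\<Sum>i\<in>{1..r}. \<mu> i * real (card (R'.flats i))) \<le> real (card R') / real (card R)" .
    \<comment> \<open>The mean of the ratios \<open>x i\<close> with weights \<open>?s i / W\<close>
      is at most \<open>card R' / card R\<close>; by AM-GM so is their geometric mean. As this bound
      is below 1 and \<open>W > 1\<close>, the product of flat counts shrinks at least as much as
      the number of joints.\<close>
    define x where "x i = real (card (R'.flats i)) / real (card (flats i))" for i
    have x: "0 < x i" "real (card (R'.flats i)) = x i * real (card (flats i))" if "i \<in> {1..r}" for i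
      using card_flats_pos[OF that] R'.card_flats_pos[OF that] by (auto simp: x_def)
    have W0: "0 < W" using W_gt_1 by simp
    have "(\<Prod>i=1..r. x i powr (?s i / W)) \<le> (\<Sum>i=1..r. ?s i / W * x i)"
      using x subtotal_nonneg sum_subtotal W0
      by (intro weighted_AM_GM) (auto simp: sum_divide_distrib[symmetric])
    also have "\<dots> = (\<Sum>i=1..r. \<mu> i * real (card (R'.flats i)))"
      by (intro sum.cong refl) (simp add: \<mu>_def x_def mult.commute)
    also have "\<dots> \<le> real (card R') / real (card R)" by (rule ratio)
    finally have "(\<Prod>i=1..r. x i powr (?s i / W)) powr W \<le> (real (card R') / real (card R)) powr W"
      using W0 by (intro powr_mono2) (auto intro: prod_nonneg)
    then have "(\<Prod>i=1..r. x i powr ?s i) \<le> (real (card R') / real (card R)) powr W"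
      using W0 by (simp add: prod_powr_distrib powr_powr)
    also have "\<dots> \<le> (real (card R') / real (card R)) powr 1"
      using smaller W_gt_1 by (intro powr_mono') auto
    finally have px: "(\<Prod>i=1..r. x i powr ?s i) \<le> real (card R') / real (card R)" by simp
    let ?K = "joints_constant E V c r k w" and ?P = "\<Prod>i=1..r. real (card (flats i)) powr ?s i"
    have "real (card R') \<le> ?K * (\<Prod>i=1..r. real (card (R'.flats i)) powr ?s i)"
      by (rule less.hyps[OF smaller fam])
    also have "(\<Prod>i=1..r. real (card (R'.flats i)) powr ?s i) = (\<Prod>i=1..r. x i powr ?s i) * ?P"
      unfolding prod.distrib[symmetric] using x
      by (intro prod.cong refl) (simp add: powr_mult less_imp_le)
    also have "?K * ((\<Prod>i=1..r. x i powr ?s i) * ?P) \<le> ?K * (real (card R') / real (card R) * ?P)"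
      by (intro mult_left_mono mult_right_mono px joints_constant_nonneg prod_nonneg) auto
    also have "\<dots> = real (card R') * (?K * ?P / real (card R))" by simp
    finally have "real (card R') * 1 \<le> real (card R') * (?K * ?P / real (card R))" by simp
    then have "1 \<le> ?K * ?P / real (card R)"
      using R'.card_R_pos by (subst (asm) mult_le_cancel_left_pos) simp_all
    then show ?thesis using card_R_pos by (simp add: le_divide_eq)
  qed
qed

lemma card_set_mset_le_size: "card (set_mset M) \<le> size M"
  using size_mset_mono[OF mset_set_set_mset_msubset[of M]] by simp

text \<open>Every coordinate \<open>j\<close> lies in some \<open>V e\<close>, and points of
  \<open>F e\<close> have \<open>j\<close>-th coordinate 0 in the frame \<open>A\<close>. So the
  origin of this frame is the only point common to all the flats, and \<open>q\<close> is such a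
  point.\<close>

lemma joint_unique:
  assumes cover: "\<And>j. \<exists>e\<in>E. j \<in> V e"
    and A: "invertible_affine A" "A 0 = p" "\<And>e. e \<in> E \<Longrightarrow> F e = A ` vec.span {axis j 1 | j. j \<notin> V e}"
    and B: "B 0 = q" "\<And>e. e \<in> E \<Longrightarrow> F e = B ` vec.span {axis j 1 | j. j \<notin> V e}"
  shows "p = q"
proof -
  have bij: "bij A" using A(1) by (simp add: invertible_affine_def)
  have "inv A q $ j = 0" for j
  proof -
    obtain e where e: "e \<in> E" "j \<in> V e" using cover by blast
    have "q \<in> F e" unfolding B(2)[OF e(1)] B(1)[symmetric] by (auto intro: vec.span_zero)
    then have "q \<in> A ` vec.span {axis j 1 | j. j \<notin> V e}" unfolding A(3)[OF e(1)] .
    then obtain x where x: "q = A x" "x \<in> vec.span {axis j 1 | j. j \<notin> V e}" by (rule imageE)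
    then show ?thesis using bij span_axis_subset[of "- V e"] e(2) by (auto simp: bij_is_inj)
  qed
  then have "inv A q = 0" by (simp add: vec_eq_iff)
  then show ?thesis using A(2) bij_is_surj[OF bij] by (metis surj_f_inv_f)
qed

theorem theorem1p12:
  fixes E :: "'e set" and V :: "'e \<Rightarrow> 'd::finite set" and c :: "'e \<Rightarrow> nat"
    and r :: nat and k :: "nat \<Rightarrow> nat" and w :: "'e \<Rightarrow> real"
    and J :: "('a::field ^ 'd) set" and \<F> :: "nat \<Rightarrow> ('a ^ 'd) set multiset"
  assumes "uniformly_edge_colored E V c r k"
    and "joints_configuration E V c r k J \<F>"
    and "\<forall>e\<in>E. w e \<ge> 0"
    and "covers E V w"
  shows "finite J \<and>
    real (card J) \<le> joints_constant E V c r k w *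
      (\<Prod>i=1..r. rpow (real (size (\<F> i))) (subtotal E c w i))"
proof -
  have J: "J = {p. is_joint E V c \<F> p}" using assms(2) by (simp add: joints_configuration_def)
  have finE: "finite E" using assms(1) by (simp add: uniformly_edge_colored_def)
  have cover: "\<exists>e\<in>E. j \<in> V e" for j
  proof (rule ccontr)
    assume "\<not> (\<exists>e\<in>E. j \<in> V e)"
    then have "{e \<in> E. j \<in> V e} = {}" by blast
    moreover have "1 \<le> (\<Sum>e\<in>{e \<in> E. j \<in> V e}. w e)" using assms(4) by (simp add: covers_def)
    ultimately show False by (metis not_one_le_zero sum.empty)
  qed
  have "\<forall>p\<in>J. \<exists>F A. (\<forall>e\<in>E. F e \<in># \<F> (c e)) \<and> invertible_affine A \<and> A 0 = p \<and>
    (\<forall>e\<in>E. F e = A ` vec.span {axis j 1 | j. j \<notin> V e})"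
    unfolding J is_joint_def by blast
  from bchoice[OF this] obtain Fl where "\<forall>p\<in>J. \<exists>A. (\<forall>e\<in>E. Fl p e \<in># \<F> (c e)) \<and>
    invertible_affine A \<and> A 0 = p \<and> (\<forall>e\<in>E. Fl p e = A ` vec.span {axis j 1 | j. j \<notin> V e})"
    by blast
  from bchoice[OF this] obtain A where "\<forall>p\<in>J. (\<forall>e\<in>E. Fl p e \<in># \<F> (c e)) \<and>
    invertible_affine (A p) \<and> A p 0 = p \<and> (\<forall>e\<in>E. Fl p e = A p ` vec.span {axis j 1 | j. j \<notin> V e})"
    by blast
  then have Fl: "\<And>p e. p \<in> J \<Longrightarrow> e \<in> E \<Longrightarrow> Fl p e \<in># \<F> (c e)"
    and A: "\<And>p. p \<in> J \<Longrightarrow> invertible_affine (A p)" "\<And>p. p \<in> J \<Longrightarrow> A p 0 = p"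
      "\<And>p e. p \<in> J \<Longrightarrow> e \<in> E \<Longrightarrow> Fl p e = A p ` vec.span {axis j 1 | j. j \<notin> V e}"
    by blast+
  \<comment> \<open>A joint is determined by its chosen flats, for which the multisets offer
    finitely many choices.\<close>
  have finJ: "finite J"
  proof (rule finite_imageD)
    have "(\<lambda>p. restrict (Fl p) E) ` J \<subseteq> (\<Pi>\<^sub>E e\<in>E. set_mset (\<F> (c e)))" using Fl by auto
    moreover have "finite (\<Pi>\<^sub>E e\<in>E. set_mset (\<F> (c e)))" using finE by (intro finite_PiE) auto
    ultimately show "finite ((\<lambda>p. restrict (Fl p) E) ` J)" by (rule finite_subset)
    show "inj_on (\<lambda>p. restrict (Fl p) E) J"
    proof (rule inj_onI)
      fix p q assume pq: "p \<in> J" "q \<in> J" "restrict (Fl p) E = restrict (Fl q) E"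
      have "Fl p e = Fl q e" if "e \<in> E" for e
        using fun_cong[OF pq(3), of e] that by simp
      then show "p = q"
        using joint_unique[OF cover A(1)[OF pq(1)] A(2)[OF pq(1)], of "Fl p" "A q" q] A(2,3) pq(1,2) by simp
    qed
  qed
  have "real (card J) \<le> joints_constant E V c r k w * (\<Prod>i=1..r. rpow (real (size (\<F> i))) (subtotal E c w i))"
  proof (cases "J = {}")
    case True
    then show ?thesis
      using joints_constant_nonneg[of E V c r k w]
      by (auto intro!: mult_nonneg_nonneg prod_nonneg simp: rpow_def)
  next
    case False
    have fam: "weighted_joint_family E V c r k J Fl A w"
      using assms(1,3,4) finJ False A by unfold_locales auto
    interpret weighted_joint_family E V c r k J Fl A w by (rule fam)
    have "real (card J) \<le> joints_constant E V c r k w * (\<Prod>i=1..r. real (card (flats i)) powr subtotal E c w i)"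
      by (rule card_joint_family_le[OF fam])
    also have "\<dots> \<le> joints_constant E V c r k w * (\<Prod>i=1..r. rpow (real (size (\<F> i))) (subtotal E c w i))"
    proof (intro mult_left_mono prod_mono conjI joints_constant_nonneg)
      fix i assume i: "i \<in> {1..r}"
      have "flats i \<subseteq> set_mset (\<F> i)" using Fl by (auto simp: flats_def)
      then have "card (flats i) \<le> size (\<F> i)"
        using card_mono[OF finite_set_mset] card_set_mset_le_size order_trans by blast
      \<comment> \<open>Since \<open>J\<close> is nonempty, \<open>card (flats i)\<close> is
        positive; so its power with exponent 0 is 1, in agreement with \<open>rpow\<close>.\<close>
      then show "real (card (flats i)) powr subtotal E c w i \<le> rpow (real (size (\<F> i))) (subtotal E c w i)"
        using card_flats_pos[OF i] subtotal_nonneg[of i] by (auto simp: rpow_def intro!: powr_mono2)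
    qed simp
    finally show ?thesis .
  qed
  with finJ show ?thesis by blast
qed

end
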